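(* In the setting below, there exist nonnegative weights $\xi_0$, $\{\xi^x_i\}_{i=1}^k$, $\{\xi^y_j\}_{j=1}^c$ summing to one (functions of the data) such that for every measurable $C\subseteq\mathbb{X}$ $$\mathbb{P}\big(X_{n+1}\in C\mid (X_i)_{i=1}^n,(Y_j)_{j=1}^m\big)=\xi_0P_0(C)+\sum_{i=1}^k\xi^x_i\delta_{X_i^*}(C)+\sum_{j=1}^c\xi^y_jR_{Y_j^*}(C).$$ Analogously there exist nonnegative weights $\eta_0$, $\{\eta^y_j\}_{j=1}^c$, $\{\eta^x_i\}_{i=1}^k$ summing to one such that $$\mathbb{P}\big(Y_{m+1}\in C\mid (X_i)_{i=1}^n,(Y_j)_{j=1}^m\big)=\eta_0P_0(C)+\sum_{j=1}^c\eta^y_j\delta_{Y_j^*}(C)+\sum_{i=1}^k\eta^x_iQ_{X_i^*}(C).$$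
   Context: FuRBI setup. $\mathbb{X}$ is a Polish space, $\theta>0$, $G_0$ a non-atomic probability measure on $\mathbb{X}^2$ with both marginals equal to $P_0$; $\rho$ a measure on $[0,\infty)^2\setminus\{(0,0)\}$ with $\int\min\{1,s_1+s_2\}\rho(\mathrm{d}s)<\infty$ whose two marginal jump measures on $(0,\infty)$ coincide and have infinite mass. $(\mu_1,\mu_2)$ is a completely random vector on $\mathbb{X}^2$ (independent evaluations on pairwise disjoint sets), with no fixed atoms or deterministic part and Lévy intensity $\theta\rho(\mathrm{d}s_1,\mathrm{d}s_2)G_0(\mathrm{d}x)$. The n-FuRBI are $\tilde p_1(A)=\mu_1(A\times\mathbb{X})/\mu_1(\mathbb{X}^2)$ and $\tilde p_2(B)=\mu_2(\mathbb{X}\times B)/\mu_2(\mathbb{X}^2)$. $G_0$ has density $g_0$ w.r.t. $\lambda\otimes\lambda$ for a σ-finite $\lambda$, $P_0$ has density $p_0$ w.r.t. $\lambda$; $Q_x(\mathrm{d}y)=g_0(x,y)\lambda(\mathrm{d}y)/p_0(x)$ (law of second coordinate given first $=x$ under $G_0$) and $R_y(\mathrm{d}x)=g_0(x,y)\lambda(\mathrm{d}x)/p_0(y)$ (law of first coordinate given second $=y$). Conditionally on $(\tilde p_1,\tilde p_2)$, $X_1,X_2,\dots$ are i.i.d. $\tilde p_1$ and $Y_1,Y_2,\dots$ i.i.d. $\tilde p_2$, independent. Given $n,m\ge1$, $X^*_1,\dots,X^*_k$ are the distinct values among $X_1,\dots,X_n$ and $Y^*_1,\dots,Y^*_c$ the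 distinct values among $Y_1,\dots,Y_m$. *)

theory Defs
  imports "HOL-Probability.Probability"
begin

definition expneg :: "ennreal \<Rightarrow> real" where
  "expneg t = (if t = \<infinity> then 0 else exp (- enn2real t))"

definition nmarg1 :: "('a \<times> 'a) measure \<Rightarrow> 'a set \<Rightarrow> real" where
  "nmarg1 mu A = enn2real (emeasure mu (A \<times> UNIV) / emeasure mu UNIV)"

definition nmarg2 :: "('a \<times> 'a) measure \<Rightarrow> 'a set \<Rightarrow> real" where
  "nmarg2 mu B = enn2real (emeasure mu (UNIV \<times> B) / emeasure mu UNIV)"

text \<open>Q_x: law of second coordinate given first = x;  R_y: law of first coordinate given second = y.\<close>
definition Qker :: "'a measure \<Rightarrow> ('a \<times> 'a \<Rightarrow> real) \<Rightarrow> ('a \<Rightarrow> real) \<Rightarrow> 'a \<Rightarrow> 'a measure" where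
  "Qker lam g0 p0 x = density lam (\<lambda>y. ennreal (g0 (x, y) / p0 x))"

definition Rker :: "'a measure \<Rightarrow> ('a \<times> 'a \<Rightarrow> real) \<Rightarrow> ('a \<Rightarrow> real) \<Rightarrow> 'a \<Rightarrow> 'a measure" where
  "Rker lam g0 p0 y = density lam (\<lambda>x. ennreal (g0 (x, y) / p0 y))"

definition gen_sigma :: "'w measure \<Rightarrow> ('w \<Rightarrow> 'b::topological_space) set \<Rightarrow> 'w measure" where
  "gen_sigma M Fs = sigma (space M) {f -` B \<inter> space M | f B. f \<in> Fs \<and> B \<in> sets borel}"

end

theory Submission
  imports Defs
begin

text \<open>
  Think of \<open>X\<^sub>1, X\<^sub>2, \<dots>\<close> and \<open>Y\<^sub>1, Y\<^sub>2, \<dots>\<close> as draws of atoms of \<open>(\<mu>1, \<mu>2)\<close>, of which only one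
  coordinate of the location is observed. The new draw \<open>k0\<close> shares its atom with some set \<open>S\<close> of
  the data indices, and the common location is then distributed according to \<open>G0\<close>, independently
  of the remaining data. If \<open>S\<close> is empty, the new observation has law \<open>P0\<close>; if \<open>S\<close> contains an
  index of the same sample, the new observation repeats a value; otherwise only the other coordinate
  of the location is known, and the new observation has law \<open>R\<^sub>y\<close> (or \<open>Q\<^sub>x\<close>). The
  weights are the conditional probabilities of the sets \<open>S\<close> given the data.

  No series representation of \<open>(\<mu>1, \<mu>2)\<close> is needed to make this precise. Differentiating the
  Laplace functional gives a recursion for mixed moments that are damped by
  \<open>exp (- u \<mu>1(\<X>\<^sup>2) - v \<mu>2(\<X>\<^sup>2))\<close>, in which the sum runs over the sets \<open>S\<close>; integrating over
  \<open>u\<close> and \<open>v\<close> against powers produces the normalisation, and conditioning the resulting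
  weights on the normalised measures turns the products of their evaluations back into laws of
  observations.
\<close>

section \<open>Moments of random vectors with a Laplace exponent\<close>

text \<open>The set \<open>S\<close> is not a random variable on the given probability space. What
  can be obtained is a decomposition of the law of the data into finitely many measures indexed by
  \<open>S\<close>; the weights are their Radon-Nikodym densities with respect to that law. They are
  the same for every \<open>C\<close> because these measures do not involve \<open>C\<close>.

  The recursion is applied only once, to the index \<open>k0\<close>. The indices outside its block
  stay together in a single moment of smaller order, so no sum over partitions arises.

  Two facts shape the analysis. The Levy measure is infinite, so integrability always has to come
  from that of \<open>1 - exp (- t)\<close>, and derivatives of the exponent are limits of integrals
  of increments. Moreover \<open>1 / T ^ a\<close> is a gamma integral of
  \<open>exp (- u * T)\<close> only for \<open>a \<ge> 1\<close>, which is where the nonemptiness of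
  both samples enters.\<close>

lemma one_minus_exp_bounds:
  fixes x :: real
  assumes "x \<ge> 0"
  shows "x * exp (- x) \<le> 1 - exp (- x)" "1 - exp (- x) \<le> x" "0 \<le> 1 - exp (- x)"
proof -
  have "(1 + x) * exp (- x) \<le> exp x * exp (- x)"
    by (intro mult_right_mono exp_ge_add_one_self) auto
  then show "x * exp (- x) \<le> 1 - exp (- x)"
    by (simp add: exp_minus field_simps)
  show "1 - exp (- x) \<le> x"
    using exp_ge_add_one_self[of "- x"] by simp
  show "0 \<le> 1 - exp (- x)" using assms by simp
qed

text \<open>Two tools for domination. Under a probability measure the constant bound suffices; under
  an infinite jump measure, products of jump sizes have to be bounded by a multiple of
  \<open>1 - exp (- t)\<close>, which takes at least one factor \<open>t\<close>, hence
  \<open>Suc k\<close>.\<close>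

lemma power_times_exp_neg_bounds:
  fixes t :: real
  assumes "t \<ge> 0"
  shows "t ^ k * exp (- t) \<le> fact k"
    and "t ^ Suc k * exp (- t) \<le> exp 1 * fact (Suc k) * (1 - exp (- t))"
proof -
  have *: "t ^ k \<le> fact k * exp t" if "t \<ge> 0" for t :: real and k
  proof -
    have "(\<lambda>n. t ^ n /\<^sub>R fact n) sums exp t" by (rule exp_converges)
    then have s: "summable (\<lambda>n. t ^ n /\<^sub>R fact n)" "exp t = (\<Sum>n. t ^ n /\<^sub>R fact n)"
      by (auto simp: sums_iff)
    have "sum (\<lambda>n. t ^ n /\<^sub>R fact n) {k} \<le> (\<Sum>n. t ^ n /\<^sub>R fact n)"
      using that by (intro sum_le_suminf s) auto
    then have "t ^ k /\<^sub>R fact k \<le> exp t" using s by simp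
    then show ?thesis by (simp add: field_simps)
  qed
  show "t ^ k * exp (- t) \<le> fact k"
    using *[OF assms, of k] by (simp add: exp_minus field_simps)
  have "t ^ Suc k * exp (- t) = t ^ k * (t * exp (- t))" by simp
  \<comment> \<open>By \<open>t * exp (- t) \<le> 1 - exp (- t)\<close>, one factor \<open>t\<close>
    can be exchanged for \<open>(1 + t) * (1 - exp (- t))\<close>. Then
    \<open>(1 + t) ^ Suc k \<le> fact (Suc k) * exp (1 + t)\<close> cancels \<open>exp (- t)\<close>
    and leaves the constant \<open>exp 1\<close>.\<close>
  have "t * (1 - exp (- t)) \<ge> t - (1 - exp (- t))"
    using one_minus_exp_bounds(1)[OF assms] by (simp add: algebra_simps)
  then have "t \<le> (1 + t) * (1 - exp (- t))" by (simp add: algebra_simps)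
  then have "t ^ Suc k * exp (- t) \<le> t ^ k * ((1 + t) * (1 - exp (- t))) * exp (- t)"
    using assms by (simp add: mult_left_mono mult.assoc mult.left_commute[of t])
  also have "\<dots> \<le> (1 + t) ^ k * ((1 + t) * (1 - exp (- t))) * exp (- t)"
    using assms by (intro mult_right_mono power_mono) auto
  also have "\<dots> = (1 + t) ^ Suc k * (1 - exp (- t)) * exp (- t)" by simp
  also have "\<dots> \<le> (fact (Suc k) * exp (1 + t)) * (1 - exp (- t)) * exp (- t)"
    using assms by (intro mult_right_mono *) auto
  also have "\<dots> = exp 1 * fact (Suc k) * (1 - exp (- t))"
    by (simp add: exp_add exp_minus field_simps)
  finally show "t ^ Suc k * exp (- t) \<le> exp 1 * fact (Suc k) * (1 - exp (- t))" .
qed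

text \<open>Squeezed between \<open>Suc k * x k * exp (- x k)\<close> and
  \<open>Suc k * x k\<close>; convergence of the latter to a finite limit forces \<open>x k\<close>
  to tend to 0.\<close>

lemma exp_difference_quotient:
  fixes x :: "nat \<Rightarrow> real"
  assumes nn: "\<And>k. x k \<ge> 0" and lim: "(\<lambda>k. real (Suc k) * x k) \<longlonglongrightarrow> d"
  shows "(\<lambda>k. real (Suc k) * (1 - exp (- x k))) \<longlonglongrightarrow> d"
proof (rule tendsto_sandwich)
  have "(\<lambda>k. inverse (real (Suc k)) * (real (Suc k) * x k)) \<longlonglongrightarrow> 0 * d"
    by (intro tendsto_mult lim LIMSEQ_inverse_real_of_nat)
  then have "x \<longlonglongrightarrow> 0" by (simp add: mult.assoc[symmetric] del: of_nat_Suc)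
  then have "(\<lambda>k. (real (Suc k) * x k) * exp (- x k)) \<longlonglongrightarrow> d * exp (- 0)"
    by (intro tendsto_intros lim)
  then show "(\<lambda>k. (real (Suc k) * x k) * exp (- x k)) \<longlonglongrightarrow> d" by simp
  show "(\<lambda>k. real (Suc k) * x k) \<longlonglongrightarrow> d" by fact
  show "\<forall>\<^sub>F k in sequentially. (real (Suc k) * x k) * exp (- x k) \<le> real (Suc k) * (1 - exp (- x k))"
    using one_minus_exp_bounds(1)[OF nn] by (auto intro!: always_eventually mult_left_mono simp: mult.assoc simp del: of_nat_Suc)
  show "\<forall>\<^sub>F k in sequentially. real (Suc k) * (1 - exp (- x k)) \<le> real (Suc k) * x k"
    using one_minus_exp_bounds(2)[OF nn] by (auto intro!: always_eventually mult_left_mono simp del: of_nat_Suc)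
qed

text \<open>Differentiation under the integral sign along the steps \<open>1 / Suc k\<close>,
  dominated by \<open>F * g\<close>. Integrability is asked of \<open>F * g\<close> and not of
  \<open>F\<close>: in the case of the Laplace exponent, \<open>F\<close> is an exponential and need
  not be integrable against an infinite measure.\<close>

lemma integral_difference_quotient:
  fixes F g :: "'b \<Rightarrow> real"
  assumes [measurable]: "F \<in> borel_measurable M" "g \<in> borel_measurable M"
    and nn: "\<And>x. F x \<ge> 0" "\<And>x. g x \<ge> 0" and int: "integrable M (\<lambda>x. F x * g x)"
  shows "integrable M (\<lambda>x. F x * (1 - exp (- (g x / real (Suc k)))))"
    and "(\<lambda>k. real (Suc k) * (\<integral>x. F x * (1 - exp (- (g x / real (Suc k)))) \<partial>M)) \<longlonglongrightarrow> (\<integral>x. F x * g x \<partial>M)"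
proof -
  have b: "real (Suc k) * (F x * (1 - exp (- (g x / real (Suc k))))) \<le> F x * g x"
     "0 \<le> F x * (1 - exp (- (g x / real (Suc k))))" for x k
  proof -
    have "real (Suc k) * (F x * (1 - exp (- (g x / real (Suc k))))) \<le> real (Suc k) * (F x * (g x / real (Suc k)))"
      using nn by (intro mult_left_mono one_minus_exp_bounds) auto
    then show "real (Suc k) * (F x * (1 - exp (- (g x / real (Suc k))))) \<le> F x * g x"
      by (simp del: of_nat_Suc)
    show "0 \<le> F x * (1 - exp (- (g x / real (Suc k))))"
      using nn by auto
  qed
  have b': "F x * (1 - exp (- (g x / real (Suc k)))) \<le> F x * g x" for x k
  proof -
    have "1 * (F x * (1 - exp (- (g x / real (Suc k))))) \<le> real (Suc k) * (F x * (1 - exp (- (g x / real (Suc k)))))"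
      using b(2)[of x k] by (intro mult_right_mono) auto
    then show ?thesis using b(1)[of k x] by linarith
  qed
  show "integrable M (\<lambda>x. F x * (1 - exp (- (g x / real (Suc k)))))"
    by (rule Bochner_Integration.integrable_bound[OF int]) (use b(2) b' in \<open>auto simp del: of_nat_Suc intro!: AE_I2 order_trans[OF _ abs_ge_self]\<close>)
  have "(\<lambda>k. \<integral>x. real (Suc k) * (F x * (1 - exp (- (g x / real (Suc k))))) \<partial>M) \<longlonglongrightarrow> (\<integral>x. F x * g x \<partial>M)"
  proof (rule integral_dominated_convergence[where w="\<lambda>x. F x * g x"])
    show "AE x in M. (\<lambda>k. real (Suc k) * (F x * (1 - exp (- (g x / real (Suc k)))))) \<longlonglongrightarrow> F x * g x"
    proof (rule AE_I2)
      fix x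
      have "(\<lambda>k. real (Suc k) * (1 - exp (- (g x / real (Suc k))))) \<longlonglongrightarrow> g x"
        by (rule exp_difference_quotient) (use nn in \<open>auto simp del: of_nat_Suc\<close>)
      then have "(\<lambda>k. F x * (real (Suc k) * (1 - exp (- (g x / real (Suc k)))))) \<longlonglongrightarrow> F x * g x"
        by (intro tendsto_intros)
      then show "(\<lambda>k. real (Suc k) * (F x * (1 - exp (- (g x / real (Suc k)))))) \<longlonglongrightarrow> F x * g x"
        by (simp add: mult.left_commute del: of_nat_Suc)
    qed
    show "AE x in M. norm (real (Suc k) * (F x * (1 - exp (- (g x / real (Suc k)))))) \<le> F x * g x" for k
    proof (rule AE_I2)
      fix x
      have "0 \<le> real (Suc k) * (F x * (1 - exp (- (g x / real (Suc k)))))" using b(2) by auto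
      then show "norm (real (Suc k) * (F x * (1 - exp (- (g x / real (Suc k)))))) \<le> F x * g x"
        using b(1)[of k x] by (simp only: real_norm_def abs_of_nonneg)
    qed
  qed (use int in \<open>auto\<close>)
  then show "(\<lambda>k. real (Suc k) * (\<integral>x. F x * (1 - exp (- (g x / real (Suc k)))) \<partial>M)) \<longlonglongrightarrow> (\<integral>x. F x * g x \<partial>M)"
    by (simp del: of_nat_Suc)
qed

text \<open>Differentiability implies continuity, along the chosen sequence; the product rule needs
  it for the factor taken at the shifted parameter.\<close>

lemma tendsto_of_scaled_difference:
  assumes "(\<lambda>k. real (Suc k) * (f - g k)) \<longlonglongrightarrow> d"
  shows "g \<longlonglongrightarrow> (f::real)"
proof -
  have "(\<lambda>k. inverse (real (Suc k)) * (real (Suc k) * (f - g k))) \<longlonglongrightarrow> 0 * d"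
    by (intro tendsto_mult assms LIMSEQ_inverse_real_of_nat)
  then have "(\<lambda>k. f - g k) \<longlonglongrightarrow> 0" by (simp add: mult.assoc[symmetric] del: of_nat_Suc)
  then have "(\<lambda>k. f - (f - g k)) \<longlonglongrightarrow> f - 0" by (intro tendsto_intros)
  then show ?thesis by simp
qed

text \<open>An abstract Poisson functional: \<nu> is the intensity of the atoms and
  \<open>\<phi> i z\<close> the contribution of an atom \<open>z\<close> to \<open>N i\<close>. The
  form of the Laplace transform is all that the recursion uses about random measures.\<close>

locale laplace_vector =
  fixes M :: "'w measure" and \<nu> :: "'z measure" and J :: "'i set"
    and N :: "'i \<Rightarrow> 'w \<Rightarrow> real" and \<phi> :: "'i \<Rightarrow> 'z \<Rightarrow> real"
  assumes prob: "prob_space M" and finJ: "finite J"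
    and N_meas[measurable]: "\<And>i. N i \<in> borel_measurable M" and N_nn: "\<And>i \<omega>. N i \<omega> \<ge> 0"
    and \<phi>_meas[measurable]: "\<And>i. \<phi> i \<in> borel_measurable \<nu>" and \<phi>_nn: "\<And>i z. \<phi> i z \<ge> 0"
    and exponent_int: "\<And>c. (\<And>i. c i \<ge> 0) \<Longrightarrow> integrable \<nu> (\<lambda>z. 1 - exp (- (\<Sum>i\<in>J. c i * \<phi> i z)))"
    and laplace: "\<And>c. (\<And>i. c i \<ge> 0) \<Longrightarrow> (\<integral>\<omega>. exp (- (\<Sum>i\<in>J. c i * N i \<omega>)) \<partial>M)
                     = exp (- (\<integral>z. 1 - exp (- (\<Sum>i\<in>J. c i * \<phi> i z)) \<partial>\<nu>))"
begin

text \<open>In the application \<open>c\<close> is positive only at the two total masses. What makes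
  moments finite is that the damping exponent controls every coordinate pointwise.\<close>

definition admissible :: "('i \<Rightarrow> real) \<Rightarrow> bool" where
  "admissible c \<longleftrightarrow> (\<forall>i. c i \<ge> 0) \<and> (\<exists>K\<ge>0. \<forall>i\<in>J. (\<forall>\<omega>. N i \<omega> \<le> K * (\<Sum>j\<in>J. c j * N j \<omega>))
                                              \<and> (\<forall>z. \<phi> i z \<le> K * (\<Sum>j\<in>J. c j * \<phi> j z)))"

text \<open>Up to sign, the mixed partial derivative of the Laplace transform in the coordinates
  \<open>I\<close>; for nonempty \<open>I\<close>, \<open>cumulant I\<close> is that of its
  exponent.\<close>

definition moment :: "'i set \<Rightarrow> ('i \<Rightarrow> real) \<Rightarrow> real" where
  "moment I c = (\<integral>\<omega>. (\<Prod>i\<in>I. N i \<omega>) * exp (- (\<Sum>j\<in>J. c j * N j \<omega>)) \<partial>M)"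

definition cumulant :: "'i set \<Rightarrow> ('i \<Rightarrow> real) \<Rightarrow> real" where
  "cumulant I c = (\<integral>z. (\<Prod>i\<in>I. \<phi> i z) * exp (- (\<Sum>j\<in>J. c j * \<phi> j z)) \<partial>\<nu>)"

definition bump :: "'i \<Rightarrow> nat \<Rightarrow> ('i \<Rightarrow> real) \<Rightarrow> 'i \<Rightarrow> real" where
  "bump j k c = c(j := c j + inverse (real (Suc k)))"

lemma sum_bump:
  assumes "j \<in> J"
  shows "(\<Sum>i\<in>J. bump j k c i * f i) = (\<Sum>i\<in>J. c i * f i) + f j / real (Suc k)"
proof -
  have "(\<Sum>i\<in>J. bump j k c i * f i) = (\<Sum>i\<in>J. c i * f i + (if i = j then f j / real (Suc k) else 0))"
    by (intro sum.cong) (auto simp: bump_def field_simps simp del: of_nat_Suc)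
  then show ?thesis using assms finJ by (simp add: sum.distrib)
qed

lemma admissible_bump:
  assumes "admissible c" "j \<in> J"
  shows "admissible (bump j k c)"
proof -
  from assms obtain K where K: "K \<ge> 0" "\<And>i \<omega>. i \<in> J \<Longrightarrow> N i \<omega> \<le> K * (\<Sum>j\<in>J. c j * N j \<omega>)"
     "\<And>i z. i \<in> J \<Longrightarrow> \<phi> i z \<le> K * (\<Sum>j\<in>J. c j * \<phi> j z)" "\<And>i. c i \<ge> 0"
    unfolding admissible_def by blast
  have "N i \<omega> \<le> K * (\<Sum>i\<in>J. bump j k c i * N i \<omega>)" if "i \<in> J" for i \<omega>
    unfolding sum_bump[OF assms(2)]
    by (rule order_trans[OF K(2)[OF that]]) (use K(1) N_nn in \<open>auto intro!: mult_left_mono\<close>)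
  moreover have "\<phi> i z \<le> K * (\<Sum>i\<in>J. bump j k c i * \<phi> i z)" if "i \<in> J" for i z
    unfolding sum_bump[OF assms(2)]
    by (rule order_trans[OF K(3)[OF that]]) (use K(1) \<phi>_nn in \<open>auto intro!: mult_left_mono\<close>)
  moreover have "bump j k c i \<ge> 0" for i
    using K(4) by (auto simp: bump_def simp del: of_nat_Suc)
  ultimately show ?thesis using K(1) unfolding admissible_def by blast
qed

text \<open>With \<open>t\<close> the damping exponent, every factor is at most
  \<open>K * t\<close>, and \<open>t ^ card I * exp (- t)\<close> is bounded.\<close>

lemma moment_integrable:
  assumes "admissible c" "I \<subseteq> J"
  shows "integrable M (\<lambda>\<omega>. (\<Prod>i\<in>I. N i \<omega>) * exp (- (\<Sum>j\<in>J. c j * N j \<omega>)))"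
proof -
  interpret prob_space M by (rule prob)
  from assms obtain K where K: "K \<ge> 0" "\<And>i \<omega>. i \<in> J \<Longrightarrow> N i \<omega> \<le> K * (\<Sum>j\<in>J. c j * N j \<omega>)" "\<And>i. c i \<ge> 0"
    unfolding admissible_def by blast
  show ?thesis
  proof (rule integrable_const_bound[where B="K ^ card I * fact (card I)"])
    show "AE \<omega> in M. norm ((\<Prod>i\<in>I. N i \<omega>) * exp (- (\<Sum>j\<in>J. c j * N j \<omega>))) \<le> K ^ card I * fact (card I)"
    proof (rule AE_I2)
      fix \<omega>
      define t where "t = (\<Sum>j\<in>J. c j * N j \<omega>)"
      have t: "t \<ge> 0" unfolding t_def using K N_nn by (auto intro!: sum_nonneg)
      have "(\<Prod>i\<in>I. N i \<omega>) \<le> (\<Prod>i\<in>I. K * t)"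
        using K assms N_nn by (intro prod_mono) (auto simp: t_def)
      then have "(\<Prod>i\<in>I. N i \<omega>) * exp (- t) \<le> (K * t) ^ card I * exp (- t)"
        by (intro mult_right_mono) auto
      also have "\<dots> = K ^ card I * (t ^ card I * exp (- t))" by (simp add: power_mult_distrib)
      also have "\<dots> \<le> K ^ card I * fact (card I)"
        using K t by (intro mult_left_mono power_times_exp_neg_bounds) auto
      finally show "norm ((\<Prod>i\<in>I. N i \<omega>) * exp (- (\<Sum>j\<in>J. c j * N j \<omega>))) \<le> K ^ card I * fact (card I)"
        using N_nn by (auto simp: t_def[symmetric] abs_mult prod_nonneg)
    qed
  qed measurable
qed

text \<open>As for moments, but \<nu> may be infinite: a nonempty \<open>I\<close> supplies the
  factor \<open>t\<close> that is needed to dominate by \<open>1 - exp (- t)\<close>, which is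
  integrable by \<open>exponent_int\<close>.\<close>

lemma cumulant_integrable:
  assumes "admissible c" "I \<subseteq> J" "I \<noteq> {}"
  shows "integrable \<nu> (\<lambda>z. (\<Prod>i\<in>I. \<phi> i z) * exp (- (\<Sum>j\<in>J. c j * \<phi> j z)))"
proof -
  from assms obtain K where K: "K \<ge> 0" "\<And>i z. i \<in> J \<Longrightarrow> \<phi> i z \<le> K * (\<Sum>j\<in>J. c j * \<phi> j z)" "\<And>i. c i \<ge> 0"
    unfolding admissible_def by blast
  have "finite I" using assms finJ finite_subset by blast
  with assms obtain l where l: "card I = Suc l" by (metis card_0_eq not0_implies_Suc)
  define D where "D = K ^ card I * (exp 1 * fact (card I))"
  show ?thesis
  proof (rule Bochner_Integration.integrable_bound)
    show "integrable \<nu> (\<lambda>z. D * (1 - exp (- (\<Sum>j\<in>J. c j * \<phi> j z))))"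
      using exponent_int[OF K(3)] by simp
    show "AE z in \<nu>. norm ((\<Prod>i\<in>I. \<phi> i z) * exp (- (\<Sum>j\<in>J. c j * \<phi> j z))) \<le> norm (D * (1 - exp (- (\<Sum>j\<in>J. c j * \<phi> j z))))"
    proof (rule AE_I2)
      fix z
      define t where "t = (\<Sum>j\<in>J. c j * \<phi> j z)"
      have t: "t \<ge> 0" unfolding t_def using K \<phi>_nn by (auto intro!: sum_nonneg)
      have "(\<Prod>i\<in>I. \<phi> i z) \<le> (\<Prod>i\<in>I. K * t)"
        using K assms \<phi>_nn by (intro prod_mono) (auto simp: t_def)
      then have "(\<Prod>i\<in>I. \<phi> i z) * exp (- t) \<le> (K * t) ^ card I * exp (- t)"
        by (intro mult_right_mono) auto
      also have "\<dots> = K ^ card I * (t ^ card I * exp (- t))" by (simp add: power_mult_distrib)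
      also have "\<dots> \<le> K ^ card I * (exp 1 * fact (card I) * (1 - exp (- t)))"
        using K t unfolding l by (intro mult_left_mono power_times_exp_neg_bounds) auto
      also have "\<dots> = D * (1 - exp (- t))" by (simp add: D_def)
      finally show "norm ((\<Prod>i\<in>I. \<phi> i z) * exp (- (\<Sum>j\<in>J. c j * \<phi> j z))) \<le> norm (D * (1 - exp (- (\<Sum>j\<in>J. c j * \<phi> j z))))"
        using \<phi>_nn abs_ge_self[of "D * (1 - exp (- t))"] by (simp add: t_def[symmetric] abs_mult prod_nonneg)
    qed
  qed measurable
qed

lemma moment_quotient:
  assumes "admissible c" "I \<subseteq> J" "j \<in> J" "j \<notin> I"
  shows "(\<lambda>k. real (Suc k) * (moment I c - moment I (bump j k c))) \<longlonglongrightarrow> moment (insert j I) c"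
proof -
  have fI: "finite I" using assms finJ finite_subset by blast
  let ?F = "\<lambda>\<omega>. (\<Prod>i\<in>I. N i \<omega>) * exp (- (\<Sum>j\<in>J. c j * N j \<omega>))"
  have ins: "?F \<omega> * N j \<omega> = (\<Prod>i\<in>insert j I. N i \<omega>) * exp (- (\<Sum>j\<in>J. c j * N j \<omega>))" for \<omega>
    using fI assms by simp
  have int: "integrable M (\<lambda>\<omega>. ?F \<omega> * N j \<omega>)"
    unfolding ins by (rule moment_integrable) (use assms in auto)
  have "(\<lambda>k. real (Suc k) * (\<integral>\<omega>. ?F \<omega> * (1 - exp (- (N j \<omega> / real (Suc k)))) \<partial>M)) \<longlonglongrightarrow> (\<integral>\<omega>. ?F \<omega> * N j \<omega> \<partial>M)"
    by (rule integral_difference_quotient) (use N_nn int in \<open>auto intro!: mult_nonneg_nonneg prod_nonneg\<close>)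
  moreover have "(\<integral>\<omega>. ?F \<omega> * (1 - exp (- (N j \<omega> / real (Suc k)))) \<partial>M) = moment I c - moment I (bump j k c)" for k
  proof -
    have "moment I c - moment I (bump j k c) = (\<integral>\<omega>. ?F \<omega> - (\<Prod>i\<in>I. N i \<omega>) * exp (- (\<Sum>i\<in>J. bump j k c i * N i \<omega>)) \<partial>M)"
      unfolding moment_def
      by (intro Bochner_Integration.integral_diff[symmetric] moment_integrable admissible_bump assms)
    also have "\<dots> = (\<integral>\<omega>. ?F \<omega> * (1 - exp (- (N j \<omega> / real (Suc k)))) \<partial>M)"
      unfolding sum_bump[OF assms(3)] by (intro Bochner_Integration.integral_cong) (auto simp: algebra_simps exp_add[symmetric] simp del: of_nat_Suc)
    finally show ?thesis ..
  qed
  ultimately show ?thesis unfolding ins moment_def by simp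
qed

lemma cumulant_quotient:
  assumes "admissible c" "I \<subseteq> J" "j \<in> J" "j \<notin> I" "I \<noteq> {}"
  shows "(\<lambda>k. real (Suc k) * (cumulant I c - cumulant I (bump j k c))) \<longlonglongrightarrow> cumulant (insert j I) c"
proof -
  have fI: "finite I" using assms finJ finite_subset by blast
  let ?F = "\<lambda>\<omega>. (\<Prod>i\<in>I. \<phi> i \<omega>) * exp (- (\<Sum>j\<in>J. c j * \<phi> j \<omega>))"
  have ins: "?F \<omega> * \<phi> j \<omega> = (\<Prod>i\<in>insert j I. \<phi> i \<omega>) * exp (- (\<Sum>j\<in>J. c j * \<phi> j \<omega>))" for \<omega>
    using fI assms by simp
  have int: "integrable \<nu> (\<lambda>\<omega>. ?F \<omega> * \<phi> j \<omega>)"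
    unfolding ins by (rule cumulant_integrable) (use assms in auto)
  have "(\<lambda>k. real (Suc k) * (\<integral>\<omega>. ?F \<omega> * (1 - exp (- (\<phi> j \<omega> / real (Suc k)))) \<partial>\<nu>)) \<longlonglongrightarrow> (\<integral>\<omega>. ?F \<omega> * \<phi> j \<omega> \<partial>\<nu>)"
    by (rule integral_difference_quotient) (use \<phi>_nn int in \<open>auto intro!: mult_nonneg_nonneg prod_nonneg\<close>)
  moreover have "(\<integral>\<omega>. ?F \<omega> * (1 - exp (- (\<phi> j \<omega> / real (Suc k)))) \<partial>\<nu>) = cumulant I c - cumulant I (bump j k c)" for k
  proof -
    have "cumulant I c - cumulant I (bump j k c) = (\<integral>\<omega>. ?F \<omega> - (\<Prod>i\<in>I. \<phi> i \<omega>) * exp (- (\<Sum>i\<in>J. bump j k c i * \<phi> i \<omega>)) \<partial>\<nu>)"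
      unfolding cumulant_def
      by (intro Bochner_Integration.integral_diff[symmetric] cumulant_integrable admissible_bump assms)
    also have "\<dots> = (\<integral>\<omega>. ?F \<omega> * (1 - exp (- (\<phi> j \<omega> / real (Suc k)))) \<partial>\<nu>)"
      unfolding sum_bump[OF assms(3)] by (intro Bochner_Integration.integral_cong) (auto simp: algebra_simps exp_add[symmetric] simp del: of_nat_Suc)
    finally show ?thesis ..
  qed
  ultimately show ?thesis unfolding ins cumulant_def by simp
qed

text \<open>Chain rule for \<open>exp (- L c)\<close>. The integrand of \<open>cumulant {}\<close>
  need not be integrable, so the increments of the exponent \<open>L\<close> are computed directly
  rather than by \<open>cumulant_quotient\<close>.\<close>

lemma moment_singleton:
  assumes c: "admissible c" and i: "i \<in> J"
  shows "moment {i} c = cumulant {i} c * moment {} c"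
proof -
  have c0: "\<And>i. c i \<ge> 0" using c unfolding admissible_def by blast
  have b0: "bump i k c j \<ge> 0" for k j using admissible_bump[OF c i] unfolding admissible_def by blast
  define L where "L c = (\<integral>z. 1 - exp (- (\<Sum>i\<in>J. c i * \<phi> i z)) \<partial>\<nu>)" for c :: "'i \<Rightarrow> real"
  have L: "moment {} c = exp (- L c)" if "\<And>i. c i \<ge> 0" for c
    using laplace[OF that] by (simp add: moment_def L_def)
  let ?F = "\<lambda>z. exp (- (\<Sum>j\<in>J. c j * \<phi> j z))"
  have int: "integrable \<nu> (\<lambda>z. ?F z * \<phi> i z)"
    using cumulant_integrable[OF c, of "{i}"] i by (simp add: mult.commute)
  have diff: "L (bump i k c) - L c = (\<integral>z. ?F z * (1 - exp (- (\<phi> i z / real (Suc k)))) \<partial>\<nu>)" for k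
  proof -
    have "L (bump i k c) - L c = (\<integral>z. (1 - exp (- (\<Sum>j\<in>J. bump i k c j * \<phi> j z))) - (1 - ?F z) \<partial>\<nu>)"
      unfolding L_def by (intro Bochner_Integration.integral_diff[symmetric] exponent_int c0 b0)
    also have "\<dots> = (\<integral>z. ?F z * (1 - exp (- (\<phi> i z / real (Suc k)))) \<partial>\<nu>)"
      unfolding sum_bump[OF i] by (intro Bochner_Integration.integral_cong) (auto simp: algebra_simps exp_add[symmetric] simp del: of_nat_Suc)
    finally show ?thesis .
  qed
  have "(\<lambda>k. real (Suc k) * (L (bump i k c) - L c)) \<longlonglongrightarrow> (\<integral>z. ?F z * \<phi> i z \<partial>\<nu>)"
    unfolding diff by (rule integral_difference_quotient) (use \<phi>_nn int in auto)
  then have "(\<lambda>k. real (Suc k) * (L (bump i k c) - L c)) \<longlonglongrightarrow> cumulant {i} c"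
    by (simp add: cumulant_def mult.commute)
  moreover have "L (bump i k c) - L c \<ge> 0" for k
    unfolding diff by (rule Bochner_Integration.integral_nonneg) (use \<phi>_nn in auto)
  ultimately have "(\<lambda>k. real (Suc k) * (1 - exp (- (L (bump i k c) - L c)))) \<longlonglongrightarrow> cumulant {i} c"
    by (intro exp_difference_quotient)
  then have "(\<lambda>k. exp (- L c) * (real (Suc k) * (1 - exp (- (L (bump i k c) - L c))))) \<longlonglongrightarrow> exp (- L c) * cumulant {i} c"
    by (intro tendsto_intros)
  moreover have "exp (- L c) * (real (Suc k) * (1 - exp (- (L (bump i k c) - L c)))) = real (Suc k) * (moment {} c - moment {} (bump i k c))" for k
    unfolding L[OF c0] L[OF b0] by (simp add: algebra_simps exp_add[symmetric] del: of_nat_Suc)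
  ultimately have "(\<lambda>k. real (Suc k) * (moment {} c - moment {} (bump i k c))) \<longlonglongrightarrow> exp (- L c) * cumulant {i} c"
    by (simp only:)
  moreover have "(\<lambda>k. real (Suc k) * (moment {} c - moment {} (bump i k c))) \<longlonglongrightarrow> moment {i} c"
    by (rule moment_quotient) (use c i in auto)
  ultimately have "moment {i} c = exp (- L c) * cumulant {i} c" by (rule LIMSEQ_unique[rotated])
  then show ?thesis unfolding L[OF c0] by (simp only: mult.commute)
qed

text \<open>Leibniz rule. Differentiating the Laplace transform in \<open>i0\<close> gives one
  cumulant times the transform. Each further derivative, in \<open>j \<in> I\<close>, hits either
  the cumulant, so that \<open>j\<close> joins the block of \<open>i0\<close>, or the remaining
  moment; \<open>S\<close> records the indices that joined.\<close>

lemma moment_recursion: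
  assumes i0: "i0 \<in> J" and I: "I \<subseteq> J" "i0 \<notin> I" and c: "admissible c"
  shows "moment (insert i0 I) c = (\<Sum>S\<in>Pow I. cumulant (insert i0 S) c * moment (I - S) c)"
proof -
  have "finite I" using I finJ finite_subset by blast
  then show ?thesis using I c
  proof (induction I arbitrary: c rule: finite_induct)
    case empty
    then show ?case using moment_singleton[OF _ i0] by simp
  next
    case (insert j I)
    have j: "j \<in> J" "I \<subseteq> J" "j \<noteq> i0" "i0 \<notin> I" using insert by auto
    let ?t = "\<lambda>S c. cumulant (insert i0 S) c * moment (I - S) c"
    let ?D = "\<lambda>S. cumulant (insert i0 (insert j S)) c * moment (I - S) c
                 + cumulant (insert i0 S) c * moment (insert j (I - S)) c"
    have summand: "(\<lambda>k. real (Suc k) * (?t S c - ?t S (bump j k c))) \<longlonglongrightarrow> ?D S" if S: "S \<in> Pow I" for S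
    proof -
      have 1: "(\<lambda>k. real (Suc k) * (cumulant (insert i0 S) c - cumulant (insert i0 S) (bump j k c)))
             \<longlonglongrightarrow> cumulant (insert j (insert i0 S)) c"
        by (rule cumulant_quotient) (use insert j i0 S in auto)
      have 2: "(\<lambda>k. real (Suc k) * (moment (I - S) c - moment (I - S) (bump j k c)))
             \<longlonglongrightarrow> moment (insert j (I - S)) c"
        by (rule moment_quotient) (use insert j i0 S in auto)
      \<comment> \<open>Product rule for increments:
        \<open>f * g - f' * g' = (f - f') * g' + f * (g - g')\<close>. The shifted factor
        \<open>g'\<close> converges to \<open>g\<close> because its difference quotient has a
        limit.\<close>
      have "(\<lambda>k. (real (Suc k) * (cumulant (insert i0 S) c - cumulant (insert i0 S) (bump j k c))) * moment (I - S) (bump j k c)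
            + cumulant (insert i0 S) c * (real (Suc k) * (moment (I - S) c - moment (I - S) (bump j k c))))
          \<longlonglongrightarrow> cumulant (insert j (insert i0 S)) c * moment (I - S) c + cumulant (insert i0 S) c * moment (insert j (I - S)) c"
        by (intro tendsto_intros 1 2 tendsto_of_scaled_difference[OF 2])
      moreover have "(real (Suc k) * (cumulant (insert i0 S) c - cumulant (insert i0 S) (bump j k c))) * moment (I - S) (bump j k c)
            + cumulant (insert i0 S) c * (real (Suc k) * (moment (I - S) c - moment (I - S) (bump j k c)))
          = real (Suc k) * (?t S c - ?t S (bump j k c))" for k
        by (simp only: ring_distribs mult_ac)
      ultimately show ?thesis by (simp only: insert_commute[of i0 j S])
    qed
    have "(\<lambda>k. real (Suc k) * (moment (insert i0 I) c - moment (insert i0 I) (bump j k c))) \<longlonglongrightarrow> moment (insert j (insert i0 I)) c"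
      by (rule moment_quotient) (use insert j i0 in auto)
    moreover have "real (Suc k) * (moment (insert i0 I) c - moment (insert i0 I) (bump j k c))
           = (\<Sum>S\<in>Pow I. real (Suc k) * (?t S c - ?t S (bump j k c)))" for k
      unfolding insert.IH[OF j(2,4) insert.prems(3)]
        insert.IH[OF j(2,4) admissible_bump[OF insert.prems(3) j(1)]]
      by (simp only: sum_subtractf sum_distrib_left right_diff_distrib)
    moreover have "(\<lambda>k. \<Sum>S\<in>Pow I. real (Suc k) * (?t S c - ?t S (bump j k c))) \<longlonglongrightarrow> (\<Sum>S\<in>Pow I. ?D S)"
      by (intro tendsto_sum summand)
    ultimately have "moment (insert j (insert i0 I)) c = (\<Sum>S\<in>Pow I. ?D S)"
      by (simp only:) (rule LIMSEQ_unique)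
    then have "moment (insert i0 (insert j I)) c = (\<Sum>S\<in>Pow I. ?D S)"
      by (simp only: insert_commute[of i0 j I])
    also have "\<dots> = (\<Sum>S\<in>Pow (insert j I). cumulant (insert i0 S) c * moment (insert j I - S) c)"
    proof -
      \<comment> \<open>Sets without \<open>j\<close> match the derivative of the moment, sets with
        \<open>j\<close> that of the cumulant.\<close>
      have inj: "inj_on (insert j) (Pow I)" using insert.hyps by (auto simp: inj_on_def)
      have "(\<Sum>S\<in>Pow (insert j I). cumulant (insert i0 S) c * moment (insert j I - S) c)
         = (\<Sum>S\<in>Pow I. cumulant (insert i0 S) c * moment (insert j I - S) c)
         + (\<Sum>S\<in>insert j ` Pow I. cumulant (insert i0 S) c * moment (insert j I - S) c)"
        unfolding Pow_insert by (rule sum.union_disjoint) (use insert.hyps in auto)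
      also have "(\<Sum>S\<in>insert j ` Pow I. cumulant (insert i0 S) c * moment (insert j I - S) c)
          = (\<Sum>S\<in>Pow I. cumulant (insert i0 (insert j S)) c * moment (I - S) c)"
        unfolding sum.reindex[OF inj] o_def
        by (intro sum.cong refl arg_cong2[where f="(*)"] arg_cong2[where f=moment]) (use insert.hyps in auto)
      also have "(\<Sum>S\<in>Pow I. cumulant (insert i0 S) c * moment (insert j I - S) c)
          = (\<Sum>S\<in>Pow I. cumulant (insert i0 S) c * moment (insert j (I - S)) c)"
        by (intro sum.cong refl arg_cong2[where f="(*)"] arg_cong2[where f=moment]) (use insert.hyps in auto)
      finally show ?thesis by (simp add: sum.distrib)
    qed
    finally show ?case .
  qed
qed

end

lemma one_minus_exp_le_min:
  fixes a b x y C :: real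
  assumes "0 \<le> a" "0 \<le> b" "0 \<le> x" "0 \<le> y" "a \<le> C" "b \<le> C" "1 \<le> C"
  shows "1 - exp (- (a * x + b * y)) \<le> C * min 1 (x + y)"
proof -
  have "a * x + b * y \<le> C * x + C * y" using assms by (intro add_mono mult_right_mono) auto
  moreover have "1 - exp (- (a * x + b * y)) \<le> a * x + b * y"
    using assms by (intro one_minus_exp_bounds) auto
  ultimately have "1 - exp (- (a * x + b * y)) \<le> C * (x + y)" by (simp add: algebra_simps)
  moreover have "1 - exp (- (a * x + b * y)) \<le> C * 1" using assms by (smt (verit) exp_ge_zero)
  ultimately show ?thesis by (auto simp: min_def)
qed

lemma expneg_bounds: "0 \<le> expneg t" "expneg t \<le> 1"
  by (auto simp: expneg_def)

lemma measurable_expneg[measurable]: "expneg \<in> borel_measurable borel"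
  unfolding expneg_def[abs_def] by measurable

lemma expneg_ennreal: "0 \<le> t \<Longrightarrow> expneg (ennreal t) = exp (- t)"
  by (simp add: expneg_def)

section \<open>The random masses\<close>

text \<open>Observations are indexed by pairs: \<open>(True, i)\<close> stands for \<open>X i\<close> and \<open>(False, j)\<close> for \<open>Y j\<close>. Indices start at 1.\<close>

definition coord :: "bool \<Rightarrow> 'a \<times> 'a \<Rightarrow> 'a" where
  "coord b q = (if b then fst q else snd q)"

lemma measurable_coord[measurable]: "coord b \<in> measurable (L \<Otimes>\<^sub>M L) L"
  by (cases b) (simp_all add: coord_def[abs_def])

text \<open>\<open>G0\<close>, \<open>P0\<close> and \<open>Fp\<close> are parameters tied to their
  formulas by equations, so that the interpretation in the theorem speaks about the abbreviations
  used there.\<close>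

locale furbi = prob_space M for M :: "'w measure" +
  fixes lam :: "'a::polish_space measure"
    and g0 :: "'a \<times> 'a \<Rightarrow> real" and p0 :: "'a \<Rightarrow> real"
    and \<theta> :: real
    and \<rho> :: "(real \<times> real) measure"
    and \<mu>1 \<mu>2 :: "'w \<Rightarrow> ('a \<times> 'a) measure"
    and X Y :: "nat \<Rightarrow> 'w \<Rightarrow> 'a"
    and G0 :: "('a \<times> 'a) measure" and P0 :: "'a measure" and Fp :: "'w measure"
  assumes G0_eq: "G0 = density (lam \<Otimes>\<^sub>M lam) (\<lambda>z. ennreal (g0 z))"
    and P0_eq: "P0 = density lam (\<lambda>x. ennreal (p0 x))"
    and Fp_eq: "Fp = gen_sigma M ({(\<lambda>\<omega>. nmarg1 (\<mu>1 \<omega>) A) | A. A \<in> sets borel}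
                            \<union> {(\<lambda>\<omega>. nmarg2 (\<mu>2 \<omega>) B) | B. B \<in> sets borel})"
    and lam_sets[measurable_cong]: "sets lam = sets borel" and lam_sf: "sigma_finite_measure lam"
    and g0_meas[measurable]: "g0 \<in> borel_measurable (lam \<Otimes>\<^sub>M lam)" and g0_nn: "\<And>z. g0 z \<ge> 0"
    and p0_meas[measurable]: "p0 \<in> borel_measurable lam" and p0_nn: "\<And>x. p0 x \<ge> 0"
    and G0_prob: "prob_space G0"
    and G0_fst: "distr G0 lam fst = P0" and G0_snd: "distr G0 lam snd = P0"
    and \<theta>_pos: "\<theta> > 0"
    and \<rho>_sets[measurable_cong]: "sets \<rho> = sets borel"
    and \<rho>_supp: "emeasure \<rho> (UNIV - ({0..} \<times> {0..} - {(0, 0)})) = 0"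
    and \<rho>_int: "(\<integral>\<^sup>+ s. ennreal (min 1 (fst s + snd s)) \<partial>\<rho>) < \<infinity>"
    and \<rho>_marg: "\<And>B. B \<in> sets borel \<Longrightarrow> B \<subseteq> {0<..} \<Longrightarrow>
                   emeasure \<rho> {s. fst s \<in> B} = emeasure \<rho> {s. snd s \<in> B}"
    and \<rho>_inf: "emeasure \<rho> {s. fst s > 0} = \<infinity>"
    and \<mu>_sets: "\<And>\<omega>. sets (\<mu>1 \<omega>) = sets (borel \<Otimes>\<^sub>M borel)"
                "\<And>\<omega>. sets (\<mu>2 \<omega>) = sets (borel \<Otimes>\<^sub>M borel)"
    and \<mu>_meas: "\<And>A. A \<in> sets (borel \<Otimes>\<^sub>M borel) \<Longrightarrow>
                   (\<lambda>\<omega>. emeasure (\<mu>1 \<omega>) A) \<in> borel_measurable M"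
                "\<And>A. A \<in> sets (borel \<Otimes>\<^sub>M borel) \<Longrightarrow>
                   (\<lambda>\<omega>. emeasure (\<mu>2 \<omega>) A) \<in> borel_measurable M"
    and \<mu>_laplace: "\<And>(r::nat) (A::nat \<Rightarrow> ('a \<times> 'a) set) (l1::nat \<Rightarrow> real) (l2::nat \<Rightarrow> real).
          (\<forall>i<r. A i \<in> sets (borel \<Otimes>\<^sub>M borel)) \<Longrightarrow> disjoint_family_on A {..<r} \<Longrightarrow>
          (\<forall>i<r. l1 i \<ge> 0 \<and> l2 i \<ge> 0) \<Longrightarrow>
          (\<integral>\<omega>. (\<Prod>i<r. expneg (ennreal (l1 i) * emeasure (\<mu>1 \<omega>) (A i)
                                 + ennreal (l2 i) * emeasure (\<mu>2 \<omega>) (A i))) \<partial>M)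
          = (\<Prod>i<r. exp (- (\<theta> * measure G0 (A i) *
               enn2real (\<integral>\<^sup>+ s. ennreal (1 - exp (- (l1 i * fst s + l2 i * snd s))) \<partial>\<rho>))))"
    and X_meas[measurable]: "\<And>i. X i \<in> measurable M borel" and Y_meas[measurable]: "\<And>j. Y j \<in> measurable M borel"
    and cond_iid: "\<And>(N::nat) (A::nat \<Rightarrow> 'a set) (B::nat \<Rightarrow> 'a set) E.
          (\<forall>i. A i \<in> sets borel) \<Longrightarrow> (\<forall>j. B j \<in> sets borel) \<Longrightarrow> E \<in> sets Fp \<Longrightarrow>
          measure M ({\<omega> \<in> space M. (\<forall>i\<in>{1..N}. X i \<omega> \<in> A i) \<and> (\<forall>j\<in>{1..N}. Y j \<omega> \<in> B j)} \<inter> E)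
          = (\<integral>\<omega>. indicator E \<omega> * (\<Prod>i\<in>{1..N}. nmarg1 (\<mu>1 \<omega>) (A i))
                                 * (\<Prod>j\<in>{1..N}. nmarg2 (\<mu>2 \<omega>) (B j)) \<partial>M)"
begin

sublocale G0: prob_space G0 by (rule G0_prob)
sublocale lam: sigma_finite_measure lam by (rule lam_sf)

lemma G0_sets[measurable_cong]: "sets G0 = sets (borel \<Otimes>\<^sub>M borel)"
proof -
  have "sets (lam \<Otimes>\<^sub>M lam) = sets (borel \<Otimes>\<^sub>M borel)"
    by (intro sets_pair_measure_cong lam_sets)
  then show ?thesis by (simp add: G0_eq)
qed

lemma space_G0[simp]: "space G0 = UNIV"
  using sets_eq_imp_space_eq[OF G0_sets] by (simp add: space_pair_measure)

lemma space_lam[simp]: "space lam = UNIV"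
  using sets_eq_imp_space_eq[OF lam_sets] by simp

lemma space_\<rho>[simp]: "space \<rho> = UNIV"
  using sets_eq_imp_space_eq[OF \<rho>_sets] by simp

definition mu :: "bool \<Rightarrow> 'w \<Rightarrow> ('a \<times> 'a) measure" where
  "mu b = (if b then \<mu>1 else \<mu>2)"

lemma mu_sets[measurable_cong]: "sets (mu b \<omega>) = sets (borel \<Otimes>\<^sub>M borel)"
  using \<mu>_sets by (simp add: mu_def)

lemma space_mu[simp]: "space (mu b \<omega>) = UNIV"
  using sets_eq_imp_space_eq[OF mu_sets] by (simp add: space_pair_measure)

lemma emeasure_mu_measurable[measurable]:
  "A \<in> sets (borel \<Otimes>\<^sub>M borel) \<Longrightarrow> (\<lambda>\<omega>. emeasure (mu b \<omega>) A) \<in> borel_measurable M"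
  using \<mu>_meas by (simp add: mu_def)

text \<open>The truncation at 0 changes nothing \<rho>-almost everywhere and makes jump sizes
  nonnegative at every point, as \<open>laplace_vector\<close> demands.\<close>

definition pick :: "bool \<Rightarrow> real \<times> real \<Rightarrow> real" where
  "pick b s = max 0 (if b then fst s else snd s)"

lemma pick_nonneg[simp]: "0 \<le> pick b s" by (simp add: pick_def)

lemma measurable_pick[measurable]: "pick b \<in> borel_measurable \<rho>"
proof -
  have "pick b \<in> borel_measurable (borel \<Otimes>\<^sub>M borel)"
    by (cases b) (auto simp: pick_def[abs_def])
  then show ?thesis by (simp add: borel_prod measurable_cong_sets[OF \<rho>_sets refl])
qed

lemma AE_\<rho>: "AE s in \<rho>. fst s = pick True s \<and> snd s = pick False s \<and> pick True s + pick False s > 0"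
proof -
  have "({0..} \<times> {0..} - {(0, 0)}) \<in> sets (borel \<Otimes>\<^sub>M borel :: (real \<times> real) measure)"
    unfolding borel_prod by (intro sets.Diff borel_closed closed_Times) auto
  then have "UNIV - ({0..} \<times> {0..} - {(0, 0)}) \<in> sets \<rho>"
    unfolding borel_prod \<rho>_sets by (metis sets.compl_sets space_borel)
  then have "AE s in \<rho>. s \<notin> UNIV - ({0..} \<times> {0..} - {(0, 0)})"
    using \<rho>_supp by (intro AE_not_in) auto
  then show ?thesis
    by eventually_elim (auto simp: pick_def)
qed

section \<open>The Laplace exponent of the jump measure\<close>

definition \<psi> :: "real \<Rightarrow> real \<Rightarrow> ennreal" where
  "\<psi> a b = (\<integral>\<^sup>+ s. ennreal (1 - exp (- (a * pick True s + b * pick False s))) \<partial>\<rho>)"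

lemma \<psi>_alt: "(\<integral>\<^sup>+ s. ennreal (1 - exp (- (a * fst s + b * snd s))) \<partial>\<rho>) = \<psi> a b"
  unfolding \<psi>_def
proof (rule nn_integral_cong_AE)
  show "AE s in \<rho>. ennreal (1 - exp (- (a * fst s + b * snd s))) = ennreal (1 - exp (- (a * pick True s + b * pick False s)))"
    using AE_\<rho> by eventually_elim simp
qed

lemma \<rho>_int': "(\<integral>\<^sup>+ s. ennreal (min 1 (pick True s + pick False s)) \<partial>\<rho>) < \<infinity>"
proof -
  have "(\<integral>\<^sup>+ s. ennreal (min 1 (pick True s + pick False s)) \<partial>\<rho>) = (\<integral>\<^sup>+ s. ennreal (min 1 (fst s + snd s)) \<partial>\<rho>)"
  proof (rule nn_integral_cong_AE)
    show "AE s in \<rho>. ennreal (min 1 (pick True s + pick False s)) = ennreal (min 1 (fst s + snd s))"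
      using AE_\<rho> by eventually_elim simp
  qed
  then show ?thesis using \<rho>_int by simp
qed

lemma \<psi>_finite:
  assumes "0 \<le> a" "0 \<le> b"
  shows "\<psi> a b < \<infinity>"
proof -
  define C where "C = max 1 (max a b)"
  have "\<psi> a b \<le> (\<integral>\<^sup>+ s. ennreal C * ennreal (min 1 (pick True s + pick False s)) \<partial>\<rho>)"
    unfolding \<psi>_def
  proof (rule nn_integral_mono)
    fix s
    have "1 - exp (- (a * pick True s + b * pick False s)) \<le> C * min 1 (pick True s + pick False s)"
      by (rule one_minus_exp_le_min) (use assms in \<open>auto simp: C_def\<close>)
    then show "ennreal (1 - exp (- (a * pick True s + b * pick False s))) \<le> ennreal C * ennreal (min 1 (pick True s + pick False s))"
      by (subst ennreal_mult'[symmetric]) (auto simp: C_def intro!: ennreal_leI)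
  qed
  also have "\<dots> = ennreal C * (\<integral>\<^sup>+ s. ennreal (min 1 (pick True s + pick False s)) \<partial>\<rho>)"
    by (rule nn_integral_cmult) measurable
  also have "\<dots> < \<infinity>" using \<rho>_int' by (simp add: ennreal_mult_less_top)
  finally show ?thesis .
qed

text \<open>Gives the measurability of \<rho>-integrals that depend on a parameter. The sets where
  \<open>min 1 (s1 + s2)\<close> exceeds \<open>1 / Suc k\<close> have finite measure by Markov's
  inequality; what they leave out is null by the support condition.\<close>

sublocale \<rho>: sigma_finite_measure \<rho>
proof (unfold_locales, intro exI conjI)
  define f where "f s = min 1 (pick True s + pick False s)" for s
  have [measurable]: "f \<in> borel_measurable \<rho>" unfolding f_def[abs_def] by measurable
  define A where "A k = {s. inverse (real (Suc k)) < f s}" for k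
  define A0 where "A0 = {s. f s \<le> 0}"
  have [measurable]: "A k \<in> sets \<rho>" for k
    unfolding A_def using measurable_sets[of f \<rho> borel "{inverse (real (Suc k))<..}"] by (simp add: vimage_def)
  have A0[measurable]: "A0 \<in> sets \<rho>"
    unfolding A0_def using measurable_sets[of f \<rho> borel "{..0}"] by (simp add: vimage_def)
  show "countable (insert A0 (range A))" by simp
  show "insert A0 (range A) \<subseteq> sets \<rho>" by auto
  show "\<Union> (insert A0 (range A)) = space \<rho>"
  proof -
    have "s \<in> A0 \<or> (\<exists>k. s \<in> A k)" for s
      using reals_Archimedean[of "f s"] unfolding A_def A0_def by (cases "f s > 0") auto
    then show ?thesis by auto
  qed
  show "\<forall>a\<in>insert A0 (range A). emeasure \<rho> a \<noteq> \<infinity>"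
  proof safe
    assume "emeasure \<rho> A0 = \<infinity>"
    moreover have "AE s in \<rho>. s \<notin> A0" using AE_\<rho> by eventually_elim (auto simp: A0_def f_def)
    then have "emeasure \<rho> A0 = 0" using A0 by (subst (asm) AE_iff_measurable[OF A0]) auto
    ultimately show False by simp
  next
    fix k assume inf: "emeasure \<rho> (A k) = \<infinity>"
    have "emeasure \<rho> (A k) = (\<integral>\<^sup>+s. indicator (A k) s \<partial>\<rho>)" by simp
    also have "\<dots> \<le> (\<integral>\<^sup>+s. ennreal (real (Suc k)) * ennreal (f s) \<partial>\<rho>)"
    proof (rule nn_integral_mono)
      fix s
      show "indicator (A k) s \<le> ennreal (real (Suc k)) * ennreal (f s)"
      proof (cases "s \<in> A k")
        case True
        then have "1 \<le> real (Suc k) * f s" by (simp add: A_def field_simps del: of_nat_Suc)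
        then have "ennreal 1 \<le> ennreal (real (Suc k) * f s)" by (rule ennreal_leI)
        then show ?thesis using True by (simp add: ennreal_mult' del: of_nat_Suc)
      qed auto
    qed
    also have "\<dots> = ennreal (real (Suc k)) * (\<integral>\<^sup>+s. ennreal (f s) \<partial>\<rho>)"
      by (rule nn_integral_cmult) measurable
    also have "\<dots> < \<infinity>" using \<rho>_int' by (simp add: ennreal_mult_less_top f_def)
    finally show False using inf by simp
  qed
qed

text \<open>Off this event of full probability, \<open>nmarg1\<close> and \<open>nmarg2\<close> take junk values.\<close>

definition good :: "'w \<Rightarrow> bool" where
  "good \<omega> \<longleftrightarrow> (\<forall>b. 0 < emeasure (mu b \<omega>) UNIV \<and> emeasure (mu b \<omega>) UNIV < \<infinity>)"

lemma UNIV_sets2[measurable, simp]: "(UNIV :: ('a \<times> 'a) set) \<in> sets (borel \<Otimes>\<^sub>M borel)"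
  using sets.top[of "borel \<Otimes>\<^sub>M borel :: ('a \<times> 'a) measure"] by (simp add: space_pair_measure)

lemma good_measurable[measurable]: "Measurable.pred M good"
  unfolding good_def[abs_def] by measurable

lemma measure_G0_UNIV[simp]: "measure G0 UNIV = 1"
  using G0.prob_space by simp

section \<open>The total masses are almost surely positive and finite\<close>

definition \<psi>b :: "bool \<Rightarrow> real \<Rightarrow> ennreal" where
  "\<psi>b b l = (if b then \<psi> l 0 else \<psi> 0 l)"

lemma \<psi>b_alt: "\<psi>b b l = (\<integral>\<^sup>+ s. ennreal (1 - exp (- (l * pick b s))) \<partial>\<rho>)"
  by (cases b) (auto simp: \<psi>b_def \<psi>_def)

lemma laplace_total:
  assumes "l \<ge> 0"
  shows "(\<integral>\<omega>. expneg (ennreal l * emeasure (mu b \<omega>) UNIV) \<partial>M) = exp (- (\<theta> * enn2real (\<psi>b b l)))"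
  using \<mu>_laplace[of 1 "\<lambda>_. UNIV" "\<lambda>_. if b then l else 0" "\<lambda>_. if b then 0 else l"] assms
  using \<psi>_alt[of l 0] \<psi>_alt[of 0 l]
  by (cases b) (simp_all add: mu_def \<psi>b_def disjoint_family_on_def)

lemma expneg_integrable: "f \<in> borel_measurable M \<Longrightarrow> integrable M (\<lambda>\<omega>. expneg (f \<omega>))"
  by (rule integrable_const_bound[where B=1]) (use expneg_bounds in auto)

lemma \<rho>_inf_pick: "emeasure \<rho> {s. pick b s > 0} = \<infinity>"
  using \<rho>_inf \<rho>_marg[of "{0<..}"] by (cases b) (auto simp: pick_def less_max_iff_disj)

text \<open>For the total mass \<open>T\<close> and every \<open>l\<close>, the probability of
  \<open>T = 0\<close> is at most the expectation of \<open>exp (- l * T)\<close>, that is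
  \<open>exp (- \<theta> * \<psi>b b l)\<close>. As \<open>l\<close> grows,
  \<open>\<psi>b b l\<close> increases to the mass of the jumps that are positive on side
  \<open>b\<close>, which is infinite.\<close>

lemma AE_total_pos: "AE \<omega> in M. 0 < emeasure (mu b \<omega>) UNIV"
proof -
  let ?Z = "{\<omega>\<in>space M. emeasure (mu b \<omega>) UNIV = 0}"
  have le: "prob ?Z \<le> exp (- (\<theta> * enn2real (\<psi>b b l)))" if "l \<ge> 0" for l
  proof -
    have "prob ?Z = (\<integral>\<omega>. indicator ?Z \<omega> \<partial>M)" by simp
    also have "\<dots> \<le> (\<integral>\<omega>. expneg (ennreal l * emeasure (mu b \<omega>) UNIV) \<partial>M)"
    proof (rule integral_mono)
      show "indicator ?Z \<omega> \<le> expneg (ennreal l * emeasure (mu b \<omega>) UNIV)" for \<omega>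
        using expneg_bounds by (auto split: split_indicator) (auto simp: expneg_def)
    qed (auto intro!: expneg_integrable simp: emeasure_eq_measure)
    finally show ?thesis using laplace_total[OF that] by simp
  qed
  have "(\<lambda>k. \<integral>\<^sup>+ s. ennreal (1 - exp (- (real k * pick b s))) \<partial>\<rho>) \<longlonglongrightarrow> (\<integral>\<^sup>+ s. indicator {s. pick b s > 0} s \<partial>\<rho>)"
  proof (rule nn_integral_LIMSEQ)
    show "incseq (\<lambda>k s. ennreal (1 - exp (- (real k * pick b s))))"
      by (auto simp: incseq_def le_fun_def intro!: ennreal_leI mult_right_mono)
    show "(\<lambda>k. ennreal (1 - exp (- (real k * pick b s)))) \<longlonglongrightarrow> indicator {s. pick b s > 0} s" for s
    proof (cases "pick b s > 0")
      case True
      have "(\<lambda>k. exp (- pick b s) ^ k) \<longlonglongrightarrow> 0"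
        using True by (intro LIMSEQ_realpow_zero) auto
      then have "(\<lambda>k. 1 - exp (- (real k * pick b s))) \<longlonglongrightarrow> 1 - 0"
        by (intro tendsto_intros) (simp add: exp_of_nat_mult[symmetric])
      then have "(\<lambda>k. ennreal (1 - exp (- (real k * pick b s)))) \<longlonglongrightarrow> ennreal 1"
        by (intro tendsto_ennrealI) simp
      then show ?thesis using True by simp
    next
      case False
      then have "pick b s = 0" using pick_nonneg[of b s] by linarith
      then show ?thesis by simp
    qed
  qed measurable
  moreover have "{s. pick b s > 0} \<in> sets \<rho>"
    using measurable_sets[OF measurable_pick, of "{0<..}"] by (simp add: vimage_def)
  ultimately have lim: "(\<lambda>k. \<psi>b b (real k)) \<longlonglongrightarrow> \<infinity>"
    using \<rho>_inf_pick by (simp add: \<psi>b_alt)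
  have "prob ?Z = 0"
  proof (rule ccontr)
    assume "prob ?Z \<noteq> 0"
    then have pos: "prob ?Z > 0" by (simp add: zero_less_measure_iff)
    \<comment> \<open>Solves \<open>exp (- \<theta> * R) = prob ?Z * exp (- 1)\<close>; an exponent
      above \<open>R\<close> contradicts the bound \<open>le\<close>.\<close>
    define R where "R = (1 - ln (prob ?Z)) / \<theta>"
    have "ln (prob ?Z) \<le> 0" using pos by simp
    then have R: "R \<ge> 0" unfolding R_def using \<theta>_pos by (intro divide_nonneg_pos) auto
    have "eventually (\<lambda>k. ennreal R < \<psi>b b (real k)) sequentially"
      using order_tendstoD(1)[OF lim, of "ennreal R"] by simp
    then obtain k where k: "ennreal R < \<psi>b b (real k)"
      using eventually_happens'[OF sequentially_bot] by blast
    have "\<psi>b b (real k) < \<infinity>" using \<psi>_finite by (auto simp: \<psi>b_def)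
    then have "R \<le> enn2real (\<psi>b b (real k))"
      using k R by (cases "\<psi>b b (real k)") (auto simp: ennreal_less_iff)
    then have "exp (- (\<theta> * enn2real (\<psi>b b (real k)))) \<le> exp (- (\<theta> * R))" using \<theta>_pos by simp
    also have "\<dots> = exp (ln (prob ?Z) - 1)" using \<theta>_pos by (simp add: R_def)
    also have "\<dots> = prob ?Z * exp (- 1)" using pos by (simp add: exp_diff exp_minus field_simps)
    also have "\<dots> < prob ?Z" using pos by simp
    finally show False using le[of "real k"] by simp
  qed
  then have "AE \<omega> in M. \<omega> \<notin> ?Z" by (simp add: prob_eq_0)
  then show ?thesis using AE_space by eventually_elim (auto simp: zero_less_iff_neq_zero)
qed

text \<open>For \<open>l > 0\<close>, the probability of a finite total mass is at least the
  expectation of \<open>exp (- l * T)\<close>, which tends to 1 as \<open>l\<close> tends to 0,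
  since the exponent vanishes in the limit by dominated convergence.\<close>

lemma AE_total_finite: "AE \<omega> in M. emeasure (mu b \<omega>) UNIV < \<infinity>"
proof -
  let ?Z = "{\<omega>\<in>space M. emeasure (mu b \<omega>) UNIV < \<infinity>}"
  have le: "exp (- (\<theta> * enn2real (\<psi>b b l))) \<le> prob ?Z" if "l > 0" for l
  proof -
    have "(\<integral>\<omega>. expneg (ennreal l * emeasure (mu b \<omega>) UNIV) \<partial>M) \<le> (\<integral>\<omega>. indicator ?Z \<omega> \<partial>M)"
    proof (rule integral_mono)
      show "expneg (ennreal l * emeasure (mu b \<omega>) UNIV) \<le> indicator ?Z \<omega>" if "\<omega> \<in> space M" for \<omega>
      proof (cases "emeasure (mu b \<omega>) UNIV = \<infinity>")
        case True
        \<comment> \<open>Strict positivity of \<open>l\<close> matters: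
          \<open>0 * \<infinity> = 0\<close> would make the left side equal to 1.\<close>
        then show ?thesis using \<open>l > 0\<close> by (simp add: expneg_def ennreal_mult_top)
      next
        case False
        then show ?thesis using that expneg_bounds(2) by (simp add: less_top)
      qed
    qed (auto intro!: expneg_integrable simp: emeasure_eq_measure)
    then show ?thesis using laplace_total[of l b] that by simp
  qed
  have "(\<lambda>k. \<integral>\<^sup>+ s. ennreal (1 - exp (- (inverse (real (Suc k)) * pick b s))) \<partial>\<rho>) \<longlonglongrightarrow> (\<integral>\<^sup>+ s. 0 \<partial>\<rho>)"
  proof (rule nn_integral_dominated_convergence[where w="\<lambda>s. ennreal (min 1 (pick True s + pick False s))"])
    show "AE s in \<rho>. ennreal (1 - exp (- (inverse (real (Suc k)) * pick b s))) \<le> ennreal (min 1 (pick True s + pick False s))" for k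
    proof (intro AE_I2 ennreal_leI)
      fix s
      have i: "0 \<le> inverse (real (Suc k))" "inverse (real (Suc k)) \<le> 1" by (auto simp: field_simps)
      show "1 - exp (- (inverse (real (Suc k)) * pick b s)) \<le> min 1 (pick True s + pick False s)"
        using one_minus_exp_le_min[of "if b then inverse (real (Suc k)) else 0" "if b then 0 else inverse (real (Suc k))" "pick True s" "pick False s" 1] i
        by (cases b) (auto simp del: of_nat_Suc)
    qed
    show "AE s in \<rho>. (\<lambda>k. ennreal (1 - exp (- (inverse (real (Suc k)) * pick b s)))) \<longlonglongrightarrow> 0"
    proof (rule AE_I2)
      fix s
      have "(\<lambda>k. 1 - exp (- (inverse (real (Suc k)) * pick b s))) \<longlonglongrightarrow> 1 - exp (- (0 * pick b s))"
        by (intro tendsto_intros LIMSEQ_inverse_real_of_nat)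
      then have "(\<lambda>k. ennreal (1 - exp (- (inverse (real (Suc k)) * pick b s)))) \<longlonglongrightarrow> ennreal 0"
        by (intro tendsto_ennrealI) simp
      then show "(\<lambda>k. ennreal (1 - exp (- (inverse (real (Suc k)) * pick b s)))) \<longlonglongrightarrow> 0" by simp
    qed
  qed (use \<rho>_int' in auto)
  then have "(\<lambda>k. \<psi>b b (inverse (real (Suc k)))) \<longlonglongrightarrow> ennreal 0" by (simp add: \<psi>b_alt)
  then have "(\<lambda>k. enn2real (\<psi>b b (inverse (real (Suc k))))) \<longlonglongrightarrow> 0"
    by (rule tendsto_enn2real) auto
  then have "(\<lambda>k. exp (- (\<theta> * enn2real (\<psi>b b (inverse (real (Suc k))))))) \<longlonglongrightarrow> exp (- (\<theta> * 0))"
    by (intro tendsto_exp tendsto_minus tendsto_mult tendsto_const)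
  then have "exp (- (\<theta> * 0)) \<le> prob ?Z"
    by (rule LIMSEQ_le_const2) (use le in \<open>auto simp del: of_nat_Suc\<close>)
  then have "prob ?Z = 1" using prob_le_1 by (intro antisym) auto
  then have "AE \<omega> in M. \<omega> \<in> ?Z" by (subst (asm) prob_eq_1) auto
  then show ?thesis by eventually_elim auto
qed

lemma AE_good: "AE \<omega> in M. good \<omega>"
proof -
  have "AE \<omega> in M. \<forall>b\<in>{True,False}. 0 < emeasure (mu b \<omega>) UNIV \<and> emeasure (mu b \<omega>) UNIV < \<infinity>"
    using AE_total_pos AE_total_finite by (intro AE_finite_allI) (auto intro: AE_conjI)
  then show ?thesis by eventually_elim (auto simp: good_def all_bool_eq)
qed


text \<open>Zero off \<open>good\<close>, so that finiteness and monotonicity hold at every point: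
  the domination in \<open>admissible\<close> is pointwise and not almost sure.\<close>

definition mass :: "bool \<Rightarrow> 'a set \<Rightarrow> 'w \<Rightarrow> real" where
  "mass b A \<omega> = (if good \<omega> then measure (mu b \<omega>) (coord b -` A) else 0)"

lemma coord_vimage_sets[measurable]:
  "A \<in> sets borel \<Longrightarrow> coord b -` A \<in> sets (borel \<Otimes>\<^sub>M borel)"
  using measurable_sets[OF measurable_coord, of A borel b] by (simp add: space_pair_measure)

lemma mass_measurable[measurable]:
  assumes [measurable]: "A \<in> sets borel"
  shows "mass b A \<in> borel_measurable M"
proof -
  have "mass b A = (\<lambda>\<omega>. if good \<omega> then enn2real (emeasure (mu b \<omega>) (coord b -` A)) else 0)"
    by (auto simp: mass_def measure_def)
  also have "\<dots> \<in> borel_measurable M" by measurable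
  finally show ?thesis .
qed

lemma mass_nonneg[simp]: "0 \<le> mass b A \<omega>" by (simp add: mass_def)

lemma good_finite: "good \<omega> \<Longrightarrow> finite_measure (mu b \<omega>)"
  by (rule finite_measureI) (simp add: good_def less_top[symmetric])

lemma good_emeasure: "good \<omega> \<Longrightarrow> emeasure (mu b \<omega>) A = ennreal (measure (mu b \<omega>) A)"
  using finite_measure.emeasure_eq_measure[OF good_finite] .

lemma mass_le: "A \<in> sets borel \<Longrightarrow> mass b A \<omega> \<le> mass b UNIV \<omega>"
  by (auto simp: mass_def mu_sets intro!: finite_measure.finite_measure_mono[OF good_finite])

section \<open>Laplace transforms of the masses of overlapping sets\<close>

definition \<nu> :: "((real \<times> real) \<times> ('a \<times> 'a)) measure" where
  "\<nu> = density \<rho> (\<lambda>_. ennreal \<theta>) \<Otimes>\<^sub>M G0"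

lemma \<nu>_sets[measurable_cong]: "sets \<nu> = sets (\<rho> \<Otimes>\<^sub>M G0)"
  unfolding \<nu>_def by (intro sets_pair_measure_cong) auto

lemma nn_integral_\<nu>_product:
  assumes [measurable]: "f \<in> borel_measurable \<rho>" "g \<in> borel_measurable G0"
  shows "(\<integral>\<^sup>+z. f (fst z) * g (snd z) \<partial>\<nu>) = ennreal \<theta> * (\<integral>\<^sup>+s. f s \<partial>\<rho>) * (\<integral>\<^sup>+q. g q \<partial>G0)"
proof -
  have "(\<integral>\<^sup>+z. f (fst z) * g (snd z) \<partial>\<nu>) = (\<integral>\<^sup>+s. \<integral>\<^sup>+q. f s * g q \<partial>G0 \<partial>density \<rho> (\<lambda>_. ennreal \<theta>))"
    unfolding \<nu>_def by (subst G0.nn_integral_fst[symmetric]) auto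
  also have "\<dots> = (\<integral>\<^sup>+s. f s * (\<integral>\<^sup>+q. g q \<partial>G0) \<partial>density \<rho> (\<lambda>_. ennreal \<theta>))"
    by (simp add: nn_integral_cmult)
  also have "\<dots> = (\<integral>\<^sup>+s. f s \<partial>density \<rho> (\<lambda>_. ennreal \<theta>)) * (\<integral>\<^sup>+q. g q \<partial>G0)"
    by (rule nn_integral_multc) simp
  also have "(\<integral>\<^sup>+s. f s \<partial>density \<rho> (\<lambda>_. ennreal \<theta>)) = ennreal \<theta> * (\<integral>\<^sup>+s. f s \<partial>\<rho>)"
    by (simp add: nn_integral_density nn_integral_cmult)
  finally show ?thesis .
qed

text \<open>What an atom with jump sizes \<open>fst z\<close> at location \<open>snd z\<close> adds
  to the mass of \<open>B k\<close> on the side \<open>fst k\<close>.\<close>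

definition jump :: "(bool \<times> nat \<Rightarrow> 'a set) \<Rightarrow> bool \<times> nat \<Rightarrow> (real \<times> real) \<times> ('a \<times> 'a) \<Rightarrow> real" where
  "jump B k z = pick (fst k) (fst z) * indicator (B k) (coord (fst k) (snd z))"

lemma jump_nonneg[simp]: "0 \<le> jump B k z" by (simp add: jump_def)

lemma jump_measurable[measurable]:
  assumes [measurable]: "B k \<in> sets borel"
  shows "jump B k \<in> borel_measurable \<nu>"
  unfolding jump_def[abs_def] by measurable

text \<open>Overlapping sets are reduced to the atoms of the finite algebra that they generate.\<close>

definition atom :: "(bool \<times> nat) set \<Rightarrow> (bool \<times> nat \<Rightarrow> 'a set) \<Rightarrow> (bool \<times> nat) set \<Rightarrow> ('a \<times> 'a) set" where
  "atom J B K = {q. \<forall>k\<in>J. coord (fst k) q \<in> B k \<longleftrightarrow> k \<in> K}"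

text \<open>The Laplace parameter that side \<open>b\<close> receives on the atom indexed by
  \<open>K\<close>: the coefficients of all sets of that side which contain the atom.\<close>

definition coef :: "(bool \<times> nat \<Rightarrow> real) \<Rightarrow> bool \<Rightarrow> (bool \<times> nat) set \<Rightarrow> real" where
  "coef c b K = (\<Sum>k\<in>K. if fst k = b then c k else 0)"

lemma atom_sets[measurable]:
  assumes "finite J" "\<And>k. B k \<in> sets borel"
  shows "atom J B K \<in> sets (borel \<Otimes>\<^sub>M borel)"
proof -
  note [measurable] = assms(2)
  have "atom J B K = {q \<in> space (borel \<Otimes>\<^sub>M borel). \<forall>k\<in>J. coord (fst k) q \<in> B k \<longleftrightarrow> k \<in> K}"
    by (auto simp: atom_def space_pair_measure)
  also have "\<dots> \<in> sets (borel \<Otimes>\<^sub>M borel)"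
    using assms(1) by measurable
  finally show ?thesis .
qed

lemma atom_disjoint:
  assumes "K \<noteq> L" "K \<subseteq> J" "L \<subseteq> J"
  shows "atom J B K \<inter> atom J B L = {}"
proof -
  obtain k where "k \<in> J" "k \<in> K \<longleftrightarrow> k \<notin> L" using assms by blast
  then show ?thesis by (auto simp: atom_def)
qed

lemma sum_coef:
  assumes "finite K"
  shows "(\<Sum>k\<in>K. c k * f (fst k)) = coef c True K * f True + coef c False K * f False"
  unfolding coef_def sum_distrib_right sum.distrib[symmetric]
  by (intro sum.cong) auto

text \<open>A location lies in exactly one atom, so pointwise the sum over atoms has a single
  nonzero term at most. On each atom the integrand is a function of the jump sizes alone, and the
  product intensity factors.\<close>

lemma nn_integral_exponent:
  assumes J: "finite J" and B[measurable]: "\<And>k. B k \<in> sets borel"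
  shows "(\<integral>\<^sup>+z. ennreal (1 - exp (- (\<Sum>k\<in>J. c k * jump B k z))) \<partial>\<nu>)
       = (\<Sum>K\<in>Pow J. ennreal \<theta> * \<psi> (coef c True K) (coef c False K) * emeasure G0 (atom J B K))"
proof -
  note [measurable] = atom_sets[OF J B]
  let ?f = "\<lambda>K s. ennreal (1 - exp (- (coef c True K * pick True s + coef c False K * pick False s)))"
  have "ennreal (1 - exp (- (\<Sum>k\<in>J. c k * jump B k z))) = (\<Sum>K\<in>Pow J. ?f K (fst z) * indicator (atom J B K) (snd z))" for z
  proof -
    define K0 where "K0 = {k\<in>J. coord (fst k) (snd z) \<in> B k}"
    have K0: "K0 \<in> Pow J" "finite K0" using J by (auto simp: K0_def)
    have "(\<Sum>k\<in>J. c k * jump B k z) = (\<Sum>k\<in>K0. c k * pick (fst k) (fst z))"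
      unfolding K0_def using J by (subst sum.inter_filter) (auto simp: jump_def intro!: sum.cong)
    also have "\<dots> = coef c True K0 * pick True (fst z) + coef c False K0 * pick False (fst z)"
      using sum_coef[OF K0(2), of c "\<lambda>b. pick b (fst z)"] by simp
    finally have "ennreal (1 - exp (- (\<Sum>k\<in>J. c k * jump B k z))) = ?f K0 (fst z)" by simp
    moreover have "(\<Sum>K\<in>Pow J. ?f K (fst z) * indicator (atom J B K) (snd z)) = (\<Sum>K\<in>Pow J. if K = K0 then ?f K0 (fst z) else 0)"
      by (intro sum.cong) (auto simp: atom_def K0_def split: split_indicator)
    ultimately show ?thesis using K0 J by simp
  qed
  then have "(\<integral>\<^sup>+z. ennreal (1 - exp (- (\<Sum>k\<in>J. c k * jump B k z))) \<partial>\<nu>)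
     = (\<integral>\<^sup>+z. (\<Sum>K\<in>Pow J. ?f K (fst z) * indicator (atom J B K) (snd z)) \<partial>\<nu>)"
    by (simp only:)
  also have "\<dots> = (\<Sum>K\<in>Pow J. \<integral>\<^sup>+z. ?f K (fst z) * indicator (atom J B K) (snd z) \<partial>\<nu>)"
    by (rule nn_integral_sum) measurable
  also have "\<dots> = (\<Sum>K\<in>Pow J. ennreal \<theta> * \<psi> (coef c True K) (coef c False K) * emeasure G0 (atom J B K))"
    unfolding \<psi>_def by (intro sum.cong refl, subst nn_integral_\<nu>_product) simp_all
  finally show ?thesis .
qed

lemma coef_nonneg: "(\<And>k. 0 \<le> c k) \<Longrightarrow> 0 \<le> coef c b K"
  unfolding coef_def by (intro sum_nonneg) auto

lemma exponent_nonneg: "(\<And>k. 0 \<le> c k) \<Longrightarrow> 0 \<le> 1 - exp (- (\<Sum>k\<in>J. c k * jump B k z))"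
  by (simp add: sum_nonneg)

text \<open>\<open>\<mu>_laplace\<close> speaks of disjoint sets only. Writing every mass as a sum
  over atoms and collecting the coefficients atom by atom brings the exponent into the form that it
  covers; the same bookkeeping for the jump integral yields the same sum.\<close>

lemma laplace_overlapping:
  assumes J: "finite J" and B[measurable]: "\<And>k. B k \<in> sets borel" and c: "\<And>k. 0 \<le> c k"
  shows "(\<integral>\<omega>. exp (- (\<Sum>k\<in>J. c k * mass (fst k) (B k) \<omega>)) \<partial>M)
       = exp (- (\<integral>z. 1 - exp (- (\<Sum>k\<in>J. c k * jump B k z)) \<partial>\<nu>))"
proof -
  note [measurable] = atom_sets[OF J B]
  have cf: "0 \<le> coef c b K" for b K by (rule coef_nonneg[OF c])
  \<comment> \<open>\<open>\<mu>_laplace\<close> takes families indexed by \<open>i < r\<close>,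
    hence the enumeration of the subsets of \<open>J\<close>.\<close>
  obtain e where e: "bij_betw e {..<card (Pow J)} (Pow J)"
    using ex_bij_betw_nat_finite[of "Pow J"] J by (auto simp: atLeast0LessThan)
  define r where "r = card (Pow J)"
  define A where "A i = atom J B (e i)" for i
  have eJ: "e i \<subseteq> J" if "i < r" for i using e that by (auto simp: bij_betw_def r_def)
  have disj: "disjoint_family_on A {..<r}"
    unfolding disjoint_family_on_def
  proof (intro ballI impI)
    fix i j assume ij: "i \<in> {..<r}" "j \<in> {..<r}" "i \<noteq> j"
    then have "e i \<noteq> e j" using e by (auto simp: bij_betw_def inj_on_def r_def)
    moreover have "e i \<subseteq> J" "e j \<subseteq> J" using ij eJ by auto
    ultimately show "A i \<inter> A j = {}" unfolding A_def by (intro atom_disjoint)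
  qed
  let ?l = "\<lambda>b i. coef c b (e i)"
  have "(\<integral>\<omega>. exp (- (\<Sum>k\<in>J. c k * mass (fst k) (B k) \<omega>)) \<partial>M)
     = (\<integral>\<omega>. (\<Prod>i<r. expneg (ennreal (?l True i) * emeasure (\<mu>1 \<omega>) (A i)
                                 + ennreal (?l False i) * emeasure (\<mu>2 \<omega>) (A i))) \<partial>M)"
  proof (rule integral_cong_AE)
    show "AE \<omega> in M. exp (- (\<Sum>k\<in>J. c k * mass (fst k) (B k) \<omega>)) = (\<Prod>i<r. expneg (ennreal (?l True i) * emeasure (\<mu>1 \<omega>) (A i)
                                 + ennreal (?l False i) * emeasure (\<mu>2 \<omega>) (A i)))"
      using AE_good
    proof eventually_elim
      fix \<omega> assume g: "good \<omega>"
      let ?m = "\<lambda>b K. measure (mu b \<omega>) (atom J B K)"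
      \<comment> \<open>The preimage of \<open>B k\<close> is the disjoint union of the atoms whose
        index set contains \<open>k\<close>, and on \<open>good\<close> the measure is
        finite.\<close>
      have split: "measure (mu (fst k) \<omega>) (coord (fst k) -` B k) = (\<Sum>K\<in>Pow J. if k \<in> K then ?m (fst k) K else 0)" if k: "k \<in> J" for k
      proof -
        interpret mb: finite_measure "mu (fst k) \<omega>" by (rule good_finite[OF g])
        have "coord (fst k) -` B k = (\<Union>K\<in>{K\<in>Pow J. k \<in> K}. atom J B K)"
        proof (intro equalityI subsetI)
          fix q assume "q \<in> coord (fst k) -` B k"
          then have "q \<in> atom J B {k\<in>J. coord (fst k) q \<in> B k}" "k \<in> {k\<in>J. coord (fst k) q \<in> B k}"
            using k by (auto simp: atom_def)
          then show "q \<in> (\<Union>K\<in>{K\<in>Pow J. k \<in> K}. atom J B K)"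
            by (intro UN_I[of "{k\<in>J. coord (fst k) q \<in> B k}"]) auto
        qed (use k in \<open>auto simp: atom_def\<close>)
        moreover have "disjoint_family_on (atom J B) {K\<in>Pow J. k \<in> K}"
          unfolding disjoint_family_on_def by (intro ballI impI atom_disjoint) auto
        ultimately have "measure (mu (fst k) \<omega>) (coord (fst k) -` B k) = (\<Sum>K\<in>{K\<in>Pow J. k \<in> K}. ?m (fst k) K)"
          using J by (simp only:) (intro mb.finite_measure_finite_Union, auto simp: mu_sets)
        then show ?thesis using J by (simp only: sum.inter_filter finite_Pow_iff)
      qed
      have "(\<Sum>k\<in>J. c k * mass (fst k) (B k) \<omega>) = (\<Sum>k\<in>J. \<Sum>K\<in>Pow J. if k \<in> K then c k * ?m (fst k) K else 0)"
        using g by (intro sum.cong) (auto simp: mass_def split sum_distrib_left intro!: sum.cong)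
      also have "\<dots> = (\<Sum>K\<in>Pow J. \<Sum>k\<in>J. if k \<in> K then c k * ?m (fst k) K else 0)"
        by (rule sum.swap)
      also have "\<dots> = (\<Sum>K\<in>Pow J. coef c True K * ?m True K + coef c False K * ?m False K)"
      proof (intro sum.cong refl)
        fix K assume K: "K \<in> Pow J"
        then have "(\<Sum>k\<in>J. if k \<in> K then c k * ?m (fst k) K else 0) = (\<Sum>k\<in>K. c k * ?m (fst k) K)"
          using J by (subst sum.inter_restrict[symmetric]) (auto simp: Int_absorb1)
        also have "\<dots> = coef c True K * ?m True K + coef c False K * ?m False K"
          using sum_coef[of K c "\<lambda>b. ?m b K"] K J finite_subset by auto
        finally show "(\<Sum>k\<in>J. if k \<in> K then c k * ?m (fst k) K else 0) = \<dots>" .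
      qed
      also have "\<dots> = (\<Sum>i<r. ?l True i * measure (mu True \<omega>) (A i) + ?l False i * measure (mu False \<omega>) (A i))"
        unfolding A_def r_def
        using sum.reindex_bij_betw[OF e, of "\<lambda>K. coef c True K * ?m True K + coef c False K * ?m False K"] by simp
      finally have "exp (- (\<Sum>k\<in>J. c k * mass (fst k) (B k) \<omega>))
         = (\<Prod>i<r. exp (- (?l True i * measure (mu True \<omega>) (A i) + ?l False i * measure (mu False \<omega>) (A i))))"
        by (simp add: exp_sum sum_negf[symmetric])
      also have "\<dots> = (\<Prod>i<r. expneg (ennreal (?l True i) * emeasure (\<mu>1 \<omega>) (A i)
                                 + ennreal (?l False i) * emeasure (\<mu>2 \<omega>) (A i)))"
      proof (intro prod.cong refl)
        fix i
        have "ennreal (?l True i) * emeasure (\<mu>1 \<omega>) (A i) + ennreal (?l False i) * emeasure (\<mu>2 \<omega>) (A i)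
          = ennreal (?l True i * measure (mu True \<omega>) (A i) + ?l False i * measure (mu False \<omega>) (A i))"
          using good_emeasure[OF g, of True "A i"] good_emeasure[OF g, of False "A i"] cf
          by (simp add: mu_def ennreal_mult' ennreal_plus)
        then show "exp (- (?l True i * measure (mu True \<omega>) (A i) + ?l False i * measure (mu False \<omega>) (A i)))
          = expneg (ennreal (?l True i) * emeasure (\<mu>1 \<omega>) (A i) + ennreal (?l False i) * emeasure (\<mu>2 \<omega>) (A i))"
          using cf by (simp only: expneg_ennreal add_nonneg_nonneg mult_nonneg_nonneg measure_nonneg)
      qed
      finally show "exp (- (\<Sum>k\<in>J. c k * mass (fst k) (B k) \<omega>)) = (\<Prod>i<r. expneg (ennreal (?l True i) * emeasure (\<mu>1 \<omega>) (A i)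
                                 + ennreal (?l False i) * emeasure (\<mu>2 \<omega>) (A i)))" .
    qed
    have [measurable]: "(\<lambda>\<omega>. emeasure (\<mu>1 \<omega>) (A i)) \<in> borel_measurable M" "(\<lambda>\<omega>. emeasure (\<mu>2 \<omega>) (A i)) \<in> borel_measurable M" for i
      unfolding A_def by (intro \<mu>_meas atom_sets[OF J B])+
    show "(\<lambda>\<omega>. \<Prod>i<r. expneg (ennreal (?l True i) * emeasure (\<mu>1 \<omega>) (A i)
                                 + ennreal (?l False i) * emeasure (\<mu>2 \<omega>) (A i))) \<in> borel_measurable M"
      by measurable
  qed measurable
  also have "\<dots> = (\<Prod>i<r. exp (- (\<theta> * measure G0 (A i) * enn2real (\<psi> (?l True i) (?l False i)))))"
    unfolding \<psi>_alt[symmetric]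
    by (intro \<mu>_laplace disj) (use cf in \<open>auto simp: A_def\<close>)
  also have "\<dots> = exp (- (\<Sum>i<r. \<theta> * measure G0 (A i) * enn2real (\<psi> (?l True i) (?l False i))))"
    by (simp add: exp_sum sum_negf[symmetric])
  also have "(\<Sum>i<r. \<theta> * measure G0 (A i) * enn2real (\<psi> (?l True i) (?l False i)))
     = (\<Sum>K\<in>Pow J. \<theta> * measure G0 (atom J B K) * enn2real (\<psi> (coef c True K) (coef c False K)))"
    unfolding A_def r_def
    using sum.reindex_bij_betw[OF e, of "\<lambda>K. \<theta> * measure G0 (atom J B K) * enn2real (\<psi> (coef c True K) (coef c False K))"] by simp
  also have "\<dots> = (\<integral>z. 1 - exp (- (\<Sum>k\<in>J. c k * jump B k z)) \<partial>\<nu>)"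
  proof -
    have "(\<integral>z. 1 - exp (- (\<Sum>k\<in>J. c k * jump B k z)) \<partial>\<nu>)
      = enn2real (\<integral>\<^sup>+z. ennreal (1 - exp (- (\<Sum>k\<in>J. c k * jump B k z))) \<partial>\<nu>)"
      by (rule integral_eq_nn_integral) (use exponent_nonneg[OF c] in auto)
    also have "\<dots> = enn2real (\<Sum>K\<in>Pow J. ennreal \<theta> * \<psi> (coef c True K) (coef c False K) * emeasure G0 (atom J B K))"
      by (simp only: nn_integral_exponent[OF J B])
    also have "(\<Sum>K\<in>Pow J. ennreal \<theta> * \<psi> (coef c True K) (coef c False K) * emeasure G0 (atom J B K))
        = (\<Sum>K\<in>Pow J. ennreal (\<theta> * measure G0 (atom J B K) * enn2real (\<psi> (coef c True K) (coef c False K))))"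
    proof (intro sum.cong refl)
      fix K
      obtain t where t: "t \<ge> 0" "\<psi> (coef c True K) (coef c False K) = ennreal t"
        using \<psi>_finite[OF cf cf, of True K False K]
        by (cases "\<psi> (coef c True K) (coef c False K)") auto
      then show "ennreal \<theta> * \<psi> (coef c True K) (coef c False K) * emeasure G0 (atom J B K)
          = ennreal (\<theta> * measure G0 (atom J B K) * enn2real (\<psi> (coef c True K) (coef c False K)))"
        using \<theta>_pos by (simp add: G0.emeasure_eq_measure ennreal_mult'[symmetric] mult_ac)
    qed
    also have "\<dots> = ennreal (\<Sum>K\<in>Pow J. \<theta> * measure G0 (atom J B K) * enn2real (\<psi> (coef c True K) (coef c False K)))"
      using \<theta>_pos by (intro sum_ennreal) auto
    also have "enn2real \<dots> = (\<Sum>K\<in>Pow J. \<theta> * measure G0 (atom J B K) * enn2real (\<psi> (coef c True K) (coef c False K)))"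
      using \<theta>_pos by (intro enn2real_ennreal sum_nonneg) auto
    finally show ?thesis by simp
  qed
  finally show ?thesis .
qed

lemma laplace_vector_mass:
  assumes J: "finite J" and B[measurable]: "\<And>k. B k \<in> sets borel"
  shows "laplace_vector M \<nu> J (\<lambda>k. mass (fst k) (B k)) (jump B)"
proof (rule laplace_vector.intro)
  show "prob_space M" by (rule prob_space_axioms)
  fix c :: "bool \<times> nat \<Rightarrow> real" assume c: "\<And>k. 0 \<le> c k"
  have cf: "0 \<le> coef c b K" for b K by (rule coef_nonneg[OF c])
  show "integrable \<nu> (\<lambda>z. 1 - exp (- (\<Sum>k\<in>J. c k * jump B k z)))"
  proof (rule integrableI_nonneg)
    show "(\<integral>\<^sup>+z. ennreal (1 - exp (- (\<Sum>k\<in>J. c k * jump B k z))) \<partial>\<nu>) < \<infinity>"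
      unfolding nn_integral_exponent[OF J B]
      using \<psi>_finite cf J by (auto simp: ennreal_mult_less_top G0.emeasure_eq_measure)
  qed (use exponent_nonneg[OF c] in auto)
qed (use assms laplace_overlapping[OF J B] in auto)

end

section \<open>Moments of the normalised measures\<close>

definition side_count :: "bool \<Rightarrow> (bool \<times> nat) set \<Rightarrow> nat" where
  "side_count b K = (\<Sum>k\<in>K. if fst k = b then 1 else 0)"

lemma prod_side_count:
  fixes f :: "bool \<Rightarrow> 'b::comm_monoid_mult"
  assumes "finite K"
  shows "(\<Prod>k\<in>K. f (fst k)) = f True ^ side_count True K * f False ^ side_count False K"
  using assms by (induction K rule: finite_induct) (auto simp: side_count_def mult_ac)

lemma side_count_pos: "finite K \<Longrightarrow> k \<in> K \<Longrightarrow> fst k = b \<Longrightarrow> 0 < side_count b K"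
  unfolding side_count_def by (intro sum_pos2[of _ k]) auto

text \<open>\<open>fact (a - 1)\<close> is the value of the Gamma function at \<open>a\<close>:
  integrating \<open>exp (- u * T)\<close> over \<open>u\<close> with this weight gives
  \<open>1 / T ^ a\<close> for \<open>a > 0\<close>.\<close>

definition gamma_weight :: "nat \<Rightarrow> real \<Rightarrow> real" where
  "gamma_weight a u = (if u > 0 then u ^ (a - 1) / fact (a - 1) else 0)"

lemma gamma_weight_nonneg[simp]: "0 \<le> gamma_weight a u" by (simp add: gamma_weight_def)

lemma gamma_weight_measurable[measurable]: "gamma_weight a \<in> borel_measurable borel"
  unfolding gamma_weight_def[abs_def] by measurable

text \<open>Up to the factor \<open>T ^ a\<close>, the integrand is the Erlang density with rate
  \<open>T\<close>, whose integral is 1.\<close>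

lemma nn_integral_gamma_weight:
  assumes a: "a > 0" and T: "T > 0"
  shows "(\<integral>\<^sup>+u. ennreal (gamma_weight a u * exp (- (u * T))) \<partial>lborel) = ennreal (1 / T ^ a)"
proof -
  obtain k where k: "a = Suc k" using a by (cases a) auto
  interpret E: prob_space "density lborel (erlang_density k T)"
    by (rule prob_space_erlang_density[OF T])
  have "(\<integral>\<^sup>+u. ennreal (erlang_density k T u) \<partial>lborel) = 1"
    using E.emeasure_space_1 by (simp add: emeasure_density)
  moreover have "(\<integral>\<^sup>+u. ennreal (erlang_density k T u) \<partial>lborel) = (\<integral>\<^sup>+u. ennreal (T ^ a) * ennreal (gamma_weight a u * exp (- (u * T))) \<partial>lborel)"
  proof (rule nn_integral_cong_AE)
    \<comment> \<open>At \<open>u = 0\<close> the two integrands can differ, because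
      \<open>gamma_weight\<close> is set to 0 there.\<close>
    have "AE u in lborel. u \<noteq> (0::real)" by (rule AE_lborel_singleton)
    then show "AE u in lborel. ennreal (erlang_density k T u) = ennreal (T ^ a) * ennreal (gamma_weight a u * exp (- (u * T)))"
      by eventually_elim (use T in \<open>auto simp: erlang_density_def gamma_weight_def k ennreal_mult'[symmetric] mult_ac\<close>)
  qed
  moreover have "\<dots> = ennreal (T ^ a) * (\<integral>\<^sup>+u. ennreal (gamma_weight a u * exp (- (u * T))) \<partial>lborel)"
    by (rule nn_integral_cmult) measurable
  ultimately have *: "ennreal (T ^ a) * (\<integral>\<^sup>+u. ennreal (gamma_weight a u * exp (- (u * T))) \<partial>lborel) = 1" by simp
  have "(\<integral>\<^sup>+u. ennreal (gamma_weight a u * exp (- (u * T))) \<partial>lborel) = ennreal (1 / T ^ a) * (ennreal (T ^ a) * (\<integral>\<^sup>+u. ennreal (gamma_weight a u * exp (- (u * T))) \<partial>lborel))"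
    using T by (simp add: mult.assoc[symmetric] ennreal_mult'[symmetric])
  then show ?thesis unfolding * by simp
qed

lemma nn_integral_gamma_weight_pair:
  assumes "a > 0" "b > 0" "S > 0" "T > 0"
  shows "(\<integral>\<^sup>+z. ennreal (gamma_weight a (fst z) * gamma_weight b (snd z)) * ennreal (exp (- (fst z * S + snd z * T))) \<partial>(lborel \<Otimes>\<^sub>M lborel))
     = ennreal (1 / (S ^ a * T ^ b))"
proof -
  have "(\<integral>\<^sup>+z. ennreal (gamma_weight a (fst z) * gamma_weight b (snd z)) * ennreal (exp (- (fst z * S + snd z * T))) \<partial>(lborel \<Otimes>\<^sub>M lborel))
    = (\<integral>\<^sup>+z. ennreal (gamma_weight a (fst z) * exp (- (fst z * S))) * ennreal (gamma_weight b (snd z) * exp (- (snd z * T))) \<partial>(lborel \<Otimes>\<^sub>M lborel))"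
  proof (rule nn_integral_cong)
    fix z :: "real \<times> real"
    have "(gamma_weight a (fst z) * gamma_weight b (snd z)) * exp (- (fst z * S + snd z * T))
       = (gamma_weight a (fst z) * exp (- (fst z * S))) * (gamma_weight b (snd z) * exp (- (snd z * T)))"
      by (simp only: minus_add_distrib exp_add mult_ac)
    moreover have "ennreal (gamma_weight a (fst z) * gamma_weight b (snd z)) * ennreal (exp (- (fst z * S + snd z * T)))
        = ennreal ((gamma_weight a (fst z) * gamma_weight b (snd z)) * exp (- (fst z * S + snd z * T)))"
      by (rule ennreal_mult[symmetric]) auto
    moreover have "ennreal (gamma_weight a (fst z) * exp (- (fst z * S))) * ennreal (gamma_weight b (snd z) * exp (- (snd z * T)))
        = ennreal ((gamma_weight a (fst z) * exp (- (fst z * S))) * (gamma_weight b (snd z) * exp (- (snd z * T))))"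
      by (rule ennreal_mult[symmetric]) auto
    ultimately show "ennreal (gamma_weight a (fst z) * gamma_weight b (snd z)) * ennreal (exp (- (fst z * S + snd z * T)))
        = ennreal (gamma_weight a (fst z) * exp (- (fst z * S))) * ennreal (gamma_weight b (snd z) * exp (- (snd z * T)))"
      by (simp only:)
  qed
  also have "\<dots> = (\<integral>\<^sup>+u. \<integral>\<^sup>+v. ennreal (gamma_weight a u * exp (- (u * S))) * ennreal (gamma_weight b v * exp (- (v * T))) \<partial>lborel \<partial>lborel)"
    by (subst lborel.nn_integral_fst[symmetric]) auto
  also have "\<dots> = (\<integral>\<^sup>+u. ennreal (gamma_weight a u * exp (- (u * S))) * ennreal (1 / T ^ b) \<partial>lborel)"
    using nn_integral_gamma_weight[OF assms(2,4)] by (simp add: nn_integral_cmult)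
  also have "\<dots> = ennreal (1 / S ^ a) * ennreal (1 / T ^ b)"
    using nn_integral_gamma_weight[OF assms(1,3)] by (simp add: nn_integral_multc)
  also have "\<dots> = ennreal (1 / (S ^ a * T ^ b))"
    using assms by (simp add: ennreal_mult'[symmetric])
  finally show ?thesis .
qed

context furbi begin

definition expo :: "real \<times> real \<Rightarrow> 'w \<Rightarrow> real" where
  "expo z \<omega> = exp (- (fst z * mass True UNIV \<omega> + snd z * mass False UNIV \<omega>))"

text \<open>The part of the cumulant of a block \<open>K\<close> that comes from the jump sizes; the
  location contributes a separate factor from \<open>G0\<close>.\<close>

definition \<tau> :: "(bool \<times> nat) set \<Rightarrow> real \<times> real \<Rightarrow> ennreal" where
  "\<tau> K z = (\<integral>\<^sup>+s. ennreal ((\<Prod>k\<in>K. pick (fst k) s) * exp (- (fst z * pick True s + snd z * pick False s))) \<partial>\<rho>)"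

text \<open>The recursion for the masses of the \<open>B k\<close>, with the two total masses as
  extra coordinates that carry the damping. As the intensity is a product measure, a cumulant splits
  into the jump part \<open>\<theta> * \<tau>\<close> and the probability that one location lies in
  all sets of the block.\<close>

lemma moment_expansion:
  assumes fO: "finite D" and O0: "0 \<notin> snd ` insert k0 D" and k0: "k0 \<notin> D"
    and B: "\<And>k. B k \<in> sets borel" and z: "fst z > 0" "snd z > 0"
  shows "(\<integral>\<^sup>+\<omega>. ennreal ((\<Prod>k\<in>insert k0 D. mass (fst k) (B k) \<omega>) * expo z \<omega>) \<partial>M)
   = (\<Sum>S\<in>Pow D. ennreal \<theta> * \<tau> (insert k0 S) z * emeasure G0 {q. \<forall>k\<in>insert k0 S. coord (fst k) q \<in> B k}
        * (\<integral>\<^sup>+\<omega>. ennreal ((\<Prod>k\<in>D - S. mass (fst k) (B k) \<omega>) * expo z \<omega>) \<partial>M))"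
proof -
  \<comment> \<open>The unused index 0 of either side carries the total mass.\<close>
  define B' where "B' k = (if snd k = 0 then UNIV else B k)" for k
  have B'[measurable]: "B' k \<in> sets borel" for k using B by (simp add: B'_def)
  have BB: "B' k = B k" if "k \<in> insert k0 D" for k
    using O0 that by (auto simp: B'_def)
  define J where "J = insert (True, 0) (insert (False, 0) (insert k0 D))"
  have fJ: "finite J" using fO by (simp add: J_def)
  interpret V: laplace_vector M \<nu> J "\<lambda>k. mass (fst k) (B' k)" "jump B'"
    by (rule laplace_vector_mass) (use fJ B' in auto)
  define c where "c = (\<lambda>k::bool \<times> nat. if k = (True, 0) then fst z else if k = (False, 0) then snd z else 0)"
  have J2: "{(True, 0), (False, 0)} \<subseteq> J" by (simp add: J_def)
  have csum: "(\<Sum>k\<in>J. c k * f k) = fst z * f (True, 0) + snd z * f (False, 0)" for f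
  proof -
    have "(\<Sum>k\<in>J. c k * f k) = (\<Sum>k\<in>{(True, 0), (False, 0)}. c k * f k)"
      by (rule sum.mono_neutral_right) (use fJ J2 in \<open>auto simp: c_def\<close>)
    then show ?thesis by (simp add: c_def)
  qed
  have cN: "exp (- (\<Sum>k\<in>J. c k * mass (fst k) (B' k) \<omega>)) = expo z \<omega>" for \<omega>
    unfolding csum by (simp add: expo_def B'_def)
  have c\<phi>: "(\<Sum>k\<in>J. c k * jump B' k y) = fst z * pick True (fst y) + snd z * pick False (fst y)" for y
    unfolding csum by (simp add: jump_def B'_def)
  have adm: "V.admissible c"
    unfolding V.admissible_def
  \<comment> \<open>Every mass is at most the total mass of its side. Both entries of
    \<open>z\<close> are positive, so a total mass is at most this constant times the damping
    exponent.\<close>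
  proof (intro conjI allI exI[of _ "max (1 / fst z) (1 / snd z)"] ballI)
    let ?K = "max (1 / fst z) (1 / snd z)"
    have bnd: "f b \<le> ?K * (fst z * f True + snd z * f False)" if f: "\<And>b. f b \<ge> 0" for f :: "bool \<Rightarrow> real" and b
    proof -
      have "f b \<le> f True + f False" using f[of True] f[of False] by (cases b) auto
      also have "\<dots> = 1 / fst z * (fst z * f True) + 1 / snd z * (snd z * f False)" using z by simp
      also have "\<dots> \<le> ?K * (fst z * f True) + ?K * (snd z * f False)"
        using z f by (intro add_mono mult_right_mono) auto
      finally show ?thesis by (simp add: algebra_simps)
    qed
    show "c k \<ge> 0" for k using z by (simp add: c_def)
    show "0 \<le> ?K" using z by (simp add: le_max_iff_disj)
    fix k assume "k \<in> J"
    show "mass (fst k) (B' k) \<omega> \<le> ?K * (\<Sum>j\<in>J. c j * mass (fst j) (B' j) \<omega>)" for \<omega>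
      unfolding csum using mass_le[OF B', of "fst k" k \<omega>] bnd[of "\<lambda>b. mass b UNIV \<omega>" "fst k"]
      by (simp add: B'_def)
    show "jump B' k y \<le> ?K * (\<Sum>j\<in>J. c j * jump B' j y)" for y
      unfolding c\<phi> using bnd[of "\<lambda>b. pick b (fst y)" "fst k"]
      by (auto simp: jump_def split: split_indicator intro: order_trans[OF pick_nonneg])
  qed
  have ne: "k0 \<in> J" "D \<subseteq> J" by (auto simp: J_def)
  have mom: "ennreal (V.moment I c) = (\<integral>\<^sup>+\<omega>. ennreal ((\<Prod>k\<in>I. mass (fst k) (B k) \<omega>) * expo z \<omega>) \<partial>M)"
    if I: "I \<subseteq> insert k0 D" for I
  proof -
    have "ennreal (V.moment I c) = (\<integral>\<^sup>+\<omega>. ennreal ((\<Prod>k\<in>I. mass (fst k) (B' k) \<omega>) * exp (- (\<Sum>k\<in>J. c k * mass (fst k) (B' k) \<omega>))) \<partial>M)"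
      unfolding V.moment_def using I ne adm
      by (intro nn_integral_eq_integral[symmetric] V.moment_integrable) (auto intro!: mult_nonneg_nonneg prod_nonneg)
    also have "\<dots> = (\<integral>\<^sup>+\<omega>. ennreal ((\<Prod>k\<in>I. mass (fst k) (B k) \<omega>) * expo z \<omega>) \<partial>M)"
      unfolding cN using BB I by (intro nn_integral_cong arg_cong[where f=ennreal] arg_cong2[where f="(*)"] prod.cong) auto
    finally show ?thesis .
  qed
  have cum: "ennreal (V.cumulant (insert k0 S) c) = ennreal \<theta> * \<tau> (insert k0 S) z * emeasure G0 {q. \<forall>k\<in>insert k0 S. coord (fst k) q \<in> B k}"
    if S: "S \<subseteq> D" for S
  proof -
    let ?K = "insert k0 S"
    have fK: "finite ?K" using S fO finite_subset by auto
    have [measurable]: "{q. \<forall>k\<in>?K. coord (fst k) q \<in> B k} \<in> sets (borel \<Otimes>\<^sub>M borel)"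
    proof -
      note [measurable] = B
      have "{q. \<forall>k\<in>?K. coord (fst k) q \<in> B k} = {q \<in> space (borel \<Otimes>\<^sub>M borel). \<forall>k\<in>?K. coord (fst k) q \<in> B k}"
        by (auto simp: space_pair_measure)
      also have "\<dots> \<in> sets (borel \<Otimes>\<^sub>M borel)" using fK by measurable
      finally show ?thesis .
    qed
    have "ennreal (V.cumulant ?K c) = (\<integral>\<^sup>+y. ennreal ((\<Prod>k\<in>?K. jump B' k y) * exp (- (\<Sum>k\<in>J. c k * jump B' k y))) \<partial>\<nu>)"
      unfolding V.cumulant_def using S ne adm
      by (intro nn_integral_eq_integral[symmetric] V.cumulant_integrable) (auto intro!: mult_nonneg_nonneg prod_nonneg)
    also have "\<dots> = (\<integral>\<^sup>+y. ennreal ((\<Prod>k\<in>?K. pick (fst k) (fst y)) * exp (- (fst z * pick True (fst y) + snd z * pick False (fst y))))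
         * indicator {q. \<forall>k\<in>?K. coord (fst k) q \<in> B k} (snd y) \<partial>\<nu>)"
    proof (rule nn_integral_cong)
      fix y
      have "(\<Prod>k\<in>?K. jump B' k y) = (\<Prod>k\<in>?K. pick (fst k) (fst y)) * (\<Prod>k\<in>?K. indicator (B k) (coord (fst k) (snd y)))"
        unfolding prod.distrib[symmetric] using S BB by (intro prod.cong) (auto simp: jump_def)
      also have "(\<Prod>k\<in>?K. indicator (B k) (coord (fst k) (snd y))) = (indicator {q. \<forall>k\<in>?K. coord (fst k) q \<in> B k} (snd y) :: real)"
        using fK by (auto split: split_indicator intro!: prod.neutral prod_zero)
      finally show "ennreal ((\<Prod>k\<in>?K. jump B' k y) * exp (- (\<Sum>k\<in>J. c k * jump B' k y)))
        = ennreal ((\<Prod>k\<in>?K. pick (fst k) (fst y)) * exp (- (fst z * pick True (fst y) + snd z * pick False (fst y))))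
         * indicator {q. \<forall>k\<in>?K. coord (fst k) q \<in> B k} (snd y)"
        unfolding c\<phi> by (auto split: split_indicator)
    qed
    also have "\<dots> = ennreal \<theta> * \<tau> ?K z * emeasure G0 {q. \<forall>k\<in>?K. coord (fst k) q \<in> B k}"
    proof -
      have reg: "{q. \<forall>k\<in>?K. coord (fst k) q \<in> B k} \<in> sets G0" by measurable
      show ?thesis
        unfolding \<tau>_def by (subst nn_integral_\<nu>_product) (use reg in \<open>simp_all only: nn_integral_indicator borel_measurable_indicator\<close>, measurable)
    qed
    finally show ?thesis .
  qed
  have nnm: "0 \<le> V.moment I c" for I
    unfolding V.moment_def by (intro Bochner_Integration.integral_nonneg mult_nonneg_nonneg prod_nonneg) auto
  have nnc: "0 \<le> V.cumulant I c" for I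
    unfolding V.cumulant_def by (intro Bochner_Integration.integral_nonneg mult_nonneg_nonneg prod_nonneg) auto
  have "(\<integral>\<^sup>+\<omega>. ennreal ((\<Prod>k\<in>insert k0 D. mass (fst k) (B k) \<omega>) * expo z \<omega>) \<partial>M) = ennreal (V.moment (insert k0 D) c)"
    by (simp only: mom[OF subset_refl])
  also have "\<dots> = (\<Sum>S\<in>Pow D. ennreal (V.cumulant (insert k0 S) c * V.moment (D - S) c))"
    unfolding V.moment_recursion[OF ne k0 adm] by (rule sum_ennreal[symmetric]) (use nnm nnc in auto)
  also have "\<dots> = (\<Sum>S\<in>Pow D. ennreal \<theta> * \<tau> (insert k0 S) z * emeasure G0 {q. \<forall>k\<in>insert k0 S. coord (fst k) q \<in> B k}
        * (\<integral>\<^sup>+\<omega>. ennreal ((\<Prod>k\<in>D - S. mass (fst k) (B k) \<omega>) * expo z \<omega>) \<partial>M))"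
  proof (intro sum.cong refl)
    fix S assume S: "S \<in> Pow D"
    have "ennreal (V.cumulant (insert k0 S) c * V.moment (D - S) c) = ennreal (V.cumulant (insert k0 S) c) * ennreal (V.moment (D - S) c)"
      using nnc by (intro ennreal_mult nnm)
    moreover have "D - S \<subseteq> insert k0 D" by auto
    ultimately show "ennreal (V.cumulant (insert k0 S) c * V.moment (D - S) c) = ennreal \<theta> * \<tau> (insert k0 S) z * emeasure G0 {q. \<forall>k\<in>insert k0 S. coord (fst k) q \<in> B k}
        * (\<integral>\<^sup>+\<omega>. ennreal ((\<Prod>k\<in>D - S. mass (fst k) (B k) \<omega>) * expo z \<omega>) \<partial>M)"
      using S cum mom by simp
  qed
  finally show ?thesis .
qed


section \<open>Mixed moments of the normalised masses\<close>

definition norm_mass :: "bool \<Rightarrow> 'w \<Rightarrow> 'a set \<Rightarrow> real" where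
  "norm_mass b \<omega> A = (if b then nmarg1 (\<mu>1 \<omega>) A else nmarg2 (\<mu>2 \<omega>) A)"

lemma norm_mass_alt: "norm_mass b \<omega> A = enn2real (emeasure (mu b \<omega>) (coord b -` A) / emeasure (mu b \<omega>) UNIV)"
proof -
  have "coord True -` A = A \<times> UNIV" "coord False -` A = UNIV \<times> A" by (auto simp: coord_def)
  then show ?thesis by (cases b) (auto simp: norm_mass_def nmarg1_def nmarg2_def mu_def)
qed

lemma mass_UNIV_pos:
  assumes "good \<omega>"
  shows "0 < mass b UNIV \<omega>"
proof -
  have "0 < emeasure (mu b \<omega>) UNIV" using assms by (simp add: good_def)
  then show ?thesis using assms by (simp add: mass_def good_emeasure[OF assms])
qed

lemma norm_mass_good:
  assumes "good \<omega>"
  shows "norm_mass b \<omega> A = mass b A \<omega> / mass b UNIV \<omega>"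
  using mass_UNIV_pos[OF assms, of b] assms
  by (simp add: norm_mass_alt good_emeasure[OF assms] mass_def divide_ennreal)

lemma norm_mass_nonneg[simp]: "0 \<le> norm_mass b \<omega> A" by (simp add: norm_mass_alt)

lemma norm_mass_measurable[measurable]:
  assumes [measurable]: "A \<in> sets borel"
  shows "(\<lambda>\<omega>. norm_mass b \<omega> A) \<in> borel_measurable M"
  unfolding norm_mass_alt by measurable

text \<open>What multiplies the factor from \<open>G0\<close> and the normalised masses after the
  recursion has been integrated over the damping parameters. The sets \<open>B k\<close> are gone;
  only the total masses of the indices outside the block remain. The gamma exponents count all of
  \<open>insert k0 D\<close>, the block included.\<close>

definition block_weight :: "(bool \<times> nat) set \<Rightarrow> bool \<times> nat \<Rightarrow> (bool \<times> nat) set \<Rightarrow> 'w \<Rightarrow> ennreal" where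
  "block_weight D k0 S \<omega> = (\<integral>\<^sup>+z. ennreal (gamma_weight (side_count True (insert k0 D)) (fst z) * gamma_weight (side_count False (insert k0 D)) (snd z))
       * (ennreal \<theta> * \<tau> (insert k0 S) z) * ennreal ((\<Prod>k\<in>D - S. mass (fst k) UNIV \<omega>) * expo z \<omega>) \<partial>(lborel \<Otimes>\<^sub>M lborel))"

lemma \<tau>_measurable[measurable]: "\<tau> K \<in> borel_measurable (borel \<Otimes>\<^sub>M borel)"
  unfolding \<tau>_def[abs_def] by measurable

lemma expo_measurable[measurable]:
  "(\<lambda>x. expo (fst x) (snd x)) \<in> borel_measurable ((borel \<Otimes>\<^sub>M borel) \<Otimes>\<^sub>M M)"
  "(\<lambda>x. expo (snd x) (fst x)) \<in> borel_measurable (M \<Otimes>\<^sub>M (borel \<Otimes>\<^sub>M borel))"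
  "expo z \<in> borel_measurable M" "(\<lambda>z. expo z \<omega>) \<in> borel_measurable (borel \<Otimes>\<^sub>M borel)"
  unfolding expo_def[abs_def] by measurable

lemma block_weight_measurable[measurable]: "block_weight D k0 S \<in> borel_measurable M"
proof -
  interpret L: pair_sigma_finite lborel "lborel :: real measure" ..
  interpret LL: sigma_finite_measure "lborel \<Otimes>\<^sub>M lborel :: (real \<times> real) measure" by (intro sigma_finite_pair_measure lborel.sigma_finite_measure_axioms)
  show ?thesis unfolding block_weight_def[abs_def] by measurable
qed

text \<open>Division by powers of the total masses becomes a gamma integral, Fubini's theorem moves
  it outside the expectation, and the recursion applies for fixed damping parameters. Moving the
  integral back inside produces the weights and restores normalised masses for the indices outside
  the block. All integrands are nonnegative, so the exchanges are free.\<close>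

lemma mixed_moment_expansion:
  assumes fD: "finite D" and D0: "0 \<notin> snd ` insert k0 D" and k0: "k0 \<notin> D"
    and pos: "\<And>b. 0 < side_count b (insert k0 D)"
    and B[measurable]: "\<And>k. B k \<in> sets borel"
  shows "(\<integral>\<^sup>+\<omega>. ennreal (\<Prod>k\<in>insert k0 D. norm_mass (fst k) \<omega> (B k)) \<partial>M)
    = (\<Sum>S\<in>Pow D. emeasure G0 {q. \<forall>k\<in>insert k0 S. coord (fst k) q \<in> B k}
          * (\<integral>\<^sup>+\<omega>. block_weight D k0 S \<omega> * ennreal (\<Prod>k\<in>D - S. norm_mass (fst k) \<omega> (B k)) \<partial>M))"
proof -
  let ?D = "insert k0 D"
  let ?w = "\<lambda>z. ennreal (gamma_weight (side_count True ?D) (fst z) * gamma_weight (side_count False ?D) (snd z))"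
  let ?LL = "lborel \<Otimes>\<^sub>M lborel :: (real \<times> real) measure"
  let ?g = "\<lambda>S. emeasure G0 {q. \<forall>k\<in>insert k0 S. coord (fst k) q \<in> B k}"
  interpret L: pair_sigma_finite lborel "lborel :: real measure" ..
  interpret LL: sigma_finite_measure ?LL by (intro sigma_finite_pair_measure lborel.sigma_finite_measure_axioms)
  interpret MU: pair_sigma_finite M ?LL ..
  have "(\<integral>\<^sup>+\<omega>. ennreal (\<Prod>k\<in>?D. norm_mass (fst k) \<omega> (B k)) \<partial>M)
     = (\<integral>\<^sup>+\<omega>. \<integral>\<^sup>+z. ?w z * ennreal ((\<Prod>k\<in>?D. mass (fst k) (B k) \<omega>) * expo z \<omega>) \<partial>?LL \<partial>M)"
  proof (rule nn_integral_cong_AE)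
    show "AE \<omega> in M. ennreal (\<Prod>k\<in>?D. norm_mass (fst k) \<omega> (B k)) = (\<integral>\<^sup>+z. ?w z * ennreal ((\<Prod>k\<in>?D. mass (fst k) (B k) \<omega>) * expo z \<omega>) \<partial>?LL)"
      using AE_good
    proof eventually_elim
      fix \<omega> assume g: "good \<omega>"
      have "(\<integral>\<^sup>+z. ?w z * ennreal ((\<Prod>k\<in>?D. mass (fst k) (B k) \<omega>) * expo z \<omega>) \<partial>?LL)
         = (\<integral>\<^sup>+z. ennreal (\<Prod>k\<in>?D. mass (fst k) (B k) \<omega>) * (?w z * ennreal (exp (- (fst z * mass True UNIV \<omega> + snd z * mass False UNIV \<omega>)))) \<partial>?LL)"
        by (intro nn_integral_cong) (simp add: expo_def ennreal_mult' prod_nonneg mult_ac)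
      also have "\<dots> = ennreal (\<Prod>k\<in>?D. mass (fst k) (B k) \<omega>) * ennreal (1 / (mass True UNIV \<omega> ^ side_count True ?D * mass False UNIV \<omega> ^ side_count False ?D))"
        by (subst nn_integral_cmult, measurable) (simp only: nn_integral_gamma_weight_pair[OF pos pos mass_UNIV_pos[OF g] mass_UNIV_pos[OF g]])
      also have "\<dots> = ennreal ((\<Prod>k\<in>?D. mass (fst k) (B k) \<omega>) / (\<Prod>k\<in>?D. mass (fst k) UNIV \<omega>))"
        using fD by (simp add: prod_side_count[of ?D "\<lambda>b. mass b UNIV \<omega>"] ennreal_mult'[symmetric] prod_nonneg del: prod.insert)
      also have "(\<Prod>k\<in>?D. mass (fst k) (B k) \<omega>) / (\<Prod>k\<in>?D. mass (fst k) UNIV \<omega>) = (\<Prod>k\<in>?D. norm_mass (fst k) \<omega> (B k))"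
        unfolding prod_dividef[symmetric] norm_mass_good[OF g] ..
      finally show "ennreal (\<Prod>k\<in>?D. norm_mass (fst k) \<omega> (B k)) = (\<integral>\<^sup>+z. ?w z * ennreal ((\<Prod>k\<in>?D. mass (fst k) (B k) \<omega>) * expo z \<omega>) \<partial>?LL)" ..
    qed
  qed
  also have "\<dots> = (\<integral>\<^sup>+z. \<integral>\<^sup>+\<omega>. ?w z * ennreal ((\<Prod>k\<in>?D. mass (fst k) (B k) \<omega>) * expo z \<omega>) \<partial>M \<partial>?LL)"
    by (rule MU.Fubini'[symmetric]) measurable
  also have "\<dots> = (\<integral>\<^sup>+z. (\<Sum>S\<in>Pow D. ?g S * (\<integral>\<^sup>+\<omega>. ?w z * (ennreal \<theta> * \<tau> (insert k0 S) z) * ennreal ((\<Prod>k\<in>D - S. mass (fst k) (B k) \<omega>) * expo z \<omega>) \<partial>M)) \<partial>?LL)"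
  proof (rule nn_integral_cong)
    fix z :: "real \<times> real"
    show "(\<integral>\<^sup>+\<omega>. ?w z * ennreal ((\<Prod>k\<in>?D. mass (fst k) (B k) \<omega>) * expo z \<omega>) \<partial>M)
       = (\<Sum>S\<in>Pow D. ?g S * (\<integral>\<^sup>+\<omega>. ?w z * (ennreal \<theta> * \<tau> (insert k0 S) z) * ennreal ((\<Prod>k\<in>D - S. mass (fst k) (B k) \<omega>) * expo z \<omega>) \<partial>M))"
    \<comment> \<open>The recursion requires positive damping on both sides; elsewhere
      \<open>gamma_weight\<close> vanishes.\<close>
    proof (cases "fst z > 0 \<and> snd z > 0")
      case True
      then have "fst z > 0" "snd z > 0" by auto
      note * = moment_expansion[OF fD D0 k0 B this]
      have "(\<integral>\<^sup>+\<omega>. ?w z * ennreal ((\<Prod>k\<in>?D. mass (fst k) (B k) \<omega>) * expo z \<omega>) \<partial>M)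
        = ?w z * (\<integral>\<^sup>+\<omega>. ennreal ((\<Prod>k\<in>?D. mass (fst k) (B k) \<omega>) * expo z \<omega>) \<partial>M)"
        by (rule nn_integral_cmult) measurable
      also have "\<dots> = (\<Sum>S\<in>Pow D. ?w z * (ennreal \<theta> * \<tau> (insert k0 S) z * ?g S
        * (\<integral>\<^sup>+\<omega>. ennreal ((\<Prod>k\<in>D - S. mass (fst k) (B k) \<omega>) * expo z \<omega>) \<partial>M)))"
        unfolding * by (rule sum_distrib_left)
      also have "\<dots> = (\<Sum>S\<in>Pow D. ?g S * (\<integral>\<^sup>+\<omega>. ?w z * (ennreal \<theta> * \<tau> (insert k0 S) z) * ennreal ((\<Prod>k\<in>D - S. mass (fst k) (B k) \<omega>) * expo z \<omega>) \<partial>M))"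
        by (intro sum.cong refl, subst nn_integral_cmult, measurable) (simp only: mult_ac)
      finally show ?thesis .
    next
      case False
      then have "?w z = 0" by (auto simp: gamma_weight_def)
      then show ?thesis
        by (simp only: mult_zero_left mult_zero_right nn_integral_const sum.neutral_const)
    qed
  qed
  also have "\<dots> = (\<Sum>S\<in>Pow D. ?g S * (\<integral>\<^sup>+z. (\<integral>\<^sup>+\<omega>. ?w z * (ennreal \<theta> * \<tau> (insert k0 S) z) * ennreal ((\<Prod>k\<in>D - S. mass (fst k) (B k) \<omega>) * expo z \<omega>) \<partial>M) \<partial>?LL))"
    by (subst nn_integral_sum, measurable) (intro sum.cong refl nn_integral_cmult, measurable)
  also have "\<dots> = (\<Sum>S\<in>Pow D. ?g S * (\<integral>\<^sup>+\<omega>. block_weight D k0 S \<omega> * ennreal (\<Prod>k\<in>D - S. norm_mass (fst k) \<omega> (B k)) \<partial>M))"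
  proof (intro sum.cong refl arg_cong2[where f="(*)"])
    fix S
    have "(\<integral>\<^sup>+z. (\<integral>\<^sup>+\<omega>. ?w z * (ennreal \<theta> * \<tau> (insert k0 S) z) * ennreal ((\<Prod>k\<in>D - S. mass (fst k) (B k) \<omega>) * expo z \<omega>) \<partial>M) \<partial>?LL)
      = (\<integral>\<^sup>+\<omega>. (\<integral>\<^sup>+z. ?w z * (ennreal \<theta> * \<tau> (insert k0 S) z) * ennreal ((\<Prod>k\<in>D - S. mass (fst k) (B k) \<omega>) * expo z \<omega>) \<partial>?LL) \<partial>M)"
      by (rule MU.Fubini') measurable
    also have "\<dots> = (\<integral>\<^sup>+\<omega>. block_weight D k0 S \<omega> * ennreal (\<Prod>k\<in>D - S. norm_mass (fst k) \<omega> (B k)) \<partial>M)"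
    proof (rule nn_integral_cong_AE)
      show "AE \<omega> in M. (\<integral>\<^sup>+z. ?w z * (ennreal \<theta> * \<tau> (insert k0 S) z) * ennreal ((\<Prod>k\<in>D - S. mass (fst k) (B k) \<omega>) * expo z \<omega>) \<partial>?LL)
          = block_weight D k0 S \<omega> * ennreal (\<Prod>k\<in>D - S. norm_mass (fst k) \<omega> (B k))"
        using AE_good
      proof eventually_elim
        fix \<omega> assume g: "good \<omega>"
        \<comment> \<open>Splitting off the total masses leaves a product of normalised masses,
          which does not depend on \<open>z\<close> and can leave the integral.\<close>
        have "(\<Prod>k\<in>D - S. mass (fst k) (B k) \<omega>) = (\<Prod>k\<in>D - S. mass (fst k) UNIV \<omega> * norm_mass (fst k) \<omega> (B k))"
          using mass_UNIV_pos[OF g] by (intro prod.cong) (auto simp: norm_mass_good[OF g] less_imp_neq[symmetric])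
        then have e: "(\<Prod>k\<in>D - S. mass (fst k) (B k) \<omega>) = (\<Prod>k\<in>D - S. mass (fst k) UNIV \<omega>) * (\<Prod>k\<in>D - S. norm_mass (fst k) \<omega> (B k))"
          by (simp only: prod.distrib)
        have "(\<integral>\<^sup>+z. ?w z * (ennreal \<theta> * \<tau> (insert k0 S) z) * ennreal ((\<Prod>k\<in>D - S. mass (fst k) (B k) \<omega>) * expo z \<omega>) \<partial>?LL)
          = (\<integral>\<^sup>+z. ?w z * (ennreal \<theta> * \<tau> (insert k0 S) z) * ennreal ((\<Prod>k\<in>D - S. mass (fst k) UNIV \<omega>) * expo z \<omega>)
              * ennreal (\<Prod>k\<in>D - S. norm_mass (fst k) \<omega> (B k)) \<partial>?LL)"
        proof (rule nn_integral_cong)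
          fix z
          have "ennreal ((\<Prod>k\<in>D - S. mass (fst k) (B k) \<omega>) * expo z \<omega>)
              = ennreal ((\<Prod>k\<in>D - S. mass (fst k) UNIV \<omega>) * expo z \<omega>) * ennreal (\<Prod>k\<in>D - S. norm_mass (fst k) \<omega> (B k))"
            unfolding e by (subst ennreal_mult'[symmetric]) (auto intro!: mult_nonneg_nonneg prod_nonneg simp: expo_def mult_ac)
          then show "?w z * (ennreal \<theta> * \<tau> (insert k0 S) z) * ennreal ((\<Prod>k\<in>D - S. mass (fst k) (B k) \<omega>) * expo z \<omega>)
             = ?w z * (ennreal \<theta> * \<tau> (insert k0 S) z) * ennreal ((\<Prod>k\<in>D - S. mass (fst k) UNIV \<omega>) * expo z \<omega>)
              * ennreal (\<Prod>k\<in>D - S. norm_mass (fst k) \<omega> (B k))"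
            by (simp only: mult.assoc)
        qed
        also have "\<dots> = block_weight D k0 S \<omega> * ennreal (\<Prod>k\<in>D - S. norm_mass (fst k) \<omega> (B k))"
          unfolding block_weight_def by (rule nn_integral_multc) measurable
        finally show "(\<integral>\<^sup>+z. ?w z * (ennreal \<theta> * \<tau> (insert k0 S) z) * ennreal ((\<Prod>k\<in>D - S. mass (fst k) (B k) \<omega>) * expo z \<omega>) \<partial>?LL)
          = block_weight D k0 S \<omega> * ennreal (\<Prod>k\<in>D - S. norm_mass (fst k) \<omega> (B k))" .
      qed
    qed
    finally show "(\<integral>\<^sup>+z. (\<integral>\<^sup>+\<omega>. ?w z * (ennreal \<theta> * \<tau> (insert k0 S) z) * ennreal ((\<Prod>k\<in>D - S. mass (fst k) (B k) \<omega>) * expo z \<omega>) \<partial>M) \<partial>?LL)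
      = (\<integral>\<^sup>+\<omega>. block_weight D k0 S \<omega> * ennreal (\<Prod>k\<in>D - S. norm_mass (fst k) \<omega> (B k)) \<partial>M)" .
  qed
  finally show ?thesis .
qed

end

section \<open>The joint law of the observations\<close>

lemma space_gen_sigma[simp]: "space (gen_sigma M Fs) = space M"
  unfolding gen_sigma_def by (rule space_measure_of) auto

lemma sets_gen_sigma:
  "sets (gen_sigma M Fs) = sigma_sets (space M) {f -` B \<inter> space M | f B. f \<in> Fs \<and> B \<in> sets borel}"
  unfolding gen_sigma_def by (rule sets_measure_of) auto

lemma measurable_gen_sigma:
  assumes "f \<in> Fs"
  shows "f \<in> measurable (gen_sigma M Fs) borel"
proof (rule measurableI)
  fix A :: "'b set" assume "A \<in> sets borel"
  then show "f -` A \<inter> space (gen_sigma M Fs) \<in> sets (gen_sigma M Fs)"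
    using assms unfolding sets_gen_sigma by (auto intro!: sigma_sets.Basic)
qed auto

lemma subalgebra_gen_sigma:
  assumes "\<And>f. f \<in> Fs \<Longrightarrow> f \<in> measurable M borel"
  shows "subalgebra M (gen_sigma M Fs)"
  unfolding subalgebra_def sets_gen_sigma
  by (auto intro!: sets.sigma_sets_subset simp: measurable_sets[OF assms])

context furbi begin

definition Z :: "bool \<times> nat \<Rightarrow> 'w \<Rightarrow> 'a" where
  "Z k = (if fst k then X (snd k) else Y (snd k))"

lemma Z_measurable[measurable]: "Z k \<in> measurable M borel"
  by (simp add: Z_def)

lemma subalgebra_Fp: "subalgebra M Fp"
  unfolding Fp_eq
proof (rule subalgebra_gen_sigma)
  fix f assume "f \<in> {\<lambda>\<omega>. nmarg1 (\<mu>1 \<omega>) A |A. A \<in> sets borel} \<union> {\<lambda>\<omega>. nmarg2 (\<mu>2 \<omega>) B |B. B \<in> sets borel}"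
  then obtain b A where "A \<in> sets borel" "f = (\<lambda>\<omega>. norm_mass b \<omega> A)"
    unfolding norm_mass_def by auto metis+
  then show "f \<in> borel_measurable M" by simp
qed

lemma norm_mass_measurable_Fp[measurable]: "A \<in> sets borel \<Longrightarrow> (\<lambda>\<omega>. norm_mass b \<omega> A) \<in> borel_measurable Fp"
  unfolding Fp_eq by (rule measurable_gen_sigma) (cases b; auto simp: norm_mass_def)

lemma norm_mass_UNIV: "good \<omega> \<Longrightarrow> norm_mass b \<omega> UNIV = 1"
  using mass_UNIV_pos[of \<omega> b] by (simp add: norm_mass_good)

lemma norm_mass_le_1: "good \<omega> \<Longrightarrow> A \<in> sets borel \<Longrightarrow> norm_mass b \<omega> A \<le> 1"
  using mass_UNIV_pos[of \<omega> b] mass_le[of A b \<omega>] by (simp add: norm_mass_good)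

text \<open>Frees \<open>cond_iid\<close> from the square index range: indices outside
  \<open>K\<close> get the set \<open>UNIV\<close>, whose normalised mass is 1 on
  \<open>good\<close>. The index 0 is excluded because the ranges in \<open>cond_iid\<close> start
  at 1.\<close>

lemma cond_iid_finite:
  assumes fK: "finite K" and K0: "0 \<notin> snd ` K" and B: "\<And>k. B k \<in> sets borel" and E: "E \<in> sets Fp"
  shows "measure M ({\<omega> \<in> space M. \<forall>k\<in>K. Z k \<omega> \<in> B k} \<inter> E)
       = (\<integral>\<omega>. indicator E \<omega> * (\<Prod>k\<in>K. norm_mass (fst k) \<omega> (B k)) \<partial>M)"
proof -
  note [measurable] = B
  have [measurable]: "E \<in> sets M" using E subalgebra_Fp by (auto simp: subalgebra_def)
  define B' where "B' k = (if k \<in> K then B k else UNIV)" for k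
  have B'[measurable]: "B' k \<in> sets borel" for k using B by (simp add: B'_def)
  obtain N where N: "\<And>k. k \<in> K \<Longrightarrow> snd k \<le> N"
    using fK finite_nat_set_iff_bounded_le[of "snd ` K"] by auto
  have KN: "K \<subseteq> UNIV \<times> {1..N}"
  proof
    fix k assume k: "k \<in> K"
    then have "snd k \<noteq> 0" using K0 by force
    then show "k \<in> UNIV \<times> {1..N}" using N[OF k] by (cases k) auto
  qed
  have "{\<omega> \<in> space M. \<forall>k\<in>K. Z k \<omega> \<in> B k} = {\<omega> \<in> space M. (\<forall>i\<in>{1..N}. X i \<omega> \<in> B' (True, i)) \<and> (\<forall>j\<in>{1..N}. Y j \<omega> \<in> B' (False, j))}"
  proof (intro Collect_cong conj_cong refl iffI)
    fix \<omega> assume *: "\<forall>k\<in>K. Z k \<omega> \<in> B k"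
    show "(\<forall>i\<in>{1..N}. X i \<omega> \<in> B' (True, i)) \<and> (\<forall>j\<in>{1..N}. Y j \<omega> \<in> B' (False, j))"
      using bspec[OF *, of "(True, i)" for i] bspec[OF *, of "(False, i)" for i]
      by (auto simp: B'_def Z_def)
  next
    fix \<omega> assume *: "(\<forall>i\<in>{1..N}. X i \<omega> \<in> B' (True, i)) \<and> (\<forall>j\<in>{1..N}. Y j \<omega> \<in> B' (False, j))"
    show "\<forall>k\<in>K. Z k \<omega> \<in> B k"
    proof
      fix k assume k: "k \<in> K"
      obtain b i where bi: "k = (b, i)" by (cases k)
      then have "i \<in> {1..N}" using KN k by auto
      then have "X i \<omega> \<in> B' (True, i)" "Y i \<omega> \<in> B' (False, i)" using * by blast+
      then show "Z k \<omega> \<in> B k" using k bi by (cases b) (auto simp: B'_def Z_def)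
    qed
  qed
  then have "measure M ({\<omega> \<in> space M. \<forall>k\<in>K. Z k \<omega> \<in> B k} \<inter> E)
     = (\<integral>\<omega>. indicator E \<omega> * (\<Prod>i\<in>{1..N}. nmarg1 (\<mu>1 \<omega>) (B' (True, i))) * (\<Prod>j\<in>{1..N}. nmarg2 (\<mu>2 \<omega>) (B' (False, j))) \<partial>M)"
    using cond_iid[of "\<lambda>i. B' (True, i)" "\<lambda>j. B' (False, j)" E N] E B' by simp
  also have "\<dots> = (\<integral>\<omega>. indicator E \<omega> * (\<Prod>i\<in>{1..N}. norm_mass True \<omega> (B' (True, i))) * (\<Prod>j\<in>{1..N}. norm_mass False \<omega> (B' (False, j))) \<partial>M)"
    by (simp add: norm_mass_def)
  also have "\<dots> = (\<integral>\<omega>. indicator E \<omega> * (\<Prod>k\<in>K. norm_mass (fst k) \<omega> (B k)) \<partial>M)"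
  proof (rule integral_cong_AE)
    show "AE \<omega> in M. indicator E \<omega> * (\<Prod>i\<in>{1..N}. norm_mass True \<omega> (B' (True, i))) * (\<Prod>j\<in>{1..N}. norm_mass False \<omega> (B' (False, j)))
        = indicator E \<omega> * (\<Prod>k\<in>K. norm_mass (fst k) \<omega> (B k))"
      using AE_good
    proof eventually_elim
      fix \<omega> assume g: "good \<omega>"
      have "(\<Prod>i\<in>{1..N}. norm_mass True \<omega> (B' (True, i))) * (\<Prod>j\<in>{1..N}. norm_mass False \<omega> (B' (False, j)))
          = (\<Prod>b\<in>UNIV. \<Prod>i\<in>{1..N}. norm_mass b \<omega> (B' (b, i)))"
        by (simp add: UNIV_bool mult.commute)
      also have "\<dots> = (\<Prod>k\<in>UNIV \<times> {1..N}. norm_mass (fst k) \<omega> (B' k))"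
        unfolding prod.cartesian_product by (intro prod.cong) auto
      also have "\<dots> = (\<Prod>k\<in>K. norm_mass (fst k) \<omega> (B' k))"
        by (rule prod.mono_neutral_right) (use KN norm_mass_UNIV[OF g] in \<open>auto simp: B'_def\<close>)
      also have "\<dots> = (\<Prod>k\<in>K. norm_mass (fst k) \<omega> (B k))"
        by (intro prod.cong) (auto simp: B'_def)
      finally show "indicator E \<omega> * (\<Prod>i\<in>{1..N}. norm_mass True \<omega> (B' (True, i))) * (\<Prod>j\<in>{1..N}. norm_mass False \<omega> (B' (False, j)))
        = indicator E \<omega> * (\<Prod>k\<in>K. norm_mass (fst k) \<omega> (B k))" by (simp only: mult.assoc)
    qed
  qed measurable
  finally show ?thesis .
qed

text \<open>From events of \<open>Fp\<close> to nonnegative \<open>Fp\<close>-measurable integrands: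
  two finite measures, with the event and with the product of normalised masses as density, agree on
  \<open>Fp\<close>.\<close>

lemma cond_iid_nn:
  assumes fK: "finite K" and K0: "0 \<notin> snd ` K" and B[measurable]: "\<And>k. B k \<in> sets borel"
    and h[measurable]: "h \<in> borel_measurable Fp"
  shows "(\<integral>\<^sup>+\<omega>. h \<omega> * indicator {\<omega> \<in> space M. \<forall>k\<in>K. Z k \<omega> \<in> B k} \<omega> \<partial>M)
       = (\<integral>\<^sup>+\<omega>. h \<omega> * ennreal (\<Prod>k\<in>K. norm_mass (fst k) \<omega> (B k)) \<partial>M)"
proof -
  let ?A = "{\<omega> \<in> space M. \<forall>k\<in>K. Z k \<omega> \<in> B k}"
  let ?p = "\<lambda>\<omega>. \<Prod>k\<in>K. norm_mass (fst k) \<omega> (B k)"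
  have [measurable]: "?A \<in> sets M" using fK by measurable
  have id[measurable]: "(\<lambda>x. x) \<in> measurable M Fp"
    using subalgebra_Fp by (auto simp: subalgebra_def intro!: measurableI)
  have hM[measurable]: "h \<in> borel_measurable M"
    using h subalgebra_Fp by (rule measurable_from_subalg[rotated])
  \<comment> \<open>The image under the identity map into \<open>Fp\<close> is the restriction of a
    measure to that sub-sigma-algebra.\<close>
  have "distr (density M (indicator ?A)) Fp (\<lambda>x. x) = distr (density M (\<lambda>\<omega>. ennreal (?p \<omega>))) Fp (\<lambda>x. x)"
  proof (rule measure_eqI)
    fix E assume "E \<in> sets (distr (density M (indicator ?A)) Fp (\<lambda>x. x))"
    then have E: "E \<in> sets Fp" by simp
    then have EM[measurable]: "E \<in> sets M" using subalgebra_Fp by (auto simp: subalgebra_def)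
    have bnd: "AE \<omega> in M. norm (indicator E \<omega> * ?p \<omega>) \<le> 1"
      using AE_good
    proof eventually_elim
      fix \<omega> assume g: "good \<omega>"
      have "?p \<omega> \<le> 1" by (rule prod_le_1) (auto simp: norm_mass_le_1[OF g])
      then show "norm (indicator E \<omega> * ?p \<omega>) \<le> 1"
        by (auto simp: abs_mult prod_nonneg split: split_indicator)
    qed
    have "emeasure (distr (density M (indicator ?A)) Fp (\<lambda>x. x)) E = emeasure M (?A \<inter> E)"
    proof -
      have "emeasure (distr (density M (indicator ?A)) Fp (\<lambda>x. x)) E = emeasure (density M (indicator ?A)) E"
        using E EM sets.sets_into_space[OF EM] by (subst emeasure_distr) (auto simp: Int_absorb2)
      also have "\<dots> = (\<integral>\<^sup>+\<omega>. indicator (?A \<inter> E) \<omega> \<partial>M)"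
        by (subst emeasure_density) (measurable, auto simp: indicator_inter_arith simp del: nn_integral_indicator intro!: nn_integral_cong)
      also have "\<dots> = emeasure M (?A \<inter> E)" by (rule nn_integral_indicator) measurable
      finally show ?thesis .
    qed
    also have "\<dots> = ennreal (\<integral>\<omega>. indicator E \<omega> * ?p \<omega> \<partial>M)"
      by (simp only: emeasure_eq_measure cond_iid_finite[OF fK K0 B E])
    also have "\<dots> = (\<integral>\<^sup>+\<omega>. ennreal (indicator E \<omega> * ?p \<omega>) \<partial>M)"
      by (rule nn_integral_eq_integral[symmetric])
         (use bnd in \<open>auto intro!: integrable_const_bound[where B=1] mult_nonneg_nonneg prod_nonneg\<close>)
    also have "\<dots> = emeasure (distr (density M (\<lambda>\<omega>. ennreal (?p \<omega>))) Fp (\<lambda>x. x)) E"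
      using E EM sets.sets_into_space[OF EM]
      by (subst emeasure_distr) (auto simp: emeasure_density Int_absorb2 intro!: nn_integral_cong split: split_indicator)
    finally show "emeasure (distr (density M (indicator ?A)) Fp (\<lambda>x. x)) E = emeasure (distr (density M (\<lambda>\<omega>. ennreal (?p \<omega>))) Fp (\<lambda>x. x)) E" .
  qed simp
  then have "integral\<^sup>N (distr (density M (indicator ?A)) Fp (\<lambda>x. x)) h = integral\<^sup>N (distr (density M (\<lambda>\<omega>. ennreal (?p \<omega>))) Fp (\<lambda>x. x)) h"
    by simp
  then show ?thesis
    by (simp add: nn_integral_distr nn_integral_density mult.commute)
qed

text \<open>The identity \<open>cond_iid\<close> only holds for events of \<open>Fp\<close>, and \<open>block_weight\<close> depends on the total masses, which are not \<open>Fp\<close>-measurable.\<close>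

definition cond_block_weight :: "(bool \<times> nat) set \<Rightarrow> bool \<times> nat \<Rightarrow> (bool \<times> nat) set \<Rightarrow> 'w \<Rightarrow> ennreal" where
  "cond_block_weight D k0 S = nn_cond_exp M Fp (block_weight D k0 S)"

lemma cond_block_weight_measurable_Fp[measurable]: "cond_block_weight D k0 S \<in> borel_measurable Fp"
  unfolding cond_block_weight_def by simp

lemma cond_block_weight_measurable[measurable]: "cond_block_weight D k0 S \<in> borel_measurable M"
  using measurable_from_subalg[OF subalgebra_Fp cond_block_weight_measurable_Fp] .

lemma cond_block_weight_intg:
  assumes "f \<in> borel_measurable Fp"
  shows "(\<integral>\<^sup>+\<omega>. cond_block_weight D k0 S \<omega> * f \<omega> \<partial>M) = (\<integral>\<^sup>+\<omega>. block_weight D k0 S \<omega> * f \<omega> \<partial>M)"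
proof -
  interpret F: finite_measure_subalgebra M Fp
    by unfold_locales (rule subalgebra_Fp)
  show ?thesis using F.nn_cond_exp_intg[OF assms block_weight_measurable[of D k0 S]] by (simp add: cond_block_weight_def mult.commute)
qed

text \<open>The observations after those that share their atom with \<open>k0\<close> have been replaced by coordinates of a fresh draw from \<open>G0\<close>.\<close>

definition resampled :: "(bool \<times> nat) set \<Rightarrow> bool \<times> nat \<Rightarrow> (bool \<times> nat) set \<Rightarrow> 'w \<times> ('a \<times> 'a) \<Rightarrow> bool \<times> nat \<Rightarrow> 'a" where
  "resampled D k0 S x = (\<lambda>k\<in>insert k0 D. if k \<in> insert k0 S then coord (fst k) (snd x) else Z k (fst x))"

lemma resampled_measurable[measurable]:
  "resampled D k0 S \<in> measurable (M \<Otimes>\<^sub>M G0) (PiM (insert k0 D) (\<lambda>_. borel))"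
  unfolding resampled_def[abs_def] by (rule measurable_restrict) (auto split: if_split)

text \<open>Both sides integrate \<open>F\<close> against measures on a finite product, so
  rectangles suffice. There the left side is a mixed moment. In its expansion the products of
  normalised masses are \<open>Fp\<close>-measurable, so \<open>block_weight\<close> may be replaced
  by its conditional expectation; this is \<open>Fp\<close>-measurable as well, so the normalised
  masses may then be replaced by events of observations.\<close>

lemma joint_law:
  assumes fD: "finite D" and D0: "0 \<notin> snd ` insert k0 D" and k0: "k0 \<notin> D"
    and pos: "\<And>b. 0 < side_count b (insert k0 D)"
    and F[measurable]: "F \<in> borel_measurable (PiM (insert k0 D) (\<lambda>_. borel))"
  shows "(\<integral>\<^sup>+\<omega>. F (\<lambda>k\<in>insert k0 D. Z k \<omega>) \<partial>M)
     = (\<Sum>S\<in>Pow D. \<integral>\<^sup>+x. cond_block_weight D k0 S (fst x) * F (resampled D k0 S x) \<partial>(M \<Otimes>\<^sub>M G0))"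
proof -
  let ?D = "insert k0 D"
  let ?P = "PiM ?D (\<lambda>_. borel :: 'a measure)"
  let ?C = "count_space (Pow D) \<Otimes>\<^sub>M (M \<Otimes>\<^sub>M G0)"
  have fD': "finite (Pow D)" "countable (Pow D)" using fD by (auto intro: countable_finite)
  define L where "L = distr M ?P (\<lambda>\<omega>. \<lambda>k\<in>?D. Z k \<omega>)"
  \<comment> \<open>A counting measure on \<open>Pow D\<close> merges the sum over \<open>S\<close>
    into a single measure, as the uniqueness argument compares two measures.\<close>
  define Q where "Q = distr (density ?C (\<lambda>x. cond_block_weight D k0 (fst x) (fst (snd x)))) ?P (\<lambda>x. resampled D k0 (fst x) (snd x))"
  have sf: "sigma_finite_measure (M \<Otimes>\<^sub>M G0)"
    by (intro sigma_finite_pair_measure sigma_finite_measure_axioms G0.sigma_finite_measure_axioms)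
  have [measurable]: "(\<lambda>x. cond_block_weight D k0 (fst x) (fst (snd x))) \<in> borel_measurable ?C"
    using fD' by (intro measurable_pair_measure_countable1) auto
  have [measurable]: "(\<lambda>x. resampled D k0 (fst x) (snd x)) \<in> measurable ?C ?P"
    using fD' by (intro measurable_pair_measure_countable1) auto
  have Q_int: "integral\<^sup>N Q F = (\<Sum>S\<in>Pow D. \<integral>\<^sup>+x. cond_block_weight D k0 S (fst x) * F (resampled D k0 S x) \<partial>(M \<Otimes>\<^sub>M G0))"
    if [measurable]: "F \<in> borel_measurable ?P" for F
  proof -
    have "integral\<^sup>N Q F = (\<integral>\<^sup>+x. cond_block_weight D k0 (fst x) (fst (snd x)) * F (resampled D k0 (fst x) (snd x)) \<partial>?C)"
      unfolding Q_def by (simp add: nn_integral_distr nn_integral_density)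
    also have "\<dots> = (\<integral>\<^sup>+S. \<integral>\<^sup>+x. cond_block_weight D k0 S (fst x) * F (resampled D k0 S x) \<partial>(M \<Otimes>\<^sub>M G0) \<partial>count_space (Pow D))"
      by (subst sigma_finite_measure.nn_integral_fst[OF sf, symmetric]) auto
    also have "\<dots> = (\<Sum>S\<in>Pow D. \<integral>\<^sup>+x. cond_block_weight D k0 S (fst x) * F (resampled D k0 S x) \<partial>(M \<Otimes>\<^sub>M G0))"
      by (rule nn_integral_count_space_finite[OF fD'(1)])
    finally show ?thesis .
  qed
  have Zm[measurable]: "(\<lambda>\<omega>. \<lambda>k\<in>?D. Z k \<omega>) \<in> measurable M ?P"
    by (rule measurable_restrict) simp
  have "L = Q"
  proof (rule measure_eqI_PiM_finite[where I="?D" and M="\<lambda>_. borel"])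
    show "finite ?D" using fD by simp
    show "sets L = sets ?P" "sets Q = sets ?P" by (simp_all add: L_def Q_def)
    show "range (\<lambda>i::nat. space ?P) \<subseteq> prod_algebra ?D (\<lambda>_. borel)"
      using fD by (auto simp: space_PiM intro!: prod_algebraI_finite[where E="\<lambda>_. UNIV", simplified])
    show "(\<Union>i::nat. space ?P) = space ?P" by simp
    show "emeasure L (space ?P) \<noteq> \<infinity>" for i :: nat
    proof -
      interpret L: prob_space L unfolding L_def by (rule prob_space_distr) simp
      show ?thesis by simp
    qed
    fix B0 :: "bool \<times> nat \<Rightarrow> 'a set" assume B0: "\<And>k. k \<in> ?D \<Longrightarrow> B0 k \<in> sets borel"
    \<comment> \<open>Nothing is known of \<open>B0\<close> outside \<open>insert k0 D\<close>; the
      value \<open>UNIV\<close> there makes all sets measurable and leaves the rectangle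
      unchanged.\<close>
    define B where "B k = (if k \<in> ?D then B0 k else UNIV)" for k
    have B[measurable]: "B k \<in> sets borel" for k using B0 by (simp add: B_def)
    have PB: "Pi\<^sub>E ?D B0 = Pi\<^sub>E ?D B" by (intro PiE_cong) (simp add: B_def)
    have PBs[measurable]: "Pi\<^sub>E ?D B \<in> sets ?P" using fD by (intro sets_PiM_I_finite) auto
    have "emeasure L (Pi\<^sub>E ?D B) = (\<integral>\<^sup>+\<omega>. indicator {\<omega> \<in> space M. \<forall>k\<in>?D. Z k \<omega> \<in> B k} \<omega> \<partial>M)"
    proof -
      have "{\<omega> \<in> space M. \<forall>k\<in>?D. Z k \<omega> \<in> B k} \<in> sets M" using fD by measurable
      then have "(\<integral>\<^sup>+\<omega>. indicator {\<omega> \<in> space M. \<forall>k\<in>?D. Z k \<omega> \<in> B k} \<omega> \<partial>M) = emeasure M {\<omega> \<in> space M. \<forall>k\<in>?D. Z k \<omega> \<in> B k}"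
        by (rule nn_integral_indicator)
      moreover have "emeasure L (Pi\<^sub>E ?D B) = emeasure M ((\<lambda>\<omega>. \<lambda>k\<in>?D. Z k \<omega>) -` Pi\<^sub>E ?D B \<inter> space M)"
        unfolding L_def by (rule emeasure_distr) measurable
      moreover have "(\<lambda>\<omega>. \<lambda>k\<in>?D. Z k \<omega>) -` Pi\<^sub>E ?D B \<inter> space M = {\<omega> \<in> space M. \<forall>k\<in>?D. Z k \<omega> \<in> B k}"
        by (auto simp: PiE_iff)
      ultimately show ?thesis by simp
    qed
    also have "\<dots> = (\<integral>\<^sup>+\<omega>. ennreal (\<Prod>k\<in>?D. norm_mass (fst k) \<omega> (B k)) \<partial>M)"
      using cond_iid_nn[OF _ D0 B, of "\<lambda>_. 1"] fD by simp
    also have "\<dots> = (\<Sum>S\<in>Pow D. emeasure G0 {q. \<forall>k\<in>insert k0 S. coord (fst k) q \<in> B k}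
          * (\<integral>\<^sup>+\<omega>. block_weight D k0 S \<omega> * ennreal (\<Prod>k\<in>D - S. norm_mass (fst k) \<omega> (B k)) \<partial>M))"
      by (rule mixed_moment_expansion[OF fD D0 k0 pos B])
    also have "\<dots> = (\<Sum>S\<in>Pow D. \<integral>\<^sup>+x. cond_block_weight D k0 S (fst x) * indicator (Pi\<^sub>E ?D B) (resampled D k0 S x) \<partial>(M \<Otimes>\<^sub>M G0))"
    proof (intro sum.cong refl)
      fix S assume S: "S \<in> Pow D"
      let ?R = "{q. \<forall>k\<in>insert k0 S. coord (fst k) q \<in> B k}"
      let ?E = "{\<omega> \<in> space M. \<forall>k\<in>D - S. Z k \<omega> \<in> B k}"
      have fS: "finite S" using S fD finite_subset by auto
      have R[measurable]: "?R \<in> sets G0"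
      proof -
        have "?R = {q \<in> space G0. \<forall>k\<in>insert k0 S. coord (fst k) q \<in> B k}" by simp
        also have "\<dots> \<in> sets G0" using fS by measurable
        finally show ?thesis .
      qed
      have E[measurable]: "?E \<in> sets M" using fD by measurable
      have "(\<integral>\<^sup>+x. cond_block_weight D k0 S (fst x) * indicator (Pi\<^sub>E ?D B) (resampled D k0 S x) \<partial>(M \<Otimes>\<^sub>M G0))
         = (\<integral>\<^sup>+x. (cond_block_weight D k0 S (fst x) * indicator ?E (fst x)) * indicator ?R (snd x) \<partial>(M \<Otimes>\<^sub>M G0))"
      proof (rule nn_integral_cong)
        fix x assume x: "x \<in> space (M \<Otimes>\<^sub>M G0)"
        \<comment> \<open>The rectangle splits into a condition on the fresh location, for the
          indices of the block, and one on the observations outside it. The product measure then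
          factors.\<close>
        have "resampled D k0 S x \<in> Pi\<^sub>E ?D B \<longleftrightarrow> fst x \<in> ?E \<and> snd x \<in> ?R"
        proof -
          have "?D = insert k0 S \<union> (D - S)" using S by auto
          then have "resampled D k0 S x \<in> Pi\<^sub>E ?D B \<longleftrightarrow>
              (\<forall>k\<in>insert k0 S. (if k \<in> insert k0 S then coord (fst k) (snd x) else Z k (fst x)) \<in> B k)
            \<and> (\<forall>k\<in>D - S. (if k \<in> insert k0 S then coord (fst k) (snd x) else Z k (fst x)) \<in> B k)"
            by (simp only: resampled_def restrict_PiE_iff ball_Un)
          also have "\<dots> \<longleftrightarrow> snd x \<in> ?R \<and> fst x \<in> ?E"
          proof (intro conj_cong)
            have "(\<forall>k\<in>D - S. (if k \<in> insert k0 S then coord (fst k) (snd x) else Z k (fst x)) \<in> B k) \<longleftrightarrow> (\<forall>k\<in>D - S. Z k (fst x) \<in> B k)"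
              using k0 by (intro ball_cong) auto
            then show "(\<forall>k\<in>D - S. (if k \<in> insert k0 S then coord (fst k) (snd x) else Z k (fst x)) \<in> B k) \<longleftrightarrow> fst x \<in> ?E"
              using x by (simp add: space_pair_measure mem_Times_iff)
          qed auto
          finally show ?thesis by (simp only: conj_commute)
        qed
        then show "cond_block_weight D k0 S (fst x) * indicator (Pi\<^sub>E ?D B) (resampled D k0 S x) = (cond_block_weight D k0 S (fst x) * indicator ?E (fst x)) * indicator ?R (snd x)"
          by (auto simp: indicator_def)
      qed
      also have "\<dots> = (\<integral>\<^sup>+\<omega>. \<integral>\<^sup>+q. (cond_block_weight D k0 S \<omega> * indicator ?E \<omega>) * indicator ?R q \<partial>G0 \<partial>M)"
        by (subst G0.nn_integral_fst[symmetric]) auto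
      also have "\<dots> = (\<integral>\<^sup>+\<omega>. (cond_block_weight D k0 S \<omega> * indicator ?E \<omega>) * emeasure G0 ?R \<partial>M)"
        by (intro nn_integral_cong nn_integral_cmult_indicator R)
      also have "\<dots> = (\<integral>\<^sup>+\<omega>. cond_block_weight D k0 S \<omega> * indicator ?E \<omega> \<partial>M) * emeasure G0 ?R"
        by (rule nn_integral_multc) measurable
      also have "(\<integral>\<^sup>+\<omega>. cond_block_weight D k0 S \<omega> * indicator ?E \<omega> \<partial>M) = (\<integral>\<^sup>+\<omega>. cond_block_weight D k0 S \<omega> * ennreal (\<Prod>k\<in>D - S. norm_mass (fst k) \<omega> (B k)) \<partial>M)"
        by (rule cond_iid_nn) (use fD D0 in auto)
      also have "\<dots> = (\<integral>\<^sup>+\<omega>. block_weight D k0 S \<omega> * ennreal (\<Prod>k\<in>D - S. norm_mass (fst k) \<omega> (B k)) \<partial>M)"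
        by (rule cond_block_weight_intg) measurable
      finally show "emeasure G0 ?R * (\<integral>\<^sup>+\<omega>. block_weight D k0 S \<omega> * ennreal (\<Prod>k\<in>D - S. norm_mass (fst k) \<omega> (B k)) \<partial>M)
         = (\<integral>\<^sup>+x. cond_block_weight D k0 S (fst x) * indicator (Pi\<^sub>E ?D B) (resampled D k0 S x) \<partial>(M \<Otimes>\<^sub>M G0))"
        by (simp only: mult.commute)
    qed
    also have "\<dots> = integral\<^sup>N Q (indicator (Pi\<^sub>E ?D B))"
      by (rule Q_int[symmetric]) measurable
    also have "\<dots> = emeasure Q (Pi\<^sub>E ?D B)"
      by (rule nn_integral_indicator) (simp add: Q_def PBs)
    finally show "emeasure L (Pi\<^sub>E ?D B0) = emeasure Q (Pi\<^sub>E ?D B0)" unfolding PB .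
  qed
  then have "integral\<^sup>N L F = integral\<^sup>N Q F" by simp
  moreover have "integral\<^sup>N L F = (\<integral>\<^sup>+\<omega>. F (\<lambda>k\<in>?D. Z k \<omega>) \<partial>M)"
    unfolding L_def by (rule nn_integral_distr) measurable
  ultimately show ?thesis using Q_int[OF F] by simp
qed

end

section \<open>Predictive weights\<close>

text \<open>For almost every \<open>y\<close>, integrating the section of \<open>g\<close> over
  \<open>C\<close> gives \<open>p y\<close> times the kernel at \<open>C\<close>, and
  \<open>p y\<close> is itself the integral of that section.\<close>

lemma disintegrate_density:
  fixes g :: "'b \<times> 'b \<Rightarrow> real"
  assumes sf: "sigma_finite_measure L"
    and [measurable]: "g \<in> borel_measurable (L \<Otimes>\<^sub>M L)" "F \<in> borel_measurable L" "C \<in> sets L"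
    and g: "\<And>z. g z \<ge> 0" and p: "\<And>y. p y \<ge> 0"
    and marg: "AE y in L. (\<integral>\<^sup>+x. ennreal (g (x, y)) \<partial>L) = ennreal (p y)"
  shows "(\<integral>\<^sup>+y. \<integral>\<^sup>+x. ennreal (g (x, y)) * (F y * indicator C x) \<partial>L \<partial>L)
       = (\<integral>\<^sup>+y. \<integral>\<^sup>+x. ennreal (g (x, y)) * (F y * emeasure (density L (\<lambda>x. ennreal (g (x, y) / p y))) C) \<partial>L \<partial>L)"
proof (rule nn_integral_cong_AE)
  show "AE y in L. (\<integral>\<^sup>+x. ennreal (g (x, y)) * (F y * indicator C x) \<partial>L)
      = (\<integral>\<^sup>+x. ennreal (g (x, y)) * (F y * emeasure (density L (\<lambda>x. ennreal (g (x, y) / p y))) C) \<partial>L)"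
    using marg AE_space
  proof eventually_elim
    fix y assume m: "(\<integral>\<^sup>+x. ennreal (g (x, y)) \<partial>L) = ennreal (p y)" and y: "y \<in> space L"
    have [measurable]: "(\<lambda>x. g (x, y)) \<in> borel_measurable L" using y by measurable
    let ?I = "\<integral>\<^sup>+x. ennreal (g (x, y)) * indicator C x \<partial>L"
    let ?K = "emeasure (density L (\<lambda>x. ennreal (g (x, y) / p y))) C"
    have "?I = ?K * ennreal (p y)"
    \<comment> \<open>At \<open>p y = 0\<close> the kernel is defined through a division by zero,
      but both sides vanish because the section of \<open>g\<close> has integral 0.\<close>
    proof (cases "p y = 0")
      case True
      have "?I \<le> (\<integral>\<^sup>+x. ennreal (g (x, y)) \<partial>L)"
        by (intro nn_integral_mono) (auto split: split_indicator)
      then show ?thesis using m True by simp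
    next
      case False
      then have py: "p y > 0" using p[of y] by simp
      have "?K = (\<integral>\<^sup>+x. ennreal (1 / p y) * (ennreal (g (x, y)) * indicator C x) \<partial>L)"
        using py g by (subst emeasure_density) (auto intro!: nn_integral_cong simp: ennreal_mult'[symmetric] split: split_indicator)
      also have "\<dots> = ennreal (1 / p y) * ?I" by (rule nn_integral_cmult) measurable
      finally have "?K * ennreal (p y) = ?I * (ennreal (1 / p y) * ennreal (p y))" by (simp only: mult_ac)
      also have "ennreal (1 / p y) * ennreal (p y) = 1" using py by (simp add: ennreal_mult'[symmetric])
      finally show ?thesis by simp
    qed
    moreover have "(\<integral>\<^sup>+x. ennreal (g (x, y)) * (F y * indicator C x) \<partial>L) = F y * ?I"
      by (subst nn_integral_cmult[symmetric]) (auto simp: mult_ac)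
    moreover have "(\<integral>\<^sup>+x. ennreal (g (x, y)) * (F y * ?K) \<partial>L) = ennreal (p y) * (F y * ?K)"
      unfolding m[symmetric] by (rule nn_integral_multc) measurable
    ultimately show "(\<integral>\<^sup>+x. ennreal (g (x, y)) * (F y * indicator C x) \<partial>L) = (\<integral>\<^sup>+x. ennreal (g (x, y)) * (F y * ?K) \<partial>L)"
      by (simp only: mult_ac)
  qed
qed

context furbi begin

text \<open>The law under \<open>G0\<close> of the coordinate on side \<open>b\<close>, given the
  other coordinate.\<close>

definition Ker :: "bool \<Rightarrow> 'a \<Rightarrow> 'a measure" where
  "Ker b = (if b then Rker lam g0 p0 else Qker lam g0 p0)"

lemma emeasure_Ker_measurable[measurable]:
  assumes [measurable]: "C \<in> sets borel"
  shows "(\<lambda>y. emeasure (Ker b y) C) \<in> borel_measurable borel"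
proof -
  have [measurable]: "C \<in> sets lam" by (simp add: lam_sets)
  have e: "emeasure (Ker b y) C = (\<integral>\<^sup>+x. ennreal ((if b then g0 (x, y) else g0 (y, x)) / p0 y) * indicator C x \<partial>lam)" for y
    by (cases b) (simp_all add: Ker_def Rker_def Qker_def emeasure_density)
  have [measurable]: "p0 \<in> borel_measurable borel" "g0 \<in> borel_measurable (borel \<Otimes>\<^sub>M lam)" "g0 \<in> borel_measurable (lam \<Otimes>\<^sub>M borel)"
    using p0_meas g0_meas by (simp_all cong: measurable_cong_sets add: lam_sets)
  show ?thesis unfolding e by (cases b) simp_all
qed

text \<open>Both functions are densities of the same marginal of \<open>G0\<close>, and densities
  with respect to a sigma-finite measure are unique almost everywhere.\<close>

lemma marginal_density:
  "AE y in lam. (\<integral>\<^sup>+x. ennreal (g0 (x, y)) \<partial>lam) = ennreal (p0 y)"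
  "AE x in lam. (\<integral>\<^sup>+y. ennreal (g0 (x, y)) \<partial>lam) = ennreal (p0 x)"
proof -
  interpret P: pair_sigma_finite lam lam ..
  have "density lam (\<lambda>y. \<integral>\<^sup>+x. ennreal (g0 (x, y)) \<partial>lam) = density lam (\<lambda>y. ennreal (p0 y))"
  proof (rule measure_eqI)
    fix A assume "A \<in> sets (density lam (\<lambda>y. \<integral>\<^sup>+x. ennreal (g0 (x, y)) \<partial>lam))"
    then have A[measurable]: "A \<in> sets lam" by simp
    have "emeasure (density lam (\<lambda>y. ennreal (p0 y))) A = emeasure (distr G0 lam snd) A"
      by (simp add: G0_snd P0_eq)
    also have "\<dots> = (\<integral>\<^sup>+q. indicator A (snd q) \<partial>G0)"
      by (subst nn_integral_indicator[symmetric], simp, subst nn_integral_distr) auto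
    also have "\<dots> = (\<integral>\<^sup>+q. ennreal (g0 q) * indicator A (snd q) \<partial>(lam \<Otimes>\<^sub>M lam))"
      unfolding G0_eq by (rule nn_integral_density) measurable
    also have "\<dots> = (\<integral>\<^sup>+y. \<integral>\<^sup>+x. ennreal (g0 (x, y)) * indicator A y \<partial>lam \<partial>lam)"
      by (subst P.nn_integral_snd[symmetric]) auto
    also have "\<dots> = emeasure (density lam (\<lambda>y. \<integral>\<^sup>+x. ennreal (g0 (x, y)) \<partial>lam)) A"
      by (subst emeasure_density) (auto simp: nn_integral_multc)
    finally show "emeasure (density lam (\<lambda>y. \<integral>\<^sup>+x. ennreal (g0 (x, y)) \<partial>lam)) A = emeasure (density lam (\<lambda>y. ennreal (p0 y))) A" ..
  qed simp
  then show "AE y in lam. (\<integral>\<^sup>+x. ennreal (g0 (x, y)) \<partial>lam) = ennreal (p0 y)"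
    by (subst (asm) lam.density_unique_iff) auto
  have "density lam (\<lambda>x. \<integral>\<^sup>+y. ennreal (g0 (x, y)) \<partial>lam) = density lam (\<lambda>y. ennreal (p0 y))"
  proof (rule measure_eqI)
    fix A assume "A \<in> sets (density lam (\<lambda>x. \<integral>\<^sup>+y. ennreal (g0 (x, y)) \<partial>lam))"
    then have A[measurable]: "A \<in> sets lam" by simp
    have "emeasure (density lam (\<lambda>y. ennreal (p0 y))) A = emeasure (distr G0 lam fst) A"
      by (simp add: G0_fst P0_eq)
    also have "\<dots> = (\<integral>\<^sup>+q. indicator A (fst q) \<partial>G0)"
      by (subst nn_integral_indicator[symmetric], simp, subst nn_integral_distr) auto
    also have "\<dots> = (\<integral>\<^sup>+q. ennreal (g0 q) * indicator A (fst q) \<partial>(lam \<Otimes>\<^sub>M lam))"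
      unfolding G0_eq by (rule nn_integral_density) measurable
    also have "\<dots> = (\<integral>\<^sup>+x. \<integral>\<^sup>+y. ennreal (g0 (x, y)) * indicator A x \<partial>lam \<partial>lam)"
      by (subst lam.nn_integral_fst[symmetric]) auto
    also have "\<dots> = emeasure (density lam (\<lambda>x. \<integral>\<^sup>+y. ennreal (g0 (x, y)) \<partial>lam)) A"
      by (subst emeasure_density) (auto simp: nn_integral_multc)
    finally show "emeasure (density lam (\<lambda>x. \<integral>\<^sup>+y. ennreal (g0 (x, y)) \<partial>lam)) A = emeasure (density lam (\<lambda>y. ennreal (p0 y))) A" ..
  qed simp
  then show "AE y in lam. (\<integral>\<^sup>+x. ennreal (g0 (y, x)) \<partial>lam) = ennreal (p0 y)"
    by (subst (asm) lam.density_unique_iff) auto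
qed

lemma disintegration:
  assumes [measurable]: "F \<in> borel_measurable borel" "C \<in> sets borel"
  shows "(\<integral>\<^sup>+q. F (coord (\<not> b) q) * indicator C (coord b q) \<partial>G0)
       = (\<integral>\<^sup>+q. F (coord (\<not> b) q) * emeasure (Ker b (coord (\<not> b) q)) C \<partial>G0)"
proof -
  interpret P: pair_sigma_finite lam lam ..
  have [measurable]: "F \<in> borel_measurable lam" "C \<in> sets lam" "(\<lambda>y. emeasure (Ker b y) C) \<in> borel_measurable lam"
    using emeasure_Ker_measurable[of C b] assms by (simp_all cong: measurable_cong_sets add: lam_sets)
  show ?thesis
  proof (cases b)
    case True
    have "(\<integral>\<^sup>+q. F (snd q) * \<Phi> (fst q) (snd q) \<partial>G0) = (\<integral>\<^sup>+y. \<integral>\<^sup>+x. ennreal (g0 (x, y)) * (F y * \<Phi> x y) \<partial>lam \<partial>lam)"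
      if [measurable]: "(\<lambda>q. \<Phi> (fst q) (snd q)) \<in> borel_measurable (lam \<Otimes>\<^sub>M lam)" for \<Phi>
      unfolding G0_eq by (subst nn_integral_density, measurable, subst P.nn_integral_snd[symmetric]) auto
    note G0_int = this
    have "(\<integral>\<^sup>+q. F (snd q) * indicator C (fst q) \<partial>G0) = (\<integral>\<^sup>+y. \<integral>\<^sup>+x. ennreal (g0 (x, y)) * (F y * indicator C x) \<partial>lam \<partial>lam)"
      by (rule G0_int) measurable
    moreover have "(\<integral>\<^sup>+q. F (snd q) * emeasure (Ker b (snd q)) C \<partial>G0) = (\<integral>\<^sup>+y. \<integral>\<^sup>+x. ennreal (g0 (x, y)) * (F y * emeasure (Ker b y) C) \<partial>lam \<partial>lam)"
      by (rule G0_int) measurable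
    moreover have "(\<integral>\<^sup>+y. \<integral>\<^sup>+x. ennreal (g0 (x, y)) * (F y * indicator C x) \<partial>lam \<partial>lam)
       = (\<integral>\<^sup>+y. \<integral>\<^sup>+x. ennreal (g0 (x, y)) * (F y * emeasure (density lam (\<lambda>x. ennreal (g0 (x, y) / p0 y))) C) \<partial>lam \<partial>lam)"
      by (rule disintegrate_density) (use lam_sf g0_nn p0_nn marginal_density in auto)
    ultimately show ?thesis using True by (simp add: coord_def Ker_def Rker_def)
  next
    case False
    have "(\<integral>\<^sup>+q. F (fst q) * \<Phi> (fst q) (snd q) \<partial>G0) = (\<integral>\<^sup>+y. \<integral>\<^sup>+x. ennreal (g0 (y, x)) * (F y * \<Phi> y x) \<partial>lam \<partial>lam)"
      if [measurable]: "(\<lambda>q. \<Phi> (fst q) (snd q)) \<in> borel_measurable (lam \<Otimes>\<^sub>M lam)" for \<Phi>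
      unfolding G0_eq by (subst nn_integral_density, measurable, subst lam.nn_integral_fst[symmetric]) auto
    note G0_int = this
    have "(\<integral>\<^sup>+q. F (fst q) * indicator C (snd q) \<partial>G0) = (\<integral>\<^sup>+y. \<integral>\<^sup>+x. ennreal (g0 (y, x)) * (F y * indicator C x) \<partial>lam \<partial>lam)"
      by (rule G0_int) measurable
    moreover have "(\<integral>\<^sup>+q. F (fst q) * emeasure (Ker b (fst q)) C \<partial>G0) = (\<integral>\<^sup>+y. \<integral>\<^sup>+x. ennreal (g0 (y, x)) * (F y * emeasure (Ker b y) C) \<partial>lam \<partial>lam)"
      by (rule G0_int) measurable
    \<comment> \<open>\<open>disintegrate_density\<close> conditions on the second argument, so it
      is used for the density with its arguments swapped; the unreduced lambda term matches its
      pattern \<open>g (x, y)\<close>.\<close>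
    moreover have "(\<integral>\<^sup>+y. \<integral>\<^sup>+x. ennreal ((\<lambda>(x, y). g0 (y, x)) (x, y)) * (F y * indicator C x) \<partial>lam \<partial>lam)
       = (\<integral>\<^sup>+y. \<integral>\<^sup>+x. ennreal ((\<lambda>(x, y). g0 (y, x)) (x, y)) * (F y * emeasure (density lam (\<lambda>x. ennreal ((\<lambda>(x, y). g0 (y, x)) (x, y) / p0 y))) C) \<partial>lam \<partial>lam)"
      by (rule disintegrate_density) (use lam_sf g0_nn p0_nn marginal_density in auto)
    ultimately show ?thesis using False by (simp add: coord_def Ker_def Qker_def)
  qed
qed

section \<open>The law of the new observation given its block\<close>

lemma emeasure_G0_coord:
  assumes [measurable]: "C \<in> sets borel"
  shows "(\<integral>\<^sup>+q. indicator C (coord b q) \<partial>G0) = emeasure P0 C"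
proof -
  have C[measurable]: "C \<in> sets lam" by (simp add: lam_sets)
  have "emeasure P0 C = emeasure (distr G0 lam (coord b)) C"
    using G0_fst G0_snd by (cases b) (simp_all add: coord_def[abs_def])
  also have "\<dots> = (\<integral>\<^sup>+q. indicator C (coord b q) \<partial>G0)"
    by (subst nn_integral_indicator[symmetric], simp, subst nn_integral_distr) auto
  finally show ?thesis ..
qed

text \<open>All indices of a block share one location, so indices of the same side carry equal
  values and any of them will do. Side \<open>b\<close> is preferred because it shows the value of
  the new observation itself.\<close>

definition representative :: "bool \<Rightarrow> (bool \<times> nat) set \<Rightarrow> bool \<times> nat" where
  "representative b S = (if \<exists>k\<in>S. fst k = b then SOME k. k \<in> S \<and> fst k = b else SOME k. k \<in> S)"

lemma representative_in: "S \<noteq> {} \<Longrightarrow> representative b S \<in> S"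
proof -
  assume ne: "S \<noteq> {}"
  have "(SOME k. k \<in> S) \<in> S" using ne by (simp add: some_in_eq)
  moreover have "(SOME k. k \<in> S \<and> fst k = b) \<in> S" if "\<exists>k\<in>S. fst k = b"
    using someI_ex[of "\<lambda>k. k \<in> S \<and> fst k = b"] that by blast
  ultimately show ?thesis by (simp add: representative_def)
qed

lemma fst_representative:
  assumes ex: "\<exists>k\<in>S. fst k = b"
  shows "fst (representative b S) = b"
proof -
  have "\<exists>k. k \<in> S \<and> fst k = b" using ex by blast
  from someI_ex[OF this] show ?thesis unfolding representative_def if_P[OF ex] by blast
qed

lemma fst_representative': "S \<noteq> {} \<Longrightarrow> \<not> (\<exists>k\<in>S. fst k = b) \<Longrightarrow> fst (representative b S) = (\<not> b)"
  using representative_in[of S b] by auto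

text \<open>The conditional law of coordinate \<open>b\<close> of a draw from \<open>G0\<close>,
  given the coordinates of that draw which are visible through \<open>S\<close>: none, coordinate
  \<open>b\<close> itself, or only the other one.\<close>

definition block_kernel :: "bool \<Rightarrow> (bool \<times> nat) set \<Rightarrow> 'a set \<Rightarrow> (bool \<times> nat \<Rightarrow> 'a) \<Rightarrow> ennreal" where
  "block_kernel b S C z = (if S = {} then emeasure P0 C
     else if \<exists>k\<in>S. fst k = b then indicator C (z (representative b S))
     else emeasure (Ker b (z (representative b S))) C)"

lemma block_kernel_measurable[measurable]:
  assumes [measurable]: "C \<in> sets borel" and S: "S \<subseteq> D"
  shows "block_kernel b S C \<in> borel_measurable (PiM D (\<lambda>_. borel))"
proof (cases "S = {}")
  case False
  then have "representative b S \<in> D" using representative_in S by blast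
  then have [measurable]: "(\<lambda>z. z (representative b S)) \<in> measurable (PiM D (\<lambda>_. borel :: 'a measure)) borel"
    by (rule measurable_component_singleton)
  show ?thesis unfolding block_kernel_def[abs_def] by measurable
qed (simp add: block_kernel_def[abs_def])

definition data :: "(bool \<times> nat) set \<Rightarrow> 'w \<Rightarrow> bool \<times> nat \<Rightarrow> 'a" where
  "data D \<omega> = (\<lambda>k\<in>D. Z k \<omega>)"

lemma data_measurable[measurable]: "data D \<in> measurable M (PiM D (\<lambda>_. borel))"
  unfolding data_def[abs_def] by (rule measurable_restrict) simp

definition resampled_data :: "(bool \<times> nat) set \<Rightarrow> (bool \<times> nat) set \<Rightarrow> 'w \<times> ('a \<times> 'a) \<Rightarrow> bool \<times> nat \<Rightarrow> 'a" where
  "resampled_data D S x = (\<lambda>k\<in>D. if k \<in> S then coord (fst k) (snd x) else Z k (fst x))"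

lemma resampled_data_measurable[measurable]: "resampled_data D S \<in> measurable (M \<Otimes>\<^sub>M G0) (PiM D (\<lambda>_. borel))"
  unfolding resampled_data_def[abs_def] by (rule measurable_restrict) (auto split: if_split)

text \<open>Replaces the indicator of the new observation by its conditional probability given the
  resampled data. An empty block leaves the location independent of the data; an index of side
  \<open>b\<close> in the block displays the wanted coordinate; in the remaining case disintegration
  applies for each fixed \<omega>.\<close>

lemma kernel_step:
  assumes S: "S \<subseteq> D" and A[measurable]: "A \<in> sets (PiM D (\<lambda>_. borel))" and C[measurable]: "C \<in> sets borel"
    and f[measurable]: "f \<in> borel_measurable M"
  shows "(\<integral>\<^sup>+x. f (fst x) * (indicator A (resampled_data D S x) * indicator C (coord b (snd x))) \<partial>(M \<Otimes>\<^sub>M G0))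
       = (\<integral>\<^sup>+x. f (fst x) * (indicator A (resampled_data D S x) * block_kernel b S C (resampled_data D S x)) \<partial>(M \<Otimes>\<^sub>M G0))"
proof -
  note [measurable] = block_kernel_measurable[OF C S]
  consider "S = {}" | "\<exists>k\<in>S. fst k = b" | "S \<noteq> {}" "\<not> (\<exists>k\<in>S. fst k = b)" by blast
  then show ?thesis
  proof cases
    case 1
    then have a: "resampled_data D S x = data D (fst x)" for x by (simp add: resampled_data_def data_def)
    have "emeasure G0 UNIV = 1" using G0.emeasure_space_1 by simp
    then show ?thesis
      unfolding a
      by (subst (1 2) G0.nn_integral_fst[symmetric])
        (auto simp: 1 block_kernel_def nn_integral_cmult emeasure_G0_coord mult.assoc[symmetric])
  next
    case 2
    then have "representative b S \<in> S" using representative_in by blast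
    then have "resampled_data D S x (representative b S) = coord b (snd x)" for x
      using S fst_representative[OF 2] by (auto simp: resampled_data_def)
    moreover have "S \<noteq> {}" using 2 by auto
    ultimately show ?thesis using 2 by (simp add: block_kernel_def)
  next
    case 3
    \<comment> \<open>With only indices of the other side in \<open>S\<close>, the resampled data
      depend on the location through the single coordinate \<open>y\<close>.\<close>
    define \<Gamma> where "\<Gamma> \<omega> y = (\<lambda>k\<in>D. if k \<in> S then y else Z k \<omega>)" for \<omega> y
    have a: "resampled_data D S (\<omega>, q) = \<Gamma> \<omega> (coord (\<not> b) q)" for \<omega> q
      using 3(2) by (fastforce simp: resampled_data_def \<Gamma>_def)
    have \<Gamma>s: "\<Gamma> \<omega> y (representative b S) = y" for \<omega> y
      using representative_in[OF 3(1)] S by (auto simp: \<Gamma>_def)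
    have \<Gamma>m[measurable]: "\<Gamma> \<omega> \<in> measurable borel (PiM D (\<lambda>_. borel))" for \<omega>
      unfolding \<Gamma>_def[abs_def] by (rule measurable_restrict) (auto split: if_split)
    have "(\<integral>\<^sup>+x. f (fst x) * (indicator A (resampled_data D S x) * indicator C (coord b (snd x))) \<partial>(M \<Otimes>\<^sub>M G0))
       = (\<integral>\<^sup>+\<omega>. \<integral>\<^sup>+q. (f \<omega> * indicator A (\<Gamma> \<omega> (coord (\<not> b) q))) * indicator C (coord b q) \<partial>G0 \<partial>M)"
      by (subst G0.nn_integral_fst[symmetric]) (auto simp: a mult.assoc)
    also have "\<dots> = (\<integral>\<^sup>+\<omega>. \<integral>\<^sup>+q. (f \<omega> * indicator A (\<Gamma> \<omega> (coord (\<not> b) q))) * emeasure (Ker b (coord (\<not> b) q)) C \<partial>G0 \<partial>M)"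
    proof (rule nn_integral_cong)
      fix \<omega>
      show "(\<integral>\<^sup>+q. (f \<omega> * indicator A (\<Gamma> \<omega> (coord (\<not> b) q))) * indicator C (coord b q) \<partial>G0)
        = (\<integral>\<^sup>+q. (f \<omega> * indicator A (\<Gamma> \<omega> (coord (\<not> b) q))) * emeasure (Ker b (coord (\<not> b) q)) C \<partial>G0)"
        by (rule disintegration) measurable
    qed
    also have "\<dots> = (\<integral>\<^sup>+x. f (fst x) * (indicator A (resampled_data D S x) * block_kernel b S C (resampled_data D S x)) \<partial>(M \<Otimes>\<^sub>M G0))"
    proof -
      have m: "(\<lambda>x. f (fst x) * (indicator A (resampled_data D S x) * block_kernel b S C (resampled_data D S x))) \<in> borel_measurable (M \<Otimes>\<^sub>M G0)"
        by measurable
      have "block_kernel b S C (\<Gamma> \<omega> y) = emeasure (Ker b y) C" for \<omega> y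
        unfolding block_kernel_def if_not_P[OF 3(1)] if_not_P[OF 3(2)] \<Gamma>s ..
      then show ?thesis
        by (subst G0.nn_integral_fst[OF m, symmetric]) (simp add: a mult.assoc)
    qed
    finally show ?thesis .
  qed
qed


section \<open>Conditional probabilities given the data\<close>

lemma measurable_data_gen_sigma:
  "data D \<in> measurable (gen_sigma M (Z ` D)) (PiM D (\<lambda>_. borel))"
  unfolding data_def[abs_def] by (rule measurable_restrict) (auto intro: measurable_gen_sigma)

text \<open>Lets a conditional expectation given the data be tested on preimages of measurable sets
  of the product space.\<close>

lemma sets_gen_sigma_data:
  assumes E: "E \<in> sets (gen_sigma M (Z ` D))"
  obtains A where "A \<in> sets (PiM D (\<lambda>_. borel))" "E = data D -` A \<inter> space M"
proof -
  let ?P = "PiM D (\<lambda>_. borel :: 'a measure)"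
  let ?V = "vimage_algebra (space M) (data D) ?P"
  have sp: "data D \<in> space M \<rightarrow> space ?P" by (auto simp: data_def space_PiM)
  have "sets (gen_sigma M (Z ` D)) \<subseteq> sets ?V"
    unfolding sets_gen_sigma
  proof (rule sets.sigma_sets_subset[of _ ?V, simplified])
    show "{f -` B \<inter> space M |f B. f \<in> Z ` D \<and> B \<in> sets borel} \<subseteq> sets ?V"
    proof safe
      fix k and B :: "'a set" assume k: "k \<in> D" and B: "B \<in> sets borel"
      have "(\<lambda>\<omega>. data D \<omega> k) \<in> measurable ?V borel"
        by (rule measurable_compose[OF measurable_vimage_algebra1[OF sp] measurable_component_singleton[OF k]])
      then have "(\<lambda>\<omega>. data D \<omega> k) -` B \<inter> space ?V \<in> sets ?V" using B by (rule measurable_sets)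
      moreover have "(\<lambda>\<omega>. data D \<omega> k) = Z k" using k by (simp add: data_def)
      ultimately show "Z k -` B \<inter> space M \<in> sets ?V" by simp
    qed
  qed
  then have "E \<in> sets ?V" using E by blast
  then show thesis using that by (auto simp: sets_vimage_algebra2[OF sp])
qed

text \<open>\<open>Q S\<close> is the law of the resampled data weighted by
  \<open>cond_block_weight\<close>. Ignoring the new observation in \<open>joint_law\<close> shows
  that these measures add up to the law \<open>L\<close> of the data, so each has a density and the
  densities sum to 1 almost surely. By \<open>kernel_step\<close>, the joint law with the new
  observation integrates \<open>block_kernel\<close> against the same \<open>Q S\<close>, whence the
  mixture.\<close>

lemma predictive_mixture:
  assumes fD: "finite D" and D0: "0 \<notin> snd ` insert k0 D" and k0: "k0 \<notin> D"
    and pos: "\<And>b. 0 < side_count b (insert k0 D)"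
  obtains w :: "(bool \<times> nat) set \<Rightarrow> 'w \<Rightarrow> real" where
    "\<And>S. w S \<in> borel_measurable (gen_sigma M (Z ` D))"
    "\<And>S \<omega>. 0 \<le> w S \<omega>" "\<And>\<omega>. (\<Sum>S\<in>Pow D. w S \<omega>) = 1"
    "\<And>C. C \<in> sets borel \<Longrightarrow> AE \<omega> in M.
        real_cond_exp M (gen_sigma M (Z ` D)) (\<lambda>\<omega>. indicator {\<omega>. Z k0 \<omega> \<in> C} \<omega>) \<omega>
      = (\<Sum>S\<in>Pow D. w S \<omega> * enn2real (block_kernel (fst k0) S C (data D \<omega>)))"
proof -
  let ?P = "PiM D (\<lambda>_. borel :: 'a measure)"
  let ?F = "gen_sigma M (Z ` D)"
  have sub: "subalgebra M ?F" by (rule subalgebra_gen_sigma) auto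
  interpret F: finite_measure_subalgebra M ?F by unfold_locales (rule sub)
  define L where "L = distr M ?P (data D)"
  define Q where "Q S = distr (density (M \<Otimes>\<^sub>M G0) (\<lambda>x. cond_block_weight D k0 S (fst x))) ?P (resampled_data D S)" for S
  interpret L: prob_space L unfolding L_def by (rule prob_space_distr) simp
  have L_sets[measurable_cong]: "sets L = sets ?P" and Q_sets[measurable_cong]: "sets (Q S) = sets ?P" for S
    by (simp_all add: L_def Q_def)
  have Q_int: "integral\<^sup>N (Q S) f = (\<integral>\<^sup>+x. cond_block_weight D k0 S (fst x) * f (resampled_data D S x) \<partial>(M \<Otimes>\<^sub>M G0))"
    if [measurable]: "f \<in> borel_measurable ?P" for S f
    unfolding Q_def by (simp add: nn_integral_distr nn_integral_density)
  have restr: "restrict (resampled D k0 S x) D = resampled_data D S x" "resampled D k0 S x k0 = coord (fst k0) (snd x)" for S x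
    using k0 by (auto simp: resampled_def resampled_data_def)
  have restr': "restrict (\<lambda>k\<in>insert k0 D. Z k \<omega>) D = data D \<omega>" for \<omega>
    by (auto simp: data_def)
  have [measurable]: "(\<lambda>z. restrict z D) \<in> measurable (PiM (insert k0 D) (\<lambda>_. borel :: 'a measure)) ?P"
    by (rule measurable_restrict_subset) auto
  have [measurable]: "(\<lambda>z. z k0) \<in> measurable (PiM (insert k0 D) (\<lambda>_. borel :: 'a measure)) borel"
    by (rule measurable_component_singleton) simp
  have joint: "emeasure M {\<omega> \<in> space M. data D \<omega> \<in> A \<and> Z k0 \<omega> \<in> C}
      = (\<Sum>S\<in>Pow D. \<integral>\<^sup>+z. indicator A z * block_kernel (fst k0) S C z \<partial>Q S)"
    if A[measurable]: "A \<in> sets ?P" and C[measurable]: "C \<in> sets borel" for A C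
  proof -
    have "emeasure M {\<omega> \<in> space M. data D \<omega> \<in> A \<and> Z k0 \<omega> \<in> C}
      = (\<integral>\<^sup>+\<omega>. indicator {\<omega> \<in> space M. data D \<omega> \<in> A \<and> Z k0 \<omega> \<in> C} \<omega> \<partial>M)"
      by (rule nn_integral_indicator[symmetric]) measurable
    also have "\<dots> = (\<integral>\<^sup>+\<omega>. (\<lambda>z. indicator A (restrict z D) * indicator C (z k0)) (\<lambda>k\<in>insert k0 D. Z k \<omega>) \<partial>M)"
      unfolding restr' by (intro nn_integral_cong) (auto split: split_indicator)
    also have "\<dots> = (\<Sum>S\<in>Pow D. \<integral>\<^sup>+x. cond_block_weight D k0 S (fst x) * (\<lambda>z. indicator A (restrict z D) * indicator C (z k0)) (resampled D k0 S x) \<partial>(M \<Otimes>\<^sub>M G0))"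
      by (rule joint_law[OF fD D0 k0 pos]) measurable
    also have "\<dots> = (\<Sum>S\<in>Pow D. \<integral>\<^sup>+z. indicator A z * block_kernel (fst k0) S C z \<partial>Q S)"
    proof (intro sum.cong refl)
      fix S assume "S \<in> Pow D"
      then have S: "S \<subseteq> D" by simp
      note [measurable] = block_kernel_measurable[OF C S]
      show "(\<integral>\<^sup>+x. cond_block_weight D k0 S (fst x) * (\<lambda>z. indicator A (restrict z D) * indicator C (z k0)) (resampled D k0 S x) \<partial>(M \<Otimes>\<^sub>M G0))
         = (\<integral>\<^sup>+z. indicator A z * block_kernel (fst k0) S C z \<partial>Q S)"
        unfolding restr by (subst Q_int, measurable) (rule kernel_step[OF S A C cond_block_weight_measurable])
    qed
    finally show ?thesis .
  qed
  have total: "emeasure L A = (\<Sum>S\<in>Pow D. emeasure (Q S) A)" if A[measurable]: "A \<in> sets ?P" for A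
  proof -
    have "emeasure L A = emeasure M (data D -` A \<inter> space M)"
      unfolding L_def by (rule emeasure_distr) measurable
    also have "data D -` A \<inter> space M = {\<omega> \<in> space M. data D \<omega> \<in> A}" by auto
    also have "emeasure M \<dots> = (\<integral>\<^sup>+\<omega>. indicator {\<omega> \<in> space M. data D \<omega> \<in> A} \<omega> \<partial>M)"
      by (rule nn_integral_indicator[symmetric]) measurable
    also have "\<dots> = (\<integral>\<^sup>+\<omega>. (\<lambda>z. indicator A (restrict z D)) (\<lambda>k\<in>insert k0 D. Z k \<omega>) \<partial>M)"
      unfolding restr' by (intro nn_integral_cong) (auto split: split_indicator)
    also have "\<dots> = (\<Sum>S\<in>Pow D. \<integral>\<^sup>+x. cond_block_weight D k0 S (fst x) * (\<lambda>z. indicator A (restrict z D)) (resampled D k0 S x) \<partial>(M \<Otimes>\<^sub>M G0))"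
      by (rule joint_law[OF fD D0 k0 pos]) measurable
    also have "\<dots> = (\<Sum>S\<in>Pow D. integral\<^sup>N (Q S) (indicator A))"
      unfolding restr by (intro sum.cong refl Q_int[symmetric]) measurable
    also have "\<dots> = (\<Sum>S\<in>Pow D. emeasure (Q S) A)"
      using A by (intro sum.cong refl nn_integral_indicator) (simp add: Q_sets)
    finally show ?thesis .
  qed
  define r where "r S = RN_deriv L (Q S)" for S
  have r[measurable]: "r S \<in> borel_measurable ?P" for S
    using borel_measurable_RN_deriv[of L "Q S"] by (simp add: r_def cong: measurable_cong_sets add: L_sets)
  have dens: "density L (r S) = Q S" if S: "S \<in> Pow D" for S
    unfolding r_def
  proof (rule L.density_RN_deriv)
    show "absolutely_continuous L (Q S)"
      unfolding absolutely_continuous_def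
    proof
      fix A assume A: "A \<in> null_sets L"
      then have "A \<in> sets ?P" "emeasure L A = 0" by (auto simp: L_sets)
      then have "(\<Sum>S\<in>Pow D. emeasure (Q S) A) = 0" using total by simp
      then have "emeasure (Q S) A = 0" using S fD by (simp add: sum_eq_0_iff)
      then show "A \<in> null_sets (Q S)" using \<open>A \<in> sets ?P\<close> by (auto simp: Q_sets)
    qed
    show "sets (Q S) = sets L" by (simp add: L_sets Q_sets)
  qed
  have r_int: "integral\<^sup>N (Q S) f = (\<integral>\<^sup>+\<omega>. r S (data D \<omega>) * f (data D \<omega>) \<partial>M)"
    if S: "S \<in> Pow D" and [measurable]: "f \<in> borel_measurable ?P" for S f
  proof -
    have "integral\<^sup>N (Q S) f = integral\<^sup>N (density L (r S)) f" by (simp only: dens[OF S])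
    also have "\<dots> = (\<integral>\<^sup>+z. r S z * f z \<partial>L)" by (rule nn_integral_density) measurable
    also have "\<dots> = (\<integral>\<^sup>+\<omega>. r S (data D \<omega>) * f (data D \<omega>) \<partial>M)"
      unfolding L_def by (rule nn_integral_distr) measurable
    finally show ?thesis .
  qed
  have sum1: "AE z in L. (\<Sum>S\<in>Pow D. r S z) = 1"
  proof -
    have "density L (\<lambda>z. \<Sum>S\<in>Pow D. r S z) = density L (\<lambda>_. 1)"
    proof (rule measure_eqI)
      fix A assume "A \<in> sets (density L (\<lambda>z. \<Sum>S\<in>Pow D. r S z))"
      then have A[measurable]: "A \<in> sets ?P" by (simp add: L_sets)
      have "emeasure (density L (\<lambda>z. \<Sum>S\<in>Pow D. r S z)) A = (\<Sum>S\<in>Pow D. \<integral>\<^sup>+z. r S z * indicator A z \<partial>L)"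
        by (subst emeasure_density) (auto simp: sum_distrib_right nn_integral_sum)
      also have "\<dots> = (\<Sum>S\<in>Pow D. emeasure (density L (r S)) A)"
        by (intro sum.cong refl emeasure_density[symmetric]) measurable
      also have "\<dots> = (\<Sum>S\<in>Pow D. emeasure (Q S) A)" by (simp add: dens)
      also have "\<dots> = emeasure (density L (\<lambda>_. 1)) A"
        using total[OF A] by (simp add: density_1)
      finally show "emeasure (density L (\<lambda>z. \<Sum>S\<in>Pow D. r S z)) A = emeasure (density L (\<lambda>_. 1)) A" .
    qed simp
    then show ?thesis by (subst (asm) L.density_unique_iff) auto
  qed
  \<comment> \<open>The densities sum to 1 only almost surely. On the exceptional set all weight
    goes to the empty block, so that the sum is 1 at every point.\<close>
  define wt where "wt S z = (if (\<Sum>S\<in>Pow D. r S z) = 1 then enn2real (r S z) else if S = {} then 1 else 0)" for S z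
  have wt_meas[measurable]: "wt S \<in> borel_measurable ?P" for S
    unfolding wt_def[abs_def] by measurable
  have r_fin: "r S z = ennreal (enn2real (r S z))" if "(\<Sum>S\<in>Pow D. r S z) = 1" "S \<in> Pow D" for S z
  proof -
    have "r S z \<le> (\<Sum>S\<in>Pow D. r S z)" using that fD by (intro member_le_sum) auto
    then have "r S z < top" using that by (simp add: le_less_trans)
    then show ?thesis by simp
  qed
  have wt_sum: "(\<Sum>S\<in>Pow D. wt S z) = 1" for z
  proof (cases "(\<Sum>S\<in>Pow D. r S z) = 1")
    case True
    have "ennreal (\<Sum>S\<in>Pow D. wt S z) = (\<Sum>S\<in>Pow D. ennreal (wt S z))"
      by (rule sum_ennreal[symmetric]) (simp add: wt_def)
    also have "\<dots> = (\<Sum>S\<in>Pow D. r S z)"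
      using True by (intro sum.cong refl) (simp only: wt_def if_P r_fin[OF True, symmetric])
    finally have "ennreal (\<Sum>S\<in>Pow D. wt S z) = ennreal 1" using True by simp
    then show ?thesis by (subst (asm) ennreal_inj) (auto simp: wt_def intro!: sum_nonneg)
  next
    case False
    then have "(\<Sum>S\<in>Pow D. wt S z) = (\<Sum>S\<in>Pow D. if S = {} then 1 else 0)"
      by (intro sum.cong) (auto simp: wt_def)
    then show ?thesis using fD by simp
  qed
  have wt_nn: "0 \<le> wt S z" for S z by (simp add: wt_def)
  have AE1: "AE \<omega> in M. \<forall>S\<in>Pow D. r S (data D \<omega>) = ennreal (wt S (data D \<omega>))"
  proof -
    have "AE \<omega> in M. (\<Sum>S\<in>Pow D. r S (data D \<omega>)) = 1"
      using sum1 unfolding L_def by (subst (asm) AE_distr_iff) auto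
    then show ?thesis
    proof eventually_elim
      fix \<omega> assume 1: "(\<Sum>S\<in>Pow D. r S (data D \<omega>)) = 1"
      show "\<forall>S\<in>Pow D. r S (data D \<omega>) = ennreal (wt S (data D \<omega>))"
        unfolding wt_def if_P[OF 1] using r_fin[OF 1] by blast
    qed
  qed
  have AE_cond: "AE \<omega> in M. real_cond_exp M ?F (\<lambda>\<omega>. indicator {\<omega>. Z k0 \<omega> \<in> C} \<omega>) \<omega>
      = (\<Sum>S\<in>Pow D. wt S (data D \<omega>) * enn2real (block_kernel (fst k0) S C (data D \<omega>)))"
    if C[measurable]: "C \<in> sets borel" for C
  proof -
    let ?g = "\<lambda>\<omega>. \<Sum>S\<in>Pow D. wt S (data D \<omega>) * enn2real (block_kernel (fst k0) S C (data D \<omega>))"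
    \<comment> \<open>The mixture in the extended reals, where the integrals against
      \<open>Q S\<close> take place; \<open>?g\<close> is its real counterpart.\<close>
    let ?gg = "\<lambda>\<omega>. \<Sum>S\<in>Pow D. r S (data D \<omega>) * block_kernel (fst k0) S C (data D \<omega>)"
    have km: "block_kernel (fst k0) S C \<in> borel_measurable ?P" if "S \<in> Pow D" for S
      by (rule block_kernel_measurable) (use C that in auto)
    have km': "(\<lambda>\<omega>. block_kernel (fst k0) S C (data D \<omega>)) \<in> borel_measurable M" if "S \<in> Pow D" for S
      by (rule measurable_compose[OF data_measurable km[OF that]])
    have g_meas: "?g \<in> borel_measurable ?F"
    proof (intro borel_measurable_sum borel_measurable_times)
      fix S assume "S \<in> Pow D"
      from km[OF this] have [measurable]: "block_kernel (fst k0) S C \<in> borel_measurable ?P" .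
      note [measurable] = measurable_data_gen_sigma[of D]
      show "(\<lambda>\<omega>. wt S (data D \<omega>)) \<in> borel_measurable ?F" by measurable
      show "(\<lambda>\<omega>. enn2real (block_kernel (fst k0) S C (data D \<omega>))) \<in> borel_measurable ?F" by measurable
    qed
    have g_measM[measurable]: "?g \<in> borel_measurable M" by (rule measurable_from_subalg[OF sub g_meas])
    have gg_meas[measurable]: "?gg \<in> borel_measurable M"
      using km' by (intro borel_measurable_sum borel_measurable_times_ennreal) auto
    have gg_int: "(\<integral>\<^sup>+\<omega>. indicator (data D -` A \<inter> space M) \<omega> * ?gg \<omega> \<partial>M) = emeasure M {\<omega> \<in> space M. data D \<omega> \<in> A \<and> Z k0 \<omega> \<in> C}"
      if A[measurable]: "A \<in> sets ?P" for A
    proof -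
      have "emeasure M {\<omega> \<in> space M. data D \<omega> \<in> A \<and> Z k0 \<omega> \<in> C}
        = (\<Sum>S\<in>Pow D. \<integral>\<^sup>+\<omega>. r S (data D \<omega>) * (indicator A (data D \<omega>) * block_kernel (fst k0) S C (data D \<omega>)) \<partial>M)"
        unfolding joint[OF A C] using km by (intro sum.cong refl r_int) auto
      also have "\<dots> = (\<integral>\<^sup>+\<omega>. (\<Sum>S\<in>Pow D. r S (data D \<omega>) * (indicator A (data D \<omega>) * block_kernel (fst k0) S C (data D \<omega>))) \<partial>M)"
        using km' by (intro nn_integral_sum[symmetric]) auto
      also have "\<dots> = (\<integral>\<^sup>+\<omega>. indicator (data D -` A \<inter> space M) \<omega> * ?gg \<omega> \<partial>M)"
        by (intro nn_integral_cong) (auto simp: sum_distrib_left split: split_indicator)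
      finally show ?thesis ..
    qed
    have "(\<integral>\<^sup>+\<omega>. ?gg \<omega> \<partial>M) = (\<integral>\<^sup>+\<omega>. indicator (data D -` space ?P \<inter> space M) \<omega> * ?gg \<omega> \<partial>M)"
      using measurable_space[OF data_measurable] by (intro nn_integral_cong) (auto split: split_indicator)
    also have "\<dots> \<noteq> \<infinity>" by (subst gg_int) (auto simp: emeasure_eq_measure)
    \<comment> \<open>\<open>Ker\<close> need not be finite at exceptional points. Finiteness of the
      mixture is read off from its integral, which is a probability.\<close>
    finally have "AE \<omega> in M. ?gg \<omega> \<noteq> \<infinity>" by (intro nn_integral_PInf_AE gg_meas)
    with AE1 have geq: "AE \<omega> in M. ennreal (?g \<omega>) = ?gg \<omega>"
    proof eventually_elim
      fix \<omega> assume 1: "\<forall>S\<in>Pow D. r S (data D \<omega>) = ennreal (wt S (data D \<omega>))" and 2: "?gg \<omega> \<noteq> \<infinity>"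
      have "ennreal (?g \<omega>) = (\<Sum>S\<in>Pow D. ennreal (wt S (data D \<omega>) * enn2real (block_kernel (fst k0) S C (data D \<omega>))))"
        by (rule sum_ennreal[symmetric]) (use wt_nn in auto)
      also have "\<dots> = ?gg \<omega>"
      proof (intro sum.cong refl)
        fix S assume S: "S \<in> Pow D"
        \<comment> \<open>If the kernel is infinite here, finiteness of the product forces the
          weight to be 0, and then both sides are 0.\<close>
        have "r S (data D \<omega>) * block_kernel (fst k0) S C (data D \<omega>) \<le> ?gg \<omega>" using S fD by (intro member_le_sum) auto
        then have fin: "r S (data D \<omega>) * block_kernel (fst k0) S C (data D \<omega>) \<noteq> \<infinity>" using 2 by (auto simp: top_unique)
        show "ennreal (wt S (data D \<omega>) * enn2real (block_kernel (fst k0) S C (data D \<omega>))) = r S (data D \<omega>) * block_kernel (fst k0) S C (data D \<omega>)"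
          using fin 1 S wt_nn[of S "data D \<omega>"]
          by (cases "block_kernel (fst k0) S C (data D \<omega>)") (auto simp: ennreal_mult' ennreal_mult_top split: if_splits)
      qed
      finally show "ennreal (?g \<omega>) = ?gg \<omega>" .
    qed
    have g_nn: "0 \<le> ?g \<omega>" for \<omega> using wt_nn by (auto intro!: sum_nonneg)
    show ?thesis
    proof (rule F.real_cond_exp_charact)
      show "integrable M (\<lambda>\<omega>. indicator {\<omega>. Z k0 \<omega> \<in> C} \<omega> :: real)"
      proof (rule integrable_const_bound[where B=1])
        have "(\<lambda>\<omega>. indicator {\<omega>. Z k0 \<omega> \<in> C} \<omega> :: real) = (\<lambda>\<omega>. indicator C (Z k0 \<omega>))" by (auto simp: indicator_def)
        also have "\<dots> \<in> borel_measurable M" by measurable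
        finally show "(\<lambda>\<omega>. indicator {\<omega>. Z k0 \<omega> \<in> C} \<omega> :: real) \<in> borel_measurable M" .
      qed auto
      have int_eq: "(\<integral>\<^sup>+\<omega>. ennreal (indicator (data D -` A \<inter> space M) \<omega> * ?g \<omega>) \<partial>M) = emeasure M {\<omega> \<in> space M. data D \<omega> \<in> A \<and> Z k0 \<omega> \<in> C}"
        if A: "A \<in> sets ?P" for A
        unfolding gg_int[OF A, symmetric]
      proof (rule nn_integral_cong_AE)
        show "AE \<omega> in M. ennreal (indicator (data D -` A \<inter> space M) \<omega> * ?g \<omega>) = indicator (data D -` A \<inter> space M) \<omega> * ?gg \<omega>"
          using geq by eventually_elim (auto split: split_indicator)
      qed
      show g_int: "integrable M ?g"
      proof (rule integrableI_nonneg)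
        have "(\<integral>\<^sup>+\<omega>. ennreal (?g \<omega>) \<partial>M) = (\<integral>\<^sup>+\<omega>. ennreal (indicator (data D -` space ?P \<inter> space M) \<omega> * ?g \<omega>) \<partial>M)"
          using measurable_space[OF data_measurable] by (intro nn_integral_cong) (auto split: split_indicator)
        also have "\<dots> < \<infinity>" by (subst int_eq) (auto simp: emeasure_eq_measure)
        finally show "(\<integral>\<^sup>+\<omega>. ennreal (?g \<omega>) \<partial>M) < \<infinity>" .
      qed (use g_nn in auto)
      show "?g \<in> borel_measurable ?F" by (rule g_meas)
      fix E assume "E \<in> sets ?F"
      then obtain A where A[measurable]: "A \<in> sets ?P" and E: "E = data D -` A \<inter> space M" by (rule sets_gen_sigma_data)
      have Em[measurable]: "E \<in> sets M" unfolding E by measurable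
      have "(\<integral>\<omega>\<in>E. indicator {\<omega>. Z k0 \<omega> \<in> C} \<omega> \<partial>M) = (\<integral>\<omega>. indicator {\<omega> \<in> space M. data D \<omega> \<in> A \<and> Z k0 \<omega> \<in> C} \<omega> \<partial>M)"
        unfolding set_lebesgue_integral_def E by (intro Bochner_Integration.integral_cong) (auto split: split_indicator)
      also have "\<dots> = measure M {\<omega> \<in> space M. data D \<omega> \<in> A \<and> Z k0 \<omega> \<in> C}"
        by (subst Bochner_Integration.integral_indicator) (auto intro!: arg_cong[where f="measure M"])
      also have "\<dots> = enn2real (\<integral>\<^sup>+\<omega>. ennreal (indicator E \<omega> * ?g \<omega>) \<partial>M)"
        unfolding E int_eq[OF A] by (simp add: measure_def)
      also have "\<dots> = (\<integral>\<omega>. indicator E \<omega> * ?g \<omega> \<partial>M)"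
        by (rule integral_eq_nn_integral[symmetric]) (use g_nn in \<open>auto intro!: borel_measurable_times\<close>)
      also have "\<dots> = (\<integral>\<omega>\<in>E. ?g \<omega> \<partial>M)" by (simp add: set_lebesgue_integral_def)
      finally show "(\<integral>\<omega>\<in>E. indicator {\<omega>. Z k0 \<omega> \<in> C} \<omega> \<partial>M) = (\<integral>\<omega>\<in>E. ?g \<omega> \<partial>M)" .
    qed
  qed
  show thesis
  proof (rule that[of "\<lambda>S \<omega>. wt S (data D \<omega>)"])
    show "(\<lambda>\<omega>. wt S (data D \<omega>)) \<in> borel_measurable ?F" for S
      by (rule measurable_compose[OF measurable_data_gen_sigma wt_meas])
  qed (use wt_nn wt_sum AE_cond in auto)
qed

end

text \<open>Several blocks may have representatives with the same observed value. The theorem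
  attaches one weight to each distinct value, so the weights of these blocks are added up.\<close>

lemma sum_grouped:
  fixes w :: "'s \<Rightarrow> real"
  assumes "finite P" "finite V" "\<And>S. S \<in> P \<Longrightarrow> s S \<in> V"
  shows "(\<Sum>x\<in>V. (\<Sum>S\<in>P. if s S = x then w S else 0) * f x) = (\<Sum>S\<in>P. w S * f (s S))"
proof -
  have "(\<Sum>x\<in>V. (\<Sum>S\<in>P. if s S = x then w S else 0) * f x) = (\<Sum>x\<in>V. \<Sum>S\<in>P. if s S = x then w S * f (s S) else 0)"
    by (auto simp: sum_distrib_right intro!: sum.cong)
  also have "\<dots> = (\<Sum>S\<in>P. \<Sum>x\<in>V. if s S = x then w S * f (s S) else 0)" by (rule sum.swap)
  also have "\<dots> = (\<Sum>S\<in>P. w S * f (s S))"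
    using assms by (intro sum.cong) auto
  finally show ?thesis .
qed

section \<open>Weights of the distinct observed values\<close>

context furbi begin

text \<open>\<open>b\<close> is the side of the new observation, so that one argument serves both
  predictive laws.\<close>

lemma predictive_grouped:
  fixes N :: "bool \<Rightarrow> nat" and b :: bool
  assumes N: "\<And>b. 1 \<le> N b"
  defines "D \<equiv> {k. snd k \<in> {1..N (fst k)}}"
  shows "\<exists>(\<xi>0::'w \<Rightarrow> real) (\<xi>x::'w \<Rightarrow> 'a \<Rightarrow> real) (\<xi>y::'w \<Rightarrow> 'a \<Rightarrow> real).
       \<xi>0 \<in> borel_measurable (gen_sigma M (Z ` D)) \<and>
       (\<forall>i\<in>{1..N b}. (\<lambda>\<omega>. \<xi>x \<omega> (Z (b, i) \<omega>)) \<in> borel_measurable (gen_sigma M (Z ` D))) \<and>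
       (\<forall>j\<in>{1..N (\<not> b)}. (\<lambda>\<omega>. \<xi>y \<omega> (Z (\<not> b, j) \<omega>)) \<in> borel_measurable (gen_sigma M (Z ` D))) \<and>
       (\<forall>\<omega>\<in>space M. \<xi>0 \<omega> \<ge> 0 \<and> (\<forall>i\<in>{1..N b}. \<xi>x \<omega> (Z (b, i) \<omega>) \<ge> 0) \<and>
                     (\<forall>j\<in>{1..N (\<not> b)}. \<xi>y \<omega> (Z (\<not> b, j) \<omega>) \<ge> 0) \<and>
          \<xi>0 \<omega> + (\<Sum>x\<in>(\<lambda>i. Z (b, i) \<omega>) ` {1..N b}. \<xi>x \<omega> x) + (\<Sum>y\<in>(\<lambda>j. Z (\<not> b, j) \<omega>) ` {1..N (\<not> b)}. \<xi>y \<omega> y) = 1) \<and>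
       (\<forall>C\<in>sets borel. AE \<omega> in M.
          real_cond_exp M (gen_sigma M (Z ` D)) (\<lambda>\<omega>. indicator {\<omega>. Z (b, Suc (N b)) \<omega> \<in> C} \<omega>) \<omega>
          = \<xi>0 \<omega> * measure P0 C + (\<Sum>x\<in>(\<lambda>i. Z (b, i) \<omega>) ` {1..N b}. \<xi>x \<omega> x * indicator C x)
            + (\<Sum>y\<in>(\<lambda>j. Z (\<not> b, j) \<omega>) ` {1..N (\<not> b)}. \<xi>y \<omega> y * measure (Ker b y) C))"
proof -
  let ?F = "gen_sigma M (Z ` D)"
  let ?k0 = "(b, Suc (N b))"
  have D_alt: "D = Sigma UNIV (\<lambda>b. {1..N b})" unfolding D_def by auto
  have fD: "finite D" unfolding D_alt by (intro finite_SigmaI) auto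
  have k0: "?k0 \<notin> D" by (simp add: D_def)
  have D0: "0 \<notin> snd ` insert ?k0 D" by (auto simp: D_def)
  \<comment> \<open>Index 1 is observed on both sides because both sample sizes are at least
    1.\<close>
  have pos: "0 < side_count c (insert ?k0 D)" for c
    by (rule side_count_pos[of _ "(c, 1)"]) (use fD N[of c] in \<open>auto simp: D_def\<close>)
  obtain w where w_meas[measurable]: "\<And>S. w S \<in> borel_measurable ?F"
    and w_nn: "\<And>S \<omega>. 0 \<le> w S \<omega>" and w_sum: "\<And>\<omega>. (\<Sum>S\<in>Pow D. w S \<omega>) = 1"
    and w_cond: "\<And>C. C \<in> sets borel \<Longrightarrow> AE \<omega> in M.
        real_cond_exp M ?F (\<lambda>\<omega>. indicator {\<omega>. Z ?k0 \<omega> \<in> C} \<omega>) \<omega>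
      = (\<Sum>S\<in>Pow D. w S \<omega> * enn2real (block_kernel (fst ?k0) S C (data D \<omega>)))"
    using predictive_mixture[OF fD D0 k0 pos] by blast
  \<comment> \<open>\<open>P1\<close> holds the blocks with an earlier observation of the same side,
    which repeat a value; \<open>P2\<close> holds the other nonempty blocks, which draw from
    \<open>Ker\<close>.\<close>
  define P1 where "P1 = {S \<in> Pow D. \<exists>k\<in>S. fst k = b}"
  define P2 where "P2 = {S \<in> Pow D. S \<noteq> {} \<and> \<not> (\<exists>k\<in>S. fst k = b)}"
  have fP: "finite P1" "finite P2" using fD by (auto simp: P1_def P2_def)
  have part: "Pow D = insert {} (P1 \<union> P2)" "{} \<notin> P1 \<union> P2" "P1 \<inter> P2 = {}"
    by (auto simp: P1_def P2_def)
  have split: "(\<Sum>S\<in>Pow D. f S) = f {} + (\<Sum>S\<in>P1. f S) + (\<Sum>S\<in>P2. f S)" for f :: "(bool \<times> nat) set \<Rightarrow> real"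
    unfolding part(1) using fP part(2,3) by (simp add: sum.union_disjoint)
  have sel1: "\<exists>i\<in>{1..N b}. representative b S = (b, i)" "S \<noteq> {}" "representative b S \<in> D" if "S \<in> P1" for S
  proof -
    have ex: "\<exists>k\<in>S. fst k = b" and S: "S \<subseteq> D" using that by (auto simp: P1_def)
    then show "S \<noteq> {}" by auto
    then show "representative b S \<in> D" using representative_in[of S b] S by auto
    then show "\<exists>i\<in>{1..N b}. representative b S = (b, i)" using fst_representative[OF ex] by (cases "representative b S") (auto simp: D_def)
  qed
  have sel2: "\<exists>j\<in>{1..N (\<not> b)}. representative b S = (\<not> b, j)" "representative b S \<in> D" if "S \<in> P2" for S
  proof -
    have ex: "S \<noteq> {}" "\<not> (\<exists>k\<in>S. fst k = b)" and S: "S \<subseteq> D" using that by (auto simp: P2_def)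
    then show "representative b S \<in> D" using representative_in[of S b] S by auto
    then show "\<exists>j\<in>{1..N (\<not> b)}. representative b S = (\<not> b, j)" using fst_representative'[OF ex] by (cases "representative b S") (auto simp: D_def)
  qed
  define grp where "grp P \<omega> x = (\<Sum>S\<in>P. if Z (representative b S) \<omega> = x then w S \<omega> else 0)" for P \<omega> x
  have grp_nn: "0 \<le> grp P \<omega> x" for P \<omega> x unfolding grp_def using w_nn by (intro sum_nonneg) auto
  have grp_meas: "(\<lambda>\<omega>. grp P \<omega> (Z k \<omega>)) \<in> borel_measurable ?F"
    if k: "k \<in> D" and P: "\<And>S. S \<in> P \<Longrightarrow> representative b S \<in> D" for P k
    unfolding grp_def
  proof (rule borel_measurable_sum)
    fix S assume "S \<in> P"
    then have [measurable]: "Z (representative b S) \<in> measurable ?F borel" "Z k \<in> measurable ?F borel"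
      using P k by (auto intro!: measurable_gen_sigma)
    \<comment> \<open>Equality of two observations is an event because the diagonal of a Polish
      space is measurable for the product sigma-algebra.\<close>
    show "(\<lambda>\<omega>. if Z (representative b S) \<omega> = Z k \<omega> then w S \<omega> else 0) \<in> borel_measurable ?F"
      by measurable
  qed
  have grp1: "(\<Sum>x\<in>(\<lambda>i. Z (b, i) \<omega>) ` {1..N b}. grp P1 \<omega> x * f x) = (\<Sum>S\<in>P1. w S \<omega> * f (Z (representative b S) \<omega>))" for f \<omega>
    unfolding grp_def by (rule sum_grouped[OF fP(1)]) (use sel1(1) in force)+
  have grp2: "(\<Sum>y\<in>(\<lambda>j. Z (\<not> b, j) \<omega>) ` {1..N (\<not> b)}. grp P2 \<omega> y * f y) = (\<Sum>S\<in>P2. w S \<omega> * f (Z (representative b S) \<omega>))" for f \<omega>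
    unfolding grp_def by (rule sum_grouped[OF fP(2)]) (use sel2(1) in force)+
  show ?thesis
  proof (intro exI conjI ballI)
    show "w {} \<in> borel_measurable ?F" by simp
    show "(\<lambda>\<omega>. grp P1 \<omega> (Z (b, i) \<omega>)) \<in> borel_measurable ?F" if "i \<in> {1..N b}" for i
      by (rule grp_meas) (use that sel1 in \<open>auto simp: D_def\<close>)
    show "(\<lambda>\<omega>. grp P2 \<omega> (Z (\<not> b, j) \<omega>)) \<in> borel_measurable ?F" if "j \<in> {1..N (\<not> b)}" for j
      by (rule grp_meas) (use that sel2 in \<open>auto simp: D_def\<close>)
    fix \<omega>
    show "0 \<le> w {} \<omega>" "\<And>x. 0 \<le> grp P1 \<omega> x" "\<And>x. 0 \<le> grp P2 \<omega> x" by (fact w_nn grp_nn)+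
    show "w {} \<omega> + (\<Sum>x\<in>(\<lambda>i. Z (b, i) \<omega>) ` {1..N b}. grp P1 \<omega> x) + (\<Sum>y\<in>(\<lambda>j. Z (\<not> b, j) \<omega>) ` {1..N (\<not> b)}. grp P2 \<omega> y) = 1"
      using grp1[of \<omega> "\<lambda>_. 1"] grp2[of \<omega> "\<lambda>_. 1"] w_sum[of \<omega>] by (simp add: split)
  next
    fix C :: "'a set" assume C: "C \<in> sets borel"
    show "AE \<omega> in M.
          real_cond_exp M ?F (\<lambda>\<omega>. indicator {\<omega>. Z (b, Suc (N b)) \<omega> \<in> C} \<omega>) \<omega>
          = w {} \<omega> * measure P0 C + (\<Sum>x\<in>(\<lambda>i. Z (b, i) \<omega>) ` {1..N b}. grp P1 \<omega> x * indicator C x)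
            + (\<Sum>y\<in>(\<lambda>j. Z (\<not> b, j) \<omega>) ` {1..N (\<not> b)}. grp P2 \<omega> y * measure (Ker b y) C)"
      using w_cond[OF C]
    proof eventually_elim
      fix \<omega>
      assume *: "real_cond_exp M ?F (\<lambda>\<omega>. indicator {\<omega>. Z ?k0 \<omega> \<in> C} \<omega>) \<omega>
        = (\<Sum>S\<in>Pow D. w S \<omega> * enn2real (block_kernel (fst ?k0) S C (data D \<omega>)))"
      have 0: "enn2real (block_kernel b {} C (data D \<omega>)) = measure P0 C" by (simp add: block_kernel_def measure_def)
      have 1: "enn2real (block_kernel b S C (data D \<omega>)) = indicator C (Z (representative b S) \<omega>)" if "S \<in> P1" for S
      proof -
        have ex: "\<exists>k\<in>S. fst k = b" using that by (simp add: P1_def)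
        show ?thesis unfolding block_kernel_def if_not_P[OF sel1(2)[OF that]] if_P[OF ex]
          using sel1(3)[OF that] by (simp add: data_def indicator_def)
      qed
      have 2: "enn2real (block_kernel b S C (data D \<omega>)) = measure (Ker b (Z (representative b S) \<omega>)) C" if "S \<in> P2" for S
      proof -
        have ex: "S \<noteq> {}" "\<not> (\<exists>k\<in>S. fst k = b)" using that by (auto simp: P2_def)
        show ?thesis unfolding block_kernel_def if_not_P[OF ex(1)] if_not_P[OF ex(2)]
          using sel2(2)[OF that] by (simp add: data_def measure_def)
      qed
      show "real_cond_exp M ?F (\<lambda>\<omega>. indicator {\<omega>. Z (b, Suc (N b)) \<omega> \<in> C} \<omega>) \<omega>
          = w {} \<omega> * measure P0 C + (\<Sum>x\<in>(\<lambda>i. Z (b, i) \<omega>) ` {1..N b}. grp P1 \<omega> x * indicator C x)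
            + (\<Sum>y\<in>(\<lambda>j. Z (\<not> b, j) \<omega>) ` {1..N (\<not> b)}. grp P2 \<omega> y * measure (Ker b y) C)"
        unfolding * grp1 grp2 split fst_conv 0 by (simp add: 1 2)
    qed
  qed
qed

end

theorem theorem2:
  fixes M :: "'w measure"
    and lam :: "'a::polish_space measure"
    and g0 :: "'a \<times> 'a \<Rightarrow> real" and p0 :: "'a \<Rightarrow> real"
    and \<theta> :: real
    and \<rho> :: "(real \<times> real) measure"
    and \<mu>1 \<mu>2 :: "'w \<Rightarrow> ('a \<times> 'a) measure"
    and X Y :: "nat \<Rightarrow> 'w \<Rightarrow> 'a"
    and n m :: nat
  defines "G0 \<equiv> density (lam \<Otimes>\<^sub>M lam) (\<lambda>z. ennreal (g0 z))"
    and "P0 \<equiv> density lam (\<lambda>x. ennreal (p0 x))"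
    and "Fp \<equiv> gen_sigma M ({(\<lambda>\<omega>. nmarg1 (\<mu>1 \<omega>) A) | A. A \<in> sets borel}
                            \<union> {(\<lambda>\<omega>. nmarg2 (\<mu>2 \<omega>) B) | B. B \<in> sets borel})"
    and "Fd \<equiv> gen_sigma M (X ` {1..n} \<union> Y ` {1..m})"
  assumes M: "prob_space M"
    (* the base measure lambda, densities, G0 and P0 *)
    and lam_sets: "sets lam = sets borel" and lam_sf: "sigma_finite_measure lam"
    and g0_meas: "g0 \<in> borel_measurable (lam \<Otimes>\<^sub>M lam)" and g0_nn: "\<And>z. g0 z \<ge> 0"
    and p0_meas: "p0 \<in> borel_measurable lam" and p0_nn: "\<And>x. p0 x \<ge> 0"
    and G0_prob: "prob_space G0"
    and G0_nonatomic: "\<And>z. emeasure G0 {z} = 0"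
    and G0_fst: "distr G0 lam fst = P0" and G0_snd: "distr G0 lam snd = P0"
    (* the parameter theta and the Levy measure rho *)
    and \<theta>_pos: "\<theta> > 0"
    and \<rho>_sets: "sets \<rho> = sets borel"
    and \<rho>_supp: "emeasure \<rho> (UNIV - ({0..} \<times> {0..} - {(0, 0)})) = 0"
    and \<rho>_int: "(\<integral>\<^sup>+ s. ennreal (min 1 (fst s + snd s)) \<partial>\<rho>) < \<infinity>"
    and \<rho>_marg: "\<And>B. B \<in> sets borel \<Longrightarrow> B \<subseteq> {0<..} \<Longrightarrow>
                   emeasure \<rho> {s. fst s \<in> B} = emeasure \<rho> {s. snd s \<in> B}"
    and \<rho>_inf: "emeasure \<rho> {s. fst s > 0} = \<infinity>"
    (* (mu1, mu2) is a completely random vector with Levy intensity theta rho G0,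
       no fixed atoms and no deterministic part *)
    and \<mu>_sets: "\<And>\<omega>. sets (\<mu>1 \<omega>) = sets (borel \<Otimes>\<^sub>M borel)"
                "\<And>\<omega>. sets (\<mu>2 \<omega>) = sets (borel \<Otimes>\<^sub>M borel)"
    and \<mu>_meas: "\<And>A. A \<in> sets (borel \<Otimes>\<^sub>M borel) \<Longrightarrow>
                   (\<lambda>\<omega>. emeasure (\<mu>1 \<omega>) A) \<in> borel_measurable M"
                "\<And>A. A \<in> sets (borel \<Otimes>\<^sub>M borel) \<Longrightarrow>
                   (\<lambda>\<omega>. emeasure (\<mu>2 \<omega>) A) \<in> borel_measurable M"
    and \<mu>_laplace: "\<And>(r::nat) (A::nat \<Rightarrow> ('a \<times> 'a) set) (l1::nat \<Rightarrow> real) (l2::nat \<Rightarrow> real).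
          (\<forall>i<r. A i \<in> sets (borel \<Otimes>\<^sub>M borel)) \<Longrightarrow> disjoint_family_on A {..<r} \<Longrightarrow>
          (\<forall>i<r. l1 i \<ge> 0 \<and> l2 i \<ge> 0) \<Longrightarrow>
          (\<integral>\<omega>. (\<Prod>i<r. expneg (ennreal (l1 i) * emeasure (\<mu>1 \<omega>) (A i)
                                 + ennreal (l2 i) * emeasure (\<mu>2 \<omega>) (A i))) \<partial>M)
          = (\<Prod>i<r. exp (- (\<theta> * measure G0 (A i) *
               enn2real (\<integral>\<^sup>+ s. ennreal (1 - exp (- (l1 i * fst s + l2 i * snd s))) \<partial>\<rho>))))"
    (* observations: conditionally on (p1, p2), X_i iid p1 and Y_j iid p2, independent *)
    and X_meas: "\<And>i. X i \<in> measurable M borel" and Y_meas: "\<And>j. Y j \<in> measurable M borel"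
    and cond_iid: "\<And>(N::nat) (A::nat \<Rightarrow> 'a set) (B::nat \<Rightarrow> 'a set) E.
          (\<forall>i. A i \<in> sets borel) \<Longrightarrow> (\<forall>j. B j \<in> sets borel) \<Longrightarrow> E \<in> sets Fp \<Longrightarrow>
          measure M ({\<omega> \<in> space M. (\<forall>i\<in>{1..N}. X i \<omega> \<in> A i) \<and> (\<forall>j\<in>{1..N}. Y j \<omega> \<in> B j)} \<inter> E)
          = (\<integral>\<omega>. indicator E \<omega> * (\<Prod>i\<in>{1..N}. nmarg1 (\<mu>1 \<omega>) (A i))
                                 * (\<Prod>j\<in>{1..N}. nmarg2 (\<mu>2 \<omega>) (B j)) \<partial>M)"
    and nm: "n \<ge> 1" "m \<ge> 1"
  shows
   "(\<exists>(\<xi>0::'w \<Rightarrow> real) (\<xi>x::'w \<Rightarrow> 'a \<Rightarrow> real) (\<xi>y::'w \<Rightarrow> 'a \<Rightarrow> real).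
       \<xi>0 \<in> borel_measurable Fd \<and>
       (\<forall>i\<in>{1..n}. (\<lambda>\<omega>. \<xi>x \<omega> (X i \<omega>)) \<in> borel_measurable Fd) \<and>
       (\<forall>j\<in>{1..m}. (\<lambda>\<omega>. \<xi>y \<omega> (Y j \<omega>)) \<in> borel_measurable Fd) \<and>
       (\<forall>\<omega>\<in>space M. \<xi>0 \<omega> \<ge> 0 \<and> (\<forall>i\<in>{1..n}. \<xi>x \<omega> (X i \<omega>) \<ge> 0) \<and>
                     (\<forall>j\<in>{1..m}. \<xi>y \<omega> (Y j \<omega>) \<ge> 0) \<and>
          \<xi>0 \<omega> + (\<Sum>x\<in>(\<lambda>i. X i \<omega>) ` {1..n}. \<xi>x \<omega> x) + (\<Sum>y\<in>(\<lambda>j. Y j \<omega>) ` {1..m}. \<xi>y \<omega> y) = 1) \<and>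
       (\<forall>C\<in>sets borel. AE \<omega> in M.
          real_cond_exp M Fd (\<lambda>\<omega>. indicator {\<omega>. X (Suc n) \<omega> \<in> C} \<omega>) \<omega>
          = \<xi>0 \<omega> * measure P0 C + (\<Sum>x\<in>(\<lambda>i. X i \<omega>) ` {1..n}. \<xi>x \<omega> x * indicator C x)
            + (\<Sum>y\<in>(\<lambda>j. Y j \<omega>) ` {1..m}. \<xi>y \<omega> y * measure (Rker lam g0 p0 y) C)))
  \<and> (\<exists>(\<eta>0::'w \<Rightarrow> real) (\<eta>y::'w \<Rightarrow> 'a \<Rightarrow> real) (\<eta>x::'w \<Rightarrow> 'a \<Rightarrow> real).
       \<eta>0 \<in> borel_measurable Fd \<and>
       (\<forall>j\<in>{1..m}. (\<lambda>\<omega>. \<eta>y \<omega> (Y j \<omega>)) \<in> borel_measurable Fd) \<and>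
       (\<forall>i\<in>{1..n}. (\<lambda>\<omega>. \<eta>x \<omega> (X i \<omega>)) \<in> borel_measurable Fd) \<and>
       (\<forall>\<omega>\<in>space M. \<eta>0 \<omega> \<ge> 0 \<and> (\<forall>j\<in>{1..m}. \<eta>y \<omega> (Y j \<omega>) \<ge> 0) \<and>
                     (\<forall>i\<in>{1..n}. \<eta>x \<omega> (X i \<omega>) \<ge> 0) \<and>
          \<eta>0 \<omega> + (\<Sum>y\<in>(\<lambda>j. Y j \<omega>) ` {1..m}. \<eta>y \<omega> y) + (\<Sum>x\<in>(\<lambda>i. X i \<omega>) ` {1..n}. \<eta>x \<omega> x) = 1) \<and>
       (\<forall>C\<in>sets borel. AE \<omega> in M.
          real_cond_exp M Fd (\<lambda>\<omega>. indicator {\<omega>. Y (Suc m) \<omega> \<in> C} \<omega>) \<omega>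
          = \<eta>0 \<omega> * measure P0 C + (\<Sum>y\<in>(\<lambda>j. Y j \<omega>) ` {1..m}. \<eta>y \<omega> y * indicator C y)
            + (\<Sum>x\<in>(\<lambda>i. X i \<omega>) ` {1..n}. \<eta>x \<omega> x * measure (Qker lam g0 p0 x) C)))"
proof -
  interpret furbi M lam g0 p0 \<theta> \<rho> \<mu>1 \<mu>2 X Y G0 P0 Fp
  proof (rule furbi.intro[OF M], rule furbi_axioms.intro)
    show "G0 = density (lam \<Otimes>\<^sub>M lam) (\<lambda>z. ennreal (g0 z))" by (simp add: G0_def)
    show "P0 = density lam (\<lambda>x. ennreal (p0 x))" by (simp add: P0_def)
    show "Fp = gen_sigma M ({(\<lambda>\<omega>. nmarg1 (\<mu>1 \<omega>) A) | A. A \<in> sets borel}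
                            \<union> {(\<lambda>\<omega>. nmarg2 (\<mu>2 \<omega>) B) | B. B \<in> sets borel})"
      by (simp add: Fp_def)
  qed fact+
  \<comment> \<open>One sample size per side, so that \<open>predictive_grouped\<close> at
    \<open>True\<close> and at \<open>False\<close> yields the two claims.\<close>
  define N where "N b = (if b then n else m)" for b
  have N: "1 \<le> N b" for b using nm by (simp add: N_def)
  have Fd: "gen_sigma M (Z ` {k. snd k \<in> {1..N (fst k)}}) = Fd"
  proof -
    have "{k. snd k \<in> {1..N (fst k)}} = Pair True ` {1..n} \<union> Pair False ` {1..m}"
      by (auto simp: N_def split: if_splits)
    then have "Z ` {k. snd k \<in> {1..N (fst k)}} = X ` {1..n} \<union> Y ` {1..m}"
      by (simp only: image_Un image_image) (simp add: Z_def)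
    then show ?thesis by (simp add: Fd_def)
  qed
  show ?thesis
    using predictive_grouped[of N True, OF N, unfolded Fd] predictive_grouped[of N False, OF N, unfolded Fd]
    by (simp only: N_def Z_def Ker_def fst_conv snd_conv if_True if_False not_True_eq_False not_False_eq_True)
qed

end
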